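(* Let $\phi$ be convex and twice differentiable on $\mathbb{R}^{d_1 \times d_2}$ (asymmetric case) or on $\mathbb{S}_d^+$ (symmetric case). For integers $r \ge r_* \ge 1$, denote $$\mu := \mu_{r + r_*}(\phi), \quad L := L_{r + r_*}(\phi), \quad L_2 := L_2^{(r + r_* )}(\phi),$$ and suppose $$\mu > \frac{L_2}{2 \sqrt{r/r_*} + L_2/L}.$$ Let $\lambda \ge 0$. Suppose that - (Asymmetric case) $M_* \in \mathbb{R}^{d_1 \times d_2}$ has rank at most $r_*$ and is a global optimum of $\min_{M \in \mathbb{R}^{d_1 \times d_2}} \phi(M) + \lambda \|M\|_{\mathrm{nuc}}$ in the sense that $$\nabla \phi(M_* ) \in -\lambda\, \partial \|M_*\|_{\mathrm{nuc}};$$ $(U, V) \in \mathbb{R}^{d_1 \times r} \times \mathbb{R}^{d_2 \times r}$ is any second-order critical point of $f_\lambda(U, V) = \phi(U V^\top) + \lambda \frac{\|U\|_F^2 + \|V\|_F^2}{2}$; and $M = U V^\top$; or - (Symmetric case) $M_* \in \mathbb{S}_d^+$ has rank at most $r_*$ and is a global optimum of $\min_{M \succeq 0} \phi(M) + \lambda \operatorname{tr} M$ in the sense that $$(\nabla \phi(M_* ) + \lambda I_d) M_* = 0 \quad \text{and} \quad \nabla \phi(M_* ) + \lambda I_d \succeq 0;$$ $U \in \mathbb{R}^{d \times r}$ is any second-order critical point of $f_\lambda(U) = \phi(U U^\top) + \lambda \|U\|_F^2$; and $M = U U^\top$. Then $M = M_*$.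
   Context: $\mathbb{S}_d$ is the space of symmetric $d \times d$ real matrices and $\mathbb{S}_d^+ \subset \mathbb{S}_d$ the set of positive semidefinite ones. Matrix spaces carry the trace inner product; $\|\cdot\|_F$ is the Frobenius norm, $\|\cdot\|_{\mathrm{nuc}}$ the nuclear norm (sum of singular values), and $\partial \|M\|_{\mathrm{nuc}}$ its convex subdifferential at $M$. For $\phi$ on $\mathbb{S}_d^+$, derivatives are taken relative to $\mathbb{S}_d^+$, so $\nabla \phi(M) \in \mathbb{S}_d$ and $\nabla^2 \phi(M)$ is a symmetric bilinear form on $\mathbb{S}_d$. Restricted strong convexity and smoothness: for integers $k, \ell \ge 1$ and reals $L \ge \mu \ge 0$, $\phi$ on $\mathbb{R}^{d_1 \times d_2}$ (resp. $\mathbb{S}_d^+$) has $(k, \ell, \mu, L)$-restricted strong convexity and smoothness if it is twice differentiable and, for all $M, E \in \mathbb{R}^{d_1 \times d_2}$ (resp. $M \in \mathbb{S}_d^+$, $E \in \mathbb{S}_d$) with $\operatorname{rank}(M) \le \ell$ and $\operatorname{rank}(E) \le k$, $$\mu \|E\|_F^2 \le \nabla^2 \phi(M)[E, E] \le L \|E\|_F^2.$$ $\mu_k^{(\ell)}(\phi)$ and $L_k^{(\ell)}(\phi)$ denote the optimal (largest, respectively smallest) values of $\mu$ and $L$ for which this holds (the values used are finite), and $\mu_k(\phi) := \mu_k^{(k)}(\phi)$, $L_k(\phi) := L_k^{(k)}(\phi)$. A second-order critical point of a function $f$ is a point where $\nabla f = 0$ and $\nabla^2 f \succeq 0$. *)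

theory Defs
  imports "HOL-Analysis.Analysis"
begin

section \<open>First and second derivatives relative to a set\<close>

text \<open>
  Functions are considered on a convex set \<open>S\<close>, and derivatives are taken relative to \<open>S\<close>.
  The linear subspace \<open>T\<close> is the direction space of \<open>S\<close>, i.e. the span of the differences of its
  points. Only two pairs \<open>(S, T)\<close> are used: \<open>(UNIV, UNIV)\<close>, and the positive semidefinite
  matrices together with the symmetric matrices. In both, the requirement \<open>g \<in> T\<close> makes the
  gradient unique, and the derivative of the gradient is determined on \<open>T\<close>; so the value
  \<open>hessian S T f x A B\<close> is meaningful for \<open>A\<close>, \<open>B\<close> in \<open>T\<close>, although
  \<^const>\<open>frechet_derivative\<close> within \<open>S\<close> may involve a choice outside \<open>T\<close>.
\<close>

definition gradient ::
  "'a::euclidean_space set \<Rightarrow> 'a set \<Rightarrow> ('a \<Rightarrow> real) \<Rightarrow> 'a \<Rightarrow> 'a" where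
  "gradient S T f x =
     (THE g. g \<in> T \<and> (f has_derivative (\<lambda>h. g \<bullet> h)) (at x within S))"

definition hessian ::
  "'a::euclidean_space set \<Rightarrow> 'a set \<Rightarrow> ('a \<Rightarrow> real) \<Rightarrow> 'a \<Rightarrow> 'a \<Rightarrow> 'a \<Rightarrow> real" where
  "hessian S T f x A B = frechet_derivative (gradient S T f) (at x within S) A \<bullet> B"

definition twice_differentiable_on ::
  "'a::euclidean_space set \<Rightarrow> 'a set \<Rightarrow> ('a \<Rightarrow> real) \<Rightarrow> bool" where
  "twice_differentiable_on S T f \<longleftrightarrow>
     f differentiable_on S \<and> gradient S T f differentiable_on S"

definition second_order_critical :: "('a::euclidean_space \<Rightarrow> real) \<Rightarrow> 'a \<Rightarrow> bool" where
  "second_order_critical f x \<longleftrightarrow>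
     (\<forall>\<^sub>F y in nhds x. f differentiable (at y)) \<and>
     gradient UNIV UNIV f differentiable (at x) \<and>
     gradient UNIV UNIV f x = 0 \<and>
     (\<forall>E. 0 \<le> hessian UNIV UNIV f x E E)"

definition subdifferential :: "('a::euclidean_space \<Rightarrow> real) \<Rightarrow> 'a \<Rightarrow> 'a set" where
  "subdifferential f x = {g. \<forall>y. f x + g \<bullet> (y - x) \<le> f y}"


section \<open>Matrices\<close>

text \<open>
  On \<open>real ^ 'n ^ 'm\<close> the library's inner product is the trace inner product and its
  \<^const>\<open>norm\<close> is the Frobenius norm.
\<close>

definition symmetric_mats :: "(real ^ 'd ^ 'd) set" where
  "symmetric_mats = {A. transpose A = A}"

definition psd_mats :: "(real ^ 'd ^ 'd) set" where
  "psd_mats = {A \<in> symmetric_mats. \<forall>x. 0 \<le> x \<bullet> (A *v x)}"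

text \<open>
  The singular values of \<open>A\<close> are the square roots of the eigenvalues of \<open>A\<^sup>T A\<close>; the multiplicity
  of \<open>\<sigma>\<close> is the dimension of the eigenspace of \<open>A\<^sup>T A\<close> for \<open>\<sigma>\<^sup>2\<close>. The set below lists the distinct
  singular values, so the nuclear norm has to weight them by their multiplicities.
\<close>

definition singular_space :: "real ^ 'n ^ 'm \<Rightarrow> real \<Rightarrow> (real ^ 'n) set" where
  "singular_space A \<sigma> = {v. (transpose A ** A) *v v = \<sigma>\<^sup>2 *\<^sub>R v}"

definition singular_values :: "real ^ 'n ^ 'm \<Rightarrow> real set" where
  "singular_values A = {\<sigma>. 0 \<le> \<sigma> \<and> (\<exists>v \<in> singular_space A \<sigma>. v \<noteq> 0)}"

definition nuclear_norm :: "real ^ 'n ^ 'm \<Rightarrow> real" where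
  "nuclear_norm A = (\<Sum>\<sigma> \<in> singular_values A. real (dim (singular_space A \<sigma>)) * \<sigma>)"


section \<open>Restricted strong convexity and smoothness\<close>

definition restricted_sc_smooth ::
  "(real ^ 'n ^ 'm) set \<Rightarrow> (real ^ 'n ^ 'm) set \<Rightarrow> nat \<Rightarrow> nat \<Rightarrow> real \<Rightarrow> real \<Rightarrow>
    (real ^ 'n ^ 'm \<Rightarrow> real) \<Rightarrow> bool" where
  "restricted_sc_smooth S T k l \<mu> L \<phi> \<longleftrightarrow>
     1 \<le> k \<and> 1 \<le> l \<and> 0 \<le> \<mu> \<and> \<mu> \<le> L \<and>
     twice_differentiable_on S T \<phi> \<and>
     (\<forall>M \<in> S. \<forall>E \<in> T. rank M \<le> l \<longrightarrow> rank E \<le> k \<longrightarrow>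
        \<mu> * (norm E)\<^sup>2 \<le> hessian S T \<phi> M E E \<and>
        hessian S T \<phi> M E E \<le> L * (norm E)\<^sup>2)"

text \<open>
  The optimal constants. They are the intended maximum and minimum only if \<open>\<phi>\<close> satisfies
  \<^const>\<open>restricted_sc_smooth\<close> with some constants; this has to be assumed where they are used.
\<close>

definition rsc_const ::
  "(real ^ 'n ^ 'm) set \<Rightarrow> (real ^ 'n ^ 'm) set \<Rightarrow> nat \<Rightarrow> nat \<Rightarrow> (real ^ 'n ^ 'm \<Rightarrow> real) \<Rightarrow> real" where
  "rsc_const S T k l \<phi> = Sup {\<mu>. \<exists>L. restricted_sc_smooth S T k l \<mu> L \<phi>}"

definition rsm_const ::
  "(real ^ 'n ^ 'm) set \<Rightarrow> (real ^ 'n ^ 'm) set \<Rightarrow> nat \<Rightarrow> nat \<Rightarrow> (real ^ 'n ^ 'm \<Rightarrow> real) \<Rightarrow> real" where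
  "rsm_const S T k l \<phi> = Inf {L. \<exists>\<mu>. restricted_sc_smooth S T k l \<mu> L \<phi>}"

end

theory Submission
  imports Defs
begin

text \<open>
  Let \<open>M\<close> come from the critical point, with singular value decomposition \<open>\<Sum>\<^sub>i p\<^sub>i q\<^sub>i\<^sup>T\<close>, and let \<open>H = M\<^sub>* - M\<close>,
  \<open>g = \<nabla>\<phi>(M\<^sub>*) - \<nabla>\<phi>(M)\<close> and \<open>r = CARD('r)\<close>. Let \<open>F\<close> be the block of \<open>M\<^sub>*\<close> orthogonal to both the column
  space and the row space of \<open>M\<close>. The optimality conditions give \<open>\<langle>g, H\<rangle> \<le> \<langle>g, F\<rangle>\<close>. The second-order
  condition, tested on rank-one perturbations along the smallest singular value \<open>s\<close> of \<open>M\<close>, gives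
  \<open>\<langle>g, H\<rangle> \<le> L\<^sub>2 s \<tau>\<close>, where \<open>\<tau>\<close> is half the squared norm of the parts of the balanced factors of \<open>M\<^sub>*\<close>
  orthogonal to those of \<open>M\<close>; if \<open>M\<close> has rank below \<open>r\<close>, this holds with \<open>s = 0\<close>.
  A geometric inequality bounds \<open>2 c \<surd>(r / r\<^sub>*) s \<tau>\<close> by \<open>c\<^sup>2 |F|\<^sup>2 + |H - F|\<^sup>2\<close> for all \<open>0 < c \<le> 1\<close>.
  All matrices in the span of \<open>H\<close> and \<open>F\<close> have rank at most \<open>r + r\<^sub>*\<close>, so restricted strong convexity
  and smoothness make \<open>\<nabla>\<phi>\<close> cocoercive along the segment from \<open>M\<close> to \<open>M\<^sub>*\<close> when tested against \<open>H\<close>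
  and \<open>F\<close>. For a suitable \<open>c\<close> the assumption on \<open>\<mu>\<close> then leaves only \<open>H = 0\<close>.
\<close>

text \<open>The factor \<open>sqrt (r / rs)\<close> comes from a count: each of the \<open>r\<close>
  singular values of \<open>M\<close> is at least \<open>s\<close>, which would put
  \<open>r s^2\<close> into the squared error, and only \<open>rs\<close> rank-one pieces of the
  optimum can compensate for it. The block \<open>F\<close> gets a weight of its own because the
  optimality conditions compare \<open><g, H>\<close> with \<open><g, F>\<close> only; the right
  weight \<open>c\<close> depends on the ratio of \<open><g, H>\<close> to \<open>|F|^2\<close> and
  is chosen last, once cocoercivity has restricted that ratio. Two obstacles shape the rest. If
  \<open>lam = 0\<close>, the factors \<open>U\<close> and \<open>V\<close> of a critical point need
  not be balanced, so the perturbations use different right vectors for the two factors. In the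
  symmetric case \<open>M\<close> may lie on the boundary of the cone, where derivatives are
  one-sided; even the symmetry of the Hessian, which cocoercivity uses, must be derived from rays
  inside the cone.\<close>

declare transpose_matrix_vector [simp del]

subsection \<open>Outer products\<close>

definition outer :: "real ^ 'm \<Rightarrow> real ^ 'n \<Rightarrow> real ^ 'n ^ 'm" where
  "outer x y = (\<chi> i j. x $ i * y $ j)"

lemma bounded_bilinear_outer: "bounded_bilinear outer"
  by (intro bilinear_conv_bounded_bilinear [THEN iffD1])
    (auto simp: bilinear_def outer_def vec_eq_iff algebra_simps intro!: linearI)

interpretation outer: bounded_bilinear outer
  by (rule bounded_bilinear_outer)

lemma outer_mult_vec: "outer x y *v z = (y \<bullet> z) *\<^sub>R x"
  by (simp add: outer_def matrix_vector_mult_def inner_vec_def vec_eq_iff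
      sum_distrib_left sum_distrib_right mult.commute mult.left_commute)

lemma transpose_outer: "transpose (outer x y) = outer y x"
  by (simp add: outer_def transpose_def mult.commute)

lemma transpose_add: "transpose (A + B) = transpose A + (transpose B :: real ^ 'm ^ 'n)"
  by (simp add: transpose_def vec_eq_iff)

lemma transpose_diff: "transpose (A - B) = transpose A - (transpose B :: real ^ 'm ^ 'n)"
  by (simp add: transpose_def vec_eq_iff)

lemma linear_transpose: "linear (transpose :: real ^ 'n ^ 'm \<Rightarrow> real ^ 'm ^ 'n)"
  by (intro linearI) (auto simp: transpose_add transpose_scalar)

lemma transpose_sum:
  "transpose (\<Sum>i\<in>I. A i) = (\<Sum>i\<in>I. transpose (A i :: real ^ 'n ^ 'm))"
  using linear_sum [OF linear_transpose] .

lemma inner_transpose: "transpose A \<bullet> transpose B = A \<bullet> (B :: real ^ 'n ^ 'm)"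
  unfolding inner_vec_def transpose_def by (simp add: sum.swap [of _ "UNIV :: 'n set"])

lemma inner_outer: "A \<bullet> outer x y = x \<bullet> (A *v y)"
  by (simp add: outer_def inner_vec_def matrix_vector_mult_def sum_distrib_left
      mult.commute mult.left_commute)

lemma inner_outer_outer: "outer a b \<bullet> outer x y = (a \<bullet> x) * (b \<bullet> y)"
  by (simp add: inner_outer outer_mult_vec inner_commute mult.commute)

lemma norm_outer: "norm (outer x y) = norm x * norm y"
  by (simp add: norm_eq_sqrt_inner inner_outer_outer real_sqrt_mult)

lemma matrix_mult_outer: "A ** outer x y = outer (A *v x) y"
  by (simp add: outer_def matrix_matrix_mult_def matrix_vector_mult_def vec_eq_iff
      sum_distrib_right mult.assoc)

lemma outer_matrix_mult: "outer x y ** A = outer x (transpose A *v y)"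
  by (simp add: outer_def matrix_matrix_mult_def matrix_vector_mult_def transpose_def vec_eq_iff
      sum_distrib_left mult.assoc mult.left_commute mult.commute)

lemma inner_matrix_mult_left: "A \<bullet> (B ** C) = (transpose B ** A) \<bullet> (C :: real ^ 'n ^ 'k)"
  for A :: "real ^ 'n ^ 'm"
proof -
  have "A \<bullet> (B ** C) = (\<Sum>i\<in>UNIV. \<Sum>j\<in>UNIV. \<Sum>k\<in>UNIV. A $ i $ j * (B $ i $ k * C $ k $ j))"
    by (simp add: inner_vec_def matrix_matrix_mult_def sum_distrib_left)
  also have "\<dots> = (\<Sum>i\<in>UNIV. \<Sum>k\<in>UNIV. \<Sum>j\<in>UNIV. A $ i $ j * (B $ i $ k * C $ k $ j))"
    by (intro sum.cong refl sum.swap)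
  also have "\<dots> = (\<Sum>k\<in>UNIV. \<Sum>i\<in>UNIV. \<Sum>j\<in>UNIV. A $ i $ j * (B $ i $ k * C $ k $ j))"
    by (rule sum.swap)
  also have "\<dots> = (\<Sum>k\<in>UNIV. \<Sum>j\<in>UNIV. \<Sum>i\<in>UNIV. A $ i $ j * (B $ i $ k * C $ k $ j))"
    by (intro sum.cong refl sum.swap)
  also have "\<dots> = (transpose B ** A) \<bullet> C"
    unfolding inner_vec_def matrix_matrix_mult_def transpose_def
    by (simp only: sum_distrib_right inner_real_def vec_lambda_beta mult.assoc mult.left_commute)
  finally show ?thesis .
qed

lemma inner_matrix_mult_right: "A \<bullet> (B ** C) = (A ** transpose C) \<bullet> (B :: real ^ 'k ^ 'm)"
  for A :: "real ^ 'n ^ 'm"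
proof -
  have "A \<bullet> (B ** C) = transpose A \<bullet> (transpose C ** transpose B)"
    by (metis inner_transpose matrix_transpose_mul)
  also have "\<dots> = (C ** transpose A) \<bullet> transpose B"
    by (simp add: inner_matrix_mult_left)
  also have "\<dots> = (A ** transpose C) \<bullet> B"
    by (metis inner_transpose matrix_transpose_mul transpose_transpose)
  finally show ?thesis .
qed

lemma inner_transpose_vec: "x \<bullet> (A *v y) = (transpose A *v x) \<bullet> (y :: real ^ 'n)"
  for A :: "real ^ 'n ^ 'm"
  by (metis dot_lmul_matrix transpose_matrix_vector)

lemma sum_mult_vec: "(\<Sum>i\<in>I. A i :: real ^ 'n ^ 'm) *v x = (\<Sum>i\<in>I. A i *v x)"
  by (induction I rule: infinite_finite_induct) (auto simp: matrix_vector_mult_add_rdistrib)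

lemma matrix_sum_mult: "(A :: real ^ 'n ^ 'm) *v (\<Sum>i\<in>I. x i) = (\<Sum>i\<in>I. A *v x i)"
  by (rule linear_sum) simp

subsection \<open>Singular value decomposition\<close>

text \<open>A maximiser \<open>e\<close> of \<open>|T x|\<close> on the unit sphere of
  \<open>S\<close> has \<open>T e\<close> orthogonal to \<open>T y\<close> for every
  \<open>y\<close> in \<open>S\<close> orthogonal to \<open>e\<close>; splitting off
  \<open>e\<close> and induction on the dimension give the basis. This replaces the spectral theorem
  twice: for singular vectors, and for the rotation that diagonalises a Gram matrix.\<close>

lemma orthogonal_image_basis_exists:
  fixes T :: "'a::euclidean_space \<Rightarrow> 'b::real_inner"
  assumes "subspace S" "linear T"
  shows "\<exists>B \<subseteq> S. finite B \<and> card B = dim S \<and> span B = S \<and> (\<forall>e\<in>B. norm e = 1) \<and>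
     pairwise orthogonal B \<and> (\<forall>e\<in>B. \<forall>e'\<in>B. e \<noteq> e' \<longrightarrow> T e \<bullet> T e' = 0)"
  using assms(1)
proof (induction "dim S" arbitrary: S)
  case 0
  then have "S = {0}"
    by (metis dim_eq_0 subspace_0 subset_singleton_iff empty_iff)
  then show ?case
    by (intro exI [of _ "{}"]) auto
next
  case (Suc n)
  let ?K = "S \<inter> sphere 0 1"
  interpret T: linear T by fact
  have "S \<noteq> {0}"
    using Suc.hyps(2) by auto
  then obtain z where z: "z \<in> S" "z \<noteq> 0"
    using subspace_0 [OF Suc.prems] by blast
  then have "z /\<^sub>R norm z \<in> ?K"
    using Suc.prems by (simp add: subspace_scale)
  moreover have "compact ?K"
    by (simp add: Suc.prems closed_Int_compact closed_subspace)
  moreover have "continuous_on ?K (\<lambda>x. T x \<bullet> T x)"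
    using linear_continuous_on_compose [OF continuous_on_id assms(2)]
    by (intro continuous_intros) auto
  ultimately obtain e where e: "e \<in> ?K" "\<And>x. x \<in> ?K \<Longrightarrow> T x \<bullet> T x \<le> T e \<bullet> T e"
    using continuous_attains_sup [of ?K "\<lambda>x. T x \<bullet> T x"] by blast
  have e1: "e \<in> S" "norm e = 1" "e \<bullet> e = 1"
    using e(1) by (auto simp: norm_eq_1)
  have max: "T x \<bullet> T x \<le> (T e \<bullet> T e) * (x \<bullet> x)" if "x \<in> S" for x
  proof (cases "x = 0")
    case False
    then have "T (x /\<^sub>R norm x) \<bullet> T (x /\<^sub>R norm x) \<le> T e \<bullet> T e"
      using that Suc.prems by (intro e(2)) (simp add: subspace_scale)
    then have "(T x \<bullet> T x) / (norm x)\<^sup>2 \<le> T e \<bullet> T e"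
      by (simp add: T.scaleR power2_eq_square divide_inverse mult_ac)
    then show ?thesis
      using False by (simp add: divide_simps power2_norm_eq_inner)
  qed (simp add: T.zero)
  have orth: "T e \<bullet> T y = 0" if y: "y \<in> S" "e \<bullet> y = 0" for y
  proof (rule ccontr)
    \<comment> \<open>Moving from \<open>e\<close> to \<open>e + d y\<close> gains
      \<open>2 d k\<close> to first order and loses at most \<open>d^2 C\<close> to second order;
      with \<open>d = k / C\<close> the gain wins.\<close>
    define k where "k = T e \<bullet> T y"
    define C where "C = \<bar>(T e \<bullet> T e) * (y \<bullet> y) - T y \<bullet> T y\<bar> + 1"
    define d where "d = k / C"
    assume "T e \<bullet> T y \<noteq> 0"
    then have k: "k \<noteq> 0" by (simp add: k_def)
    have C: "C > 0" by (simp add: C_def)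
    have "T (e + d *\<^sub>R y) \<bullet> T (e + d *\<^sub>R y) \<le> (T e \<bullet> T e) * ((e + d *\<^sub>R y) \<bullet> (e + d *\<^sub>R y))"
      using y e1 Suc.prems by (intro max) (simp add: subspace_add subspace_scale)
    then have "2 * d * k \<le> d\<^sup>2 * ((T e \<bullet> T e) * (y \<bullet> y) - T y \<bullet> T y)"
      using y e1
      by (simp add: T.add T.scaleR inner_add inner_commute algebra_simps power2_eq_square k_def)
    also have "\<dots> \<le> d\<^sup>2 * C"
      by (intro mult_left_mono) (auto simp: C_def)
    finally have "2 * k\<^sup>2 \<le> k\<^sup>2"
      using C by (simp add: d_def power2_eq_square divide_simps split: if_splits)
    with k show False
      by (simp add: power2_eq_square) (smt (verit) not_sum_squares_lt_zero zero_less_mult_iff)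
  qed
  define S' where "S' = {y \<in> S. e \<bullet> y = 0}"
  have S': "subspace S'" "S' \<subseteq> S"
    using Suc.prems by (auto simp: S'_def subspace_def inner_add_right)
  have "dim {y \<in> S. \<forall>x\<in>span {e}. orthogonal x y} + dim (span {e}) = dim S"
    using e1 Suc.prems
    by (intro dim_subspace_orthogonal_to_vectors) (auto simp: span_minimal)
  moreover have "{y \<in> S. \<forall>x\<in>span {e}. orthogonal x y} = S'"
    by (auto simp: S'_def orthogonal_def span_singleton)
  moreover have "e \<noteq> 0" using e1 by auto
  ultimately have dimS': "n = dim S'"
    using Suc.hyps(2) by (simp add: dim_singleton)
  obtain B where B: "B \<subseteq> S'" "finite B" "card B = dim S'" "span B = S'" "\<forall>e\<in>B. norm e = 1"
    "pairwise orthogonal B" "\<forall>e\<in>B. \<forall>e'\<in>B. e \<noteq> e' \<longrightarrow> T e \<bullet> T e' = 0"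
    using Suc.hyps(1) [OF dimS' S'(1)] by blast
  have eB: "e \<notin> B"
    using B(1) e1 by (auto simp: S'_def)
  have "x \<in> span (insert e B)" if "x \<in> S" for x
  proof -
    have "x - (x \<bullet> e) *\<^sub>R e \<in> S'"
      using that e1 Suc.prems
      by (simp add: S'_def subspace_diff subspace_scale inner_diff_right inner_commute)
    then show ?thesis
      using B(4) by (metis span_breakdown_eq)
  qed
  then have "span (insert e B) = S"
    using e1 B(1) S'(2) Suc.prems by (intro equalityI span_minimal) auto
  moreover have "card (insert e B) = dim S"
    using eB B(2,3) dimS' Suc.hyps(2) by simp
  moreover have "pairwise orthogonal (insert e B)"
    using B(1,6) by (auto simp: pairwise_insert S'_def orthogonal_def inner_commute)
  moreover have "\<forall>x\<in>insert e B. \<forall>y\<in>insert e B. x \<noteq> y \<longrightarrow> T x \<bullet> T y = 0"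
    using B(1,7) orth by (auto simp: S'_def inner_commute)
  ultimately show ?case
    using B e1 S' by (intro exI [of _ "insert e B"]) auto
qed

lemma orthonormal_expand:
  fixes B :: "'a::real_inner set"
  assumes "finite B" "pairwise orthogonal B" "\<forall>e\<in>B. norm e = 1" "x \<in> span B"
  shows "(\<Sum>e\<in>B. (x \<bullet> e) *\<^sub>R e) = x"
proof -
  define y where "y = x - (\<Sum>e\<in>B. (x \<bullet> e) *\<^sub>R e)"
  have "y \<bullet> e = 0" if e: "e \<in> B" for e
  proof -
    have "(\<Sum>b\<in>B. (x \<bullet> b) *\<^sub>R b) \<bullet> e = (\<Sum>b\<in>B. if b = e then x \<bullet> e else 0)"
      unfolding inner_sum_left
      using assms(2,3) e
      by (intro sum.cong) (auto simp: pairwise_def orthogonal_def norm_eq_1)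
    then show ?thesis
      using e assms(1) by (simp add: y_def inner_diff_left)
  qed
  then have "orthogonal y z" if "z \<in> span B" for z
    using that by (intro orthogonal_to_span [of z B]) (auto simp: orthogonal_def)
  moreover have "y \<in> span B"
    unfolding y_def by (intro span_diff span_sum span_scale span_base assms(4))
  ultimately have "y = 0"
    using orthogonal_self by blast
  then show ?thesis
    by (simp add: y_def)
qed

lemma matrix_eq_sum_outer:
  fixes A :: "real ^ 'n ^ 'm"
  assumes "finite B" "pairwise orthogonal B" "\<forall>e\<in>B. norm e = 1" "span B = UNIV"
  shows "A = (\<Sum>e\<in>B. outer (A *v e) e)"
proof -
  have "A *v x = (\<Sum>e\<in>B. outer (A *v e) e) *v x" for x
  proof -
    have "A *v x = A *v (\<Sum>e\<in>B. (x \<bullet> e) *\<^sub>R e)"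
      using orthonormal_expand [OF assms(1-3), of x] assms(4) by simp
    then show ?thesis
      by (simp add: matrix_sum_mult sum_mult_vec outer_mult_vec matrix_vector_mult_scaleR inner_commute)
  qed
  then show ?thesis
    unfolding matrix_eq by blast
qed

lemma range_subset_imp_rank_le:
  fixes A :: "real ^ 'n ^ 'm"
  assumes "finite S" "\<And>x. A *v x \<in> span S"
  shows "rank A \<le> card S"
  using assms unfolding rank_dim_range
  by (metis dim_le_card image_subsetI)

text \<open>Orthogonality of the images makes every basis vector an eigenvector of
  \<open>A^T A\<close>. Grouped by \<open>norm (A *v e)\<close>, the vectors of each group are
  independent and lie in one \<open>singular_space\<close>, whose dimension is the multiplicity in
  \<open>nuclear_norm\<close>.\<close>

lemma nuclear_norm_ge:
  fixes A :: "real ^ 'n ^ 'm"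
  assumes B: "finite B" "pairwise orthogonal B" "\<forall>e\<in>B. norm e = 1" "span B = UNIV"
    and orth: "\<forall>e\<in>B. \<forall>e'\<in>B. e \<noteq> e' \<longrightarrow> (A *v e) \<bullet> (A *v e') = 0"
  shows "(\<Sum>e\<in>B. norm (A *v e)) \<le> nuclear_norm A"
proof -
  let ?f = "\<lambda>e. norm (A *v e)"
  have eig: "(transpose A ** A) *v e = (?f e)\<^sup>2 *\<^sub>R e" if e: "e \<in> B" for e
  proof -
    have "(transpose A ** A) *v e = (\<Sum>b\<in>B. (((transpose A ** A) *v e) \<bullet> b) *\<^sub>R b)"
      using orthonormal_expand [OF B(1-3)] B(4) by simp
    also have "\<dots> = (\<Sum>b\<in>B. if b = e then (?f e)\<^sup>2 *\<^sub>R e else 0)"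
    proof (intro sum.cong refl)
      fix b assume "b \<in> B"
      moreover have "((transpose A ** A) *v e) \<bullet> b = (A *v e) \<bullet> (A *v b)"
        by (simp add: inner_transpose_vec matrix_vector_mul_assoc)
      ultimately show "(((transpose A ** A) *v e) \<bullet> b) *\<^sub>R b =
          (if b = e then (?f e)\<^sup>2 *\<^sub>R e else 0)"
        using orth e by (simp add: power2_norm_eq_inner)
    qed
    finally show ?thesis
      using e B(1) by simp
  qed
  have sv: "singular_values A \<subseteq> ?f ` B"
  proof
    fix \<sigma> assume "\<sigma> \<in> singular_values A"
    then obtain v where v: "\<sigma> \<ge> 0" "(transpose A ** A) *v v = \<sigma>\<^sup>2 *\<^sub>R v" "v \<noteq> 0"
      by (auto simp: singular_values_def singular_space_def)
    have "(\<Sum>b\<in>B. (v \<bullet> b) *\<^sub>R b) = v"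
      using orthonormal_expand [OF B(1-3)] B(4) by simp
    have "\<not> (\<forall>b\<in>B. v \<bullet> b = 0)"
    proof
      assume "\<forall>b\<in>B. v \<bullet> b = 0"
      then have "(\<Sum>b\<in>B. (v \<bullet> b) *\<^sub>R b) = 0" by simp
      with \<open>_ = v\<close> v(3) show False by simp
    qed
    then obtain b where b: "b \<in> B" "v \<bullet> b \<noteq> 0" by blast
    have "\<sigma>\<^sup>2 * (v \<bullet> b) = (?f b)\<^sup>2 * (v \<bullet> b)"
    proof -
      have "\<sigma>\<^sup>2 * (v \<bullet> b) = ((transpose A ** A) *v v) \<bullet> b"
        by (simp add: v(2))
      also have "\<dots> = v \<bullet> ((transpose A ** A) *v b)"
        by (metis inner_transpose_vec matrix_transpose_mul transpose_transpose)
      finally show ?thesis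
        by (simp add: eig b(1))
    qed
    with b v(1) show "\<sigma> \<in> ?f ` B"
      by (auto intro!: image_eqI [of _ _ b])
  qed
  moreover have "?f ` B \<subseteq> singular_values A"
    using eig B(3) by (force simp: singular_values_def singular_space_def)
  ultimately have svB: "singular_values A = ?f ` B"
    by blast
  have "(\<Sum>e\<in>B. ?f e) = (\<Sum>\<sigma>\<in>?f ` B. \<Sum>e\<in>{e\<in>B. ?f e = \<sigma>}. ?f e)"
    by (rule sum.image_gen [OF B(1)])
  also have "\<dots> = (\<Sum>\<sigma>\<in>?f ` B. real (card {e\<in>B. ?f e = \<sigma>}) * \<sigma>)"
    by (intro sum.cong) auto
  also have "\<dots> \<le> (\<Sum>\<sigma>\<in>?f ` B. real (dim (singular_space A \<sigma>)) * \<sigma>)"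
  proof (intro sum_mono mult_right_mono)
    fix \<sigma>
    have "0 \<notin> B" using B(3) by auto
    then have "independent {e\<in>B. ?f e = \<sigma>}"
      by (intro pairwise_orthogonal_independent) (auto intro: pairwise_mono [OF B(2)])
    moreover have "{e\<in>B. ?f e = \<sigma>} \<subseteq> singular_space A \<sigma>"
      using eig by (auto simp: singular_space_def)
    ultimately show "real (card {e\<in>B. ?f e = \<sigma>}) \<le> real (dim (singular_space A \<sigma>))"
      by (simp add: independent_card_le_dim)
  qed auto
  finally show ?thesis
    by (simp add: nuclear_norm_def svB)
qed

text \<open>The only possible nonzero singular value has its singular space inside
  \<open>span {y}\<close>. Rank-one test matrices suffice to bound the operator norm of a
  subgradient.\<close>

lemma nuclear_norm_outer_le: "nuclear_norm (outer x y) \<le> norm x * norm y"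
proof -
  let ?A = "outer x y" and ?n = "norm x * norm y"
  have AA: "(transpose ?A ** ?A) *v v = ((norm x)\<^sup>2 * (y \<bullet> v)) *\<^sub>R y" for v
    by (simp add: matrix_vector_mul_assoc [symmetric] transpose_outer outer_mult_vec
        matrix_vector_mult_scaleR power2_norm_eq_inner mult.commute)
  have sub: "singular_values ?A \<subseteq> {0, ?n}"
  proof
    fix \<sigma> assume "\<sigma> \<in> singular_values ?A"
    then obtain v where v: "\<sigma> \<ge> 0" "((norm x)\<^sup>2 * (y \<bullet> v)) *\<^sub>R y = \<sigma>\<^sup>2 *\<^sub>R v" "v \<noteq> 0"
      by (auto simp: singular_values_def singular_space_def AA)
    have "\<sigma> = ?n" if "\<sigma> \<noteq> 0"
    proof -
      have "y \<bullet> v \<noteq> 0"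
        using v that by auto
      moreover have "(norm x)\<^sup>2 * (y \<bullet> v) * (y \<bullet> y) = \<sigma>\<^sup>2 * (y \<bullet> v)"
        using arg_cong [OF v(2), of "\<lambda>z. y \<bullet> z"] by simp
      ultimately have "\<sigma>\<^sup>2 = ?n\<^sup>2"
        by (simp add: power_mult_distrib power2_norm_eq_inner [of y])
      with v(1) show ?thesis
        by simp
    qed
    then show "\<sigma> \<in> {0, ?n}" by blast
  qed
  have "real (dim (singular_space ?A \<sigma>)) * \<sigma> \<le> (if \<sigma> = ?n then ?n else 0)" if "\<sigma> \<in> {0, ?n}" for \<sigma>
  proof (cases "\<sigma> = 0")
    case False
    with that have \<sigma>: "\<sigma> = ?n" "\<sigma> \<noteq> 0" by auto
    have "singular_space ?A \<sigma> \<subseteq> span {y}"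
    proof
      fix v assume "v \<in> singular_space ?A \<sigma>"
      then have "\<sigma>\<^sup>2 *\<^sub>R v = ((norm x)\<^sup>2 * (y \<bullet> v)) *\<^sub>R y"
        by (simp add: singular_space_def AA)
      then have "(1 / \<sigma>\<^sup>2) *\<^sub>R (\<sigma>\<^sup>2 *\<^sub>R v) \<in> span {y}"
        by (simp add: span_scale span_base del: scaleR_scaleR)
      then show "v \<in> span {y}"
        using \<sigma>(2) by simp
    qed
    then have "dim (singular_space ?A \<sigma>) \<le> card {y}"
      by (intro dim_le_card) auto
    then have "dim (singular_space ?A \<sigma>) \<le> 1" by simp
    then show ?thesis
      using \<sigma> by (simp add: mult_left_le_one_le)
  qed auto
  then have "nuclear_norm ?A \<le> (\<Sum>\<sigma>\<in>singular_values ?A. if \<sigma> = ?n then ?n else 0)"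
    unfolding nuclear_norm_def using sub by (intro sum_mono) blast
  also have "\<dots> \<le> ?n"
    using finite_subset [OF sub] by (simp add: sum.delta')
  finally show ?thesis .
qed

lemma nuclear_norm_nonneg: "0 \<le> nuclear_norm A"
  unfolding nuclear_norm_def by (intro sum_nonneg) (auto simp: singular_values_def)

text \<open>Testing the subgradient inequality at \<open>0\<close> gives the first bound. Testing it
  at large multiples of a rank-one matrix shows that \<open>D\<close> has operator norm at most
  one.\<close>

lemma nuclear_norm_subgradient:
  fixes A D :: "real ^ 'n ^ 'm"
  assumes "D \<in> subdifferential nuclear_norm A"
  shows "nuclear_norm A \<le> D \<bullet> A" "x \<bullet> (D *v y) \<le> norm x * norm y"
proof -
  have D: "nuclear_norm A + D \<bullet> (Y - A) \<le> nuclear_norm Y" for Y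
    using assms by (simp add: subdifferential_def)
  have "nuclear_norm (0 :: real ^ 'n ^ 'm) \<le> 0"
    using nuclear_norm_outer_le [of 0 0] by (simp add: outer.zero_left)
  with D [of 0] show "nuclear_norm A \<le> D \<bullet> A"
    by (simp add: inner_diff_right)
  show "x \<bullet> (D *v y) \<le> norm x * norm y"
  proof (rule ccontr)
    define d where "d = x \<bullet> (D *v y) - norm x * norm y"
    assume "\<not> ?thesis"
    then have d: "d > 0" by (simp add: d_def)
    \<comment> \<open>Large enough for the linear excess \<open>t * d\<close> to outweigh
      \<open>D \<bullet> A\<close>, since \<open>nuclear_norm A\<close> is nonnegative.\<close>
    define t where "t = (\<bar>D \<bullet> A\<bar> + 1) / d"
    have t: "t > 0" "t * d = \<bar>D \<bullet> A\<bar> + 1" using d by (simp_all add: t_def)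
    have "nuclear_norm A + D \<bullet> (outer (t *\<^sub>R x) y - A) \<le> norm (t *\<^sub>R x) * norm y"
      using D nuclear_norm_outer_le order_trans by blast
    then have "nuclear_norm A + t * (x \<bullet> (D *v y)) - D \<bullet> A \<le> t * (norm x * norm y)"
      using t by (simp add: inner_diff_right inner_outer mult.assoc)
    then have "nuclear_norm A + t * d \<le> D \<bullet> A"
      by (simp add: d_def algebra_simps)
    with t nuclear_norm_nonneg [of A] show False by linarith
  qed
qed

text \<open>The square root of each singular value goes into both factors, so
  \<open>p i \<bullet> p i\<close> is the singular value itself and the factorisation is balanced.
  The index set consists of the right singular vectors with nonzero image.\<close>

lemma singular_value_decomposition:
  fixes A :: "real ^ 'n ^ 'm"
  obtains I :: "(real ^ 'n) set" and p q where
    "finite I" "card I = rank A" "A = (\<Sum>i\<in>I. outer (p i) (q i))"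
    "\<And>i j. i \<in> I \<Longrightarrow> j \<in> I \<Longrightarrow> i \<noteq> j \<Longrightarrow> p i \<bullet> p j = 0"
    "\<And>i j. i \<in> I \<Longrightarrow> j \<in> I \<Longrightarrow> i \<noteq> j \<Longrightarrow> q i \<bullet> q j = 0"
    "\<And>i. i \<in> I \<Longrightarrow> norm (p i) = norm (q i)" "\<And>i. i \<in> I \<Longrightarrow> p i \<noteq> 0"
    "(\<Sum>i\<in>I. (norm (p i))\<^sup>2) \<le> nuclear_norm A"
proof -
  have "linear ((*v) A)" by simp
  from orthogonal_image_basis_exists [OF subspace_UNIV this] obtain B :: "(real ^ 'n) set"
    where B: "finite B" "span B = UNIV" "\<forall>e\<in>B. norm e = 1" "pairwise orthogonal B"
      and orth: "\<forall>e\<in>B. \<forall>e'\<in>B. e \<noteq> e' \<longrightarrow> (A *v e) \<bullet> (A *v e') = 0"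
    by blast
  define I where "I = {e\<in>B. A *v e \<noteq> 0}"
  define p where "p e = (A *v e) /\<^sub>R sqrt (norm (A *v e))" for e
  define q where "q e = sqrt (norm (A *v e)) *\<^sub>R e" for e :: "real ^ 'n"
  have "finite I" using B(1) by (simp add: I_def)
  have "(\<Sum>e\<in>B. outer (A *v e) e) = (\<Sum>e\<in>I. outer (A *v e) e)"
    by (intro sum.mono_neutral_right) (auto simp: I_def B(1) outer.zero_left)
  note A = trans [OF matrix_eq_sum_outer [OF B(1,4,3,2), of A] this]
  have outer_pq: "outer (p e) (q e) = outer (A *v e) e" if "e \<in> I" for e
    using that by (simp add: p_def q_def I_def outer.scaleR_left outer.scaleR_right)
  have inj: "inj_on ((*v) A) I"
    using orth by (fastforce simp: inj_on_def I_def)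
  have "rank A = card ((*v) A ` I)"
  proof (rule antisym)
    show "rank A \<le> card ((*v) A ` I)"
    proof (rule range_subset_imp_rank_le)
      fix x
      have "A *v x = (\<Sum>e\<in>I. (e \<bullet> x) *\<^sub>R (A *v e))"
        using arg_cong [OF A, of "\<lambda>C. C *v x"] by (simp only: sum_mult_vec outer_mult_vec)
      then show "A *v x \<in> span ((*v) A ` I)"
        by (simp add: span_sum span_scale span_base)
    qed (simp add: \<open>finite I\<close>)
    have "independent ((*v) A ` I)"
      using orth by (intro pairwise_orthogonal_independent)
        (auto simp: pairwise_def I_def orthogonal_def)
    then show "card ((*v) A ` I) \<le> rank A"
      unfolding rank_dim_range by (intro independent_card_le_dim) auto
  qed
  then have "card I = rank A"
    using inj by (simp add: card_image)
  have norms: "norm (p e) = sqrt (norm (A *v e))" "norm (q e) = sqrt (norm (A *v e))"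
    if "e \<in> I" for e
    using that B(3) by (auto simp: p_def q_def I_def real_div_sqrt divide_inverse_commute [symmetric])
  have "(\<Sum>e\<in>I. norm (A *v e)) \<le> nuclear_norm A"
    using nuclear_norm_ge [OF B(1,4,3,2) orth]
    by (subst (asm) sum.mono_neutral_right [of _ I]) (auto simp: I_def B(1))
  then have nuc: "(\<Sum>e\<in>I. (norm (p e))\<^sup>2) \<le> nuclear_norm A"
    by (simp add: norms)
  have "(\<Sum>e\<in>I. outer (p e) (q e)) = (\<Sum>e\<in>I. outer (A *v e) e)"
    by (intro sum.cong refl outer_pq)
  note A' = trans [OF A this [symmetric]]
  have p: "p i \<bullet> p j = 0" and q: "q i \<bullet> q j = 0" if "i \<in> I" "j \<in> I" "i \<noteq> j" for i j
    using that orth B(4) by (auto simp: p_def q_def I_def pairwise_def orthogonal_def)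
  have p0: "p i \<noteq> 0" if "i \<in> I" for i
    using that by (simp add: p_def I_def)
  have "norm (p i) = norm (q i)" if "i \<in> I" for i
    using norms that by simp
  from that [OF \<open>finite I\<close> \<open>card I = rank A\<close> A' p q this p0 nuc] show ?thesis .
qed

subsection \<open>The distance from a low-rank matrix to a factored one\<close>

lemma sum_inner_mult_inner:
  fixes a a' :: "_ \<Rightarrow> real ^ 'm" and b b' :: "_ \<Rightarrow> real ^ 'n"
  shows "(\<Sum>j\<in>J. outer (a j) (b j)) \<bullet> (\<Sum>j\<in>J'. outer (a' j) (b' j)) =
    (\<Sum>j\<in>J. \<Sum>l\<in>J'. (a j \<bullet> a' l) * (b j \<bullet> b' l))"
  unfolding inner_sum_left by (simp add: inner_sum_right inner_outer_outer)

text \<open>The double sum is the squared Frobenius norm of the sum of the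
  \<open>outer (a j) (b j)\<close>.\<close>

lemma sum_inner_mult_inner_nonneg:
  fixes a :: "'j \<Rightarrow> real ^ 'm" and b :: "'j \<Rightarrow> real ^ 'n"
  shows "0 \<le> (\<Sum>j\<in>J. \<Sum>l\<in>J. (a j \<bullet> a l) * (b j \<bullet> b l))"
  unfolding sum_inner_mult_inner [symmetric] by simp

text \<open>\<open>\<alpha>\<close> and \<open>\<beta>\<close> are coordinates of the factors of the
  optimum inside the column and row space of \<open>M\<close>; \<open>x\<close> and \<open>y\<close>
  are their parts outside. The right-hand side collects the squared norms of the blocks with at
  least one side outside. Averaging the two sides loses something, and \<open>gram\<close> pays for
  it by tying the imbalance inside to the imbalance outside.\<close>

lemma gram_tail_bound:
  fixes \<alpha> \<beta> :: "'j \<Rightarrow> real ^ 'r" and x :: "'j \<Rightarrow> real ^ 'm" and y :: "'j \<Rightarrow> real ^ 'n"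
  assumes J: "finite J" and c: "0 \<le> c" "c \<le> 1"
    and gram: "\<And>j l. j \<in> J \<Longrightarrow> l \<in> J \<Longrightarrow> \<alpha> j \<bullet> \<alpha> l + x j \<bullet> x l = \<beta> j \<bullet> \<beta> l + y j \<bullet> y l"
    and B: "\<And>j. B j = (\<alpha> j + \<beta> j) /\<^sub>R 2"
    and orth: "\<And>j l. j \<in> J \<Longrightarrow> l \<in> J \<Longrightarrow> j \<noteq> l \<Longrightarrow> B j \<bullet> B l = 0"
    and g: "\<And>j. g j = (x j \<bullet> x j + y j \<bullet> y j) / 2"
  shows "(\<Sum>j\<in>J. c\<^sup>2 * (g j)\<^sup>2 + 2 * (B j \<bullet> B j) * g j) \<le>
    (\<Sum>j\<in>J. \<Sum>l\<in>J. c\<^sup>2 * ((x j \<bullet> x l) * (y j \<bullet> y l)) +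
       ((\<alpha> j \<bullet> \<alpha> l) * (y j \<bullet> y l) + (\<beta> j \<bullet> \<beta> l) * (x j \<bullet> x l)))"
proof -
  define \<delta> where "\<delta> j = (\<alpha> j - \<beta> j) /\<^sub>R 2" for j
  define h where "h j l = (x j \<bullet> x l + y j \<bullet> y l) / 2" for j l
  \<comment> \<open>The left-hand side is the diagonal of the double sum; off the diagonal
    \<open>orth\<close> leaves only squares.\<close>
  have "(\<Sum>j\<in>J. c\<^sup>2 * (g j)\<^sup>2 + 2 * (B j \<bullet> B j) * g j) \<le>
      (\<Sum>j\<in>J. \<Sum>l\<in>J. c\<^sup>2 * (h j l)\<^sup>2 + 2 * (B j \<bullet> B l) * h j l)"
  proof (rule sum_mono)
    fix j assume j: "j \<in> J"
    have "c\<^sup>2 * (g j)\<^sup>2 + 2 * (B j \<bullet> B j) * g j =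
        (\<Sum>l\<in>J. if l = j then c\<^sup>2 * (h j l)\<^sup>2 + 2 * (B j \<bullet> B l) * h j l else 0)"
      using j J by (simp add: g h_def)
    also have "\<dots> \<le> (\<Sum>l\<in>J. c\<^sup>2 * (h j l)\<^sup>2 + 2 * (B j \<bullet> B l) * h j l)"
      using orth [OF j] by (intro sum_mono) auto
    finally show "c\<^sup>2 * (g j)\<^sup>2 + 2 * (B j \<bullet> B j) * g j \<le>
      (\<Sum>l\<in>J. c\<^sup>2 * (h j l)\<^sup>2 + 2 * (B j \<bullet> B l) * h j l)" .
  qed
  \<comment> \<open>Adding the two nonnegative double sums in \<open>\<delta>\<close> turns
    \<open>B j \<bullet> B l\<close> into half of \<open>\<alpha> j \<bullet> \<alpha> l + \<beta> j
    \<bullet> \<beta> l\<close>.\<close>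
  also have "\<dots> \<le> (\<Sum>j\<in>J. \<Sum>l\<in>J. c\<^sup>2 * (h j l)\<^sup>2 + 2 * (B j \<bullet> B l) * h j l) +
      ((\<Sum>j\<in>J. \<Sum>l\<in>J. (\<delta> j \<bullet> \<delta> l) * (x j \<bullet> x l)) + (\<Sum>j\<in>J. \<Sum>l\<in>J. (\<delta> j \<bullet> \<delta> l) * (y j \<bullet> y l)))"
    using sum_inner_mult_inner_nonneg [of \<delta> x J] sum_inner_mult_inner_nonneg [of \<delta> y J] by simp
  also have "\<dots> = (\<Sum>j\<in>J. \<Sum>l\<in>J. c\<^sup>2 * (h j l)\<^sup>2 + 2 * (B j \<bullet> B l + \<delta> j \<bullet> \<delta> l) * h j l)"
    unfolding sum.distrib [symmetric]
    by (intro sum.cong refl) (simp add: h_def field_simps)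
  also have "\<dots> = (\<Sum>j\<in>J. \<Sum>l\<in>J. c\<^sup>2 * (h j l)\<^sup>2 + (\<alpha> j \<bullet> \<alpha> l + \<beta> j \<bullet> \<beta> l) * h j l)"
    by (intro sum.cong refl) (simp add: B \<delta>_def inner_diff inner_add field_simps)
  also have "\<dots> \<le> (\<Sum>j\<in>J. \<Sum>l\<in>J. c\<^sup>2 * ((x j \<bullet> x l) * (y j \<bullet> y l)) +
       ((\<alpha> j \<bullet> \<alpha> l) * (y j \<bullet> y l) + (\<beta> j \<bullet> \<beta> l) * (x j \<bullet> x l)))"
  proof (intro sum_mono)
    fix j l assume jl: "j \<in> J" "l \<in> J"
    define a b k1 k2 where ab: "a = x j \<bullet> x l" "b = y j \<bullet> y l" "k1 = \<alpha> j \<bullet> \<alpha> l" "k2 = \<beta> j \<bullet> \<beta> l"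
    have k2: "k2 = k1 + a - b"
      using gram [OF jl] by (simp add: ab)
    \<comment> \<open>Replacing \<open>a * b\<close> by the squared mean costs
      \<open>c^2 ((a - b) / 2)^2\<close>, while \<open>gram\<close> makes the mixed terms gain
      \<open>2 ((a - b) / 2)^2\<close>.\<close>
    have "c\<^sup>2 * (a * b) + (k1 * b + k2 * a) - (c\<^sup>2 * ((a + b) / 2)\<^sup>2 + (k1 + k2) * ((a + b) / 2))
        = (2 - c\<^sup>2) * ((a - b) / 2)\<^sup>2"
      by (simp add: k2 power2_eq_square field_simps)
    moreover have "c\<^sup>2 \<le> 1"
      using c by (simp add: power_le_one)
    ultimately have "c\<^sup>2 * ((a + b) / 2)\<^sup>2 + (k1 + k2) * ((a + b) / 2) \<le> c\<^sup>2 * (a * b) + (k1 * b + k2 * a)"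
      by (smt (verit) mult_nonneg_nonneg zero_le_power2)
    then show "c\<^sup>2 * (h j l)\<^sup>2 + (\<alpha> j \<bullet> \<alpha> l + \<beta> j \<bullet> \<beta> l) * h j l \<le> c\<^sup>2 * ((x j \<bullet> x l) * (y j \<bullet> y l)) +
       ((\<alpha> j \<bullet> \<alpha> l) * (y j \<bullet> y l) + (\<beta> j \<bullet> \<beta> l) * (x j \<bullet> x l))"
      by (simp add: h_def ab)
  qed
  finally show ?thesis .
qed

definition diag :: "('r \<Rightarrow> real) \<Rightarrow> real ^ 'r ^ 'r" where
  "diag \<sigma> = (\<chi> i k. if i = k then \<sigma> i else 0)"

lemma diag_inner: "diag \<sigma> \<bullet> A = (\<Sum>i\<in>UNIV. \<sigma> i * A $ i $ i)"
  by (simp add: diag_def inner_vec_def if_distrib [of "\<lambda>x. x * _"] cong: if_cong)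

lemma mat_1_eq_diag: "mat 1 = diag (\<lambda>_. 1)"
  by (simp add: mat_def diag_def)

lemma inner_mat_1: "mat 1 \<bullet> outer x y = x \<bullet> y" "mat 1 \<bullet> (mat 1 :: real ^ 'r ^ 'r) = real CARD('r)"
  by (simp add: inner_outer) (simp add: mat_1_eq_diag diag_inner, simp add: diag_def)

text \<open>
  The left-hand side is the squared Frobenius norm of the positive part of \<open>s I - \<Sum>\<^sub>j B\<^sub>j B\<^sub>j\<^sup>T\<close>. That
  positive part is the matrix \<open>N\<close> of the proof, and \<open>- C \<succeq> s I - \<Sum>\<^sub>j B\<^sub>j B\<^sub>j\<^sup>T\<close> as quadratic
  forms, where \<open>C\<close> is the matrix on the right-hand side.
\<close>

lemma diag_block_bound:
  fixes \<alpha> \<beta> :: "'j \<Rightarrow> real ^ 'r"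
  assumes J: "finite J" and s: "0 < s" "\<And>i. s \<le> \<sigma> i"
    and B: "\<And>j. B j = (\<alpha> j + \<beta> j) /\<^sub>R 2"
    and orth: "\<And>j l. j \<in> J \<Longrightarrow> l \<in> J \<Longrightarrow> j \<noteq> l \<Longrightarrow> B j \<bullet> B l = 0"
  shows "real CARD('r) * s\<^sup>2 - (\<Sum>j\<in>J. s\<^sup>2 - (max 0 (s - B j \<bullet> B j))\<^sup>2) \<le>
    (norm ((\<Sum>j\<in>J. outer (\<alpha> j) (\<beta> j)) - diag \<sigma>))\<^sup>2"
proof -
  define \<kappa> where "\<kappa> j = B j \<bullet> B j" for j
  \<comment> \<open>This scaling cuts the eigenvalues of the sum of the
    \<open>outer (B j) (B j)\<close> off at \<open>s\<close>: on a nonzero \<open>B j\<close>,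
    \<open>E\<close> has eigenvalue \<open>min s (\<kappa> j)\<close>.\<close>
  define \<theta> where "\<theta> j = (if \<kappa> j \<le> s then 1 else s / \<kappa> j)" for j
  define m where "m j = \<theta> j * \<kappa> j" for j
  define E where "E = (\<Sum>j\<in>J. \<theta> j *\<^sub>R outer (B j) (B j))"
  define N where "N = s *\<^sub>R mat 1 - E"
  define C where "C = (\<Sum>j\<in>J. outer (\<alpha> j) (\<beta> j)) - diag \<sigma>"
  have \<kappa>0: "\<kappa> j \<ge> 0" for j by (simp add: \<kappa>_def)
  have m: "m j = min s (\<kappa> j)" "m j \<le> s" for j
    using s(1) by (auto simp: m_def \<theta>_def)
  have \<theta>0: "\<theta> j \<ge> 0" for j
    using s(1) by (simp add: \<theta>_def)
  have Ev: "z \<bullet> (E *v z) = (\<Sum>j\<in>J. \<theta> j * (z \<bullet> B j)\<^sup>2)" for z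
    by (simp add: E_def sum_mult_vec inner_sum_right outer_mult_vec scaleR_matrix_vector_assoc [symmetric]
        power2_eq_square inner_commute mult.assoc)
  have psd: "0 \<le> z \<bullet> (N *v z)" for z
  proof -
    \<comment> \<open>\<open>w\<close> is \<open>E z / s\<close>. As in Bessel's inequality,
      expanding \<open>|z - w|^2\<close> bounds the quadratic form of \<open>E\<close> by
      \<open>s |z|^2\<close>.\<close>
    define w where "w = (\<Sum>j\<in>J. (\<theta> j / s * (z \<bullet> B j)) *\<^sub>R B j)"
    have "w \<bullet> w = (\<Sum>j\<in>J. \<Sum>l\<in>J. if l = j then (\<theta> j / s * (z \<bullet> B j))\<^sup>2 * \<kappa> j else 0)"
      unfolding w_def inner_sum_left inner_sum_right
      by (intro sum.cong refl) (auto simp: orth \<kappa>_def power2_eq_square)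
    also have "\<dots> = (\<Sum>j\<in>J. (\<theta> j / s * (z \<bullet> B j)\<^sup>2) * (m j / s))"
      using J by (simp add: m_def power2_eq_square mult_ac)
    also have "\<dots> \<le> (\<Sum>j\<in>J. (\<theta> j / s * (z \<bullet> B j)\<^sup>2) * 1)"
      using s(1) \<theta>0 m(2) by (intro sum_mono mult_left_mono) auto
    finally have "w \<bullet> w \<le> (\<Sum>j\<in>J. \<theta> j / s * (z \<bullet> B j)\<^sup>2)" by simp
    moreover have "z \<bullet> w = (\<Sum>j\<in>J. \<theta> j / s * (z \<bullet> B j)\<^sup>2)"
      by (simp add: w_def inner_sum_right power2_eq_square mult_ac)
    moreover have "0 \<le> (z - w) \<bullet> (z - w)" by simp
    ultimately have "(\<Sum>j\<in>J. \<theta> j / s * (z \<bullet> B j)\<^sup>2) \<le> z \<bullet> z"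
      by (simp add: inner_diff inner_commute)
    then have "(z \<bullet> (E *v z)) / s \<le> z \<bullet> z"
      by (simp add: Ev sum_divide_distrib)
    then have "z \<bullet> (E *v z) \<le> s * (z \<bullet> z)"
      using s(1) by (simp add: field_simps)
    then show ?thesis
      by (simp add: N_def matrix_vector_mult_diff_rdistrib scaleR_matrix_vector_assoc [symmetric]
          inner_diff_right)
  qed
  have sym: "transpose N = N"
    by (simp add: N_def E_def transpose_diff transpose_scalar transpose_sum transpose_outer)
  have BE: "B l \<bullet> (E *v B l) = m l * \<kappa> l" if l: "l \<in> J" for l
  proof -
    have "B l \<bullet> (E *v B l) = (\<Sum>j\<in>J. if j = l then m l * \<kappa> l else 0)"
      unfolding Ev using l by (intro sum.cong) (auto simp: orth m_def \<kappa>_def power2_eq_square)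
    then show ?thesis using l J by simp
  qed
  have BN: "B l \<bullet> (N *v B l) = s * \<kappa> l - m l * \<kappa> l" if "l \<in> J" for l
    using BE [OF that]
    by (simp add: N_def matrix_vector_mult_diff_rdistrib scaleR_matrix_vector_assoc [symmetric]
        inner_diff_right \<kappa>_def)
  have mE: "mat 1 \<bullet> E = (\<Sum>j\<in>J. m j)"
    by (simp add: E_def inner_sum_right inner_mat_1 m_def \<kappa>_def)
  have EE: "E \<bullet> E = (\<Sum>j\<in>J. (m j)\<^sup>2)"
  proof -
    have "E \<bullet> E = (\<Sum>l\<in>J. \<theta> l * (B l \<bullet> (E *v B l)))"
      by (subst (2) E_def) (simp add: inner_sum_right inner_outer)
    also have "\<dots> = (\<Sum>l\<in>J. (m l)\<^sup>2)"
      by (intro sum.cong) (auto simp: BE m_def power2_eq_square)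
    finally show ?thesis .
  qed
  have NN: "N \<bullet> N = real CARD('r) * s\<^sup>2 - 2 * s * (\<Sum>j\<in>J. m j) + (\<Sum>j\<in>J. (m j)\<^sup>2)"
    using mE by (simp add: N_def inner_diff inner_mat_1(2) inner_commute [of E "mat 1"] EE
        power2_eq_square algebra_simps)
  \<comment> \<open>A diagonal matrix sees only the diagonal of \<open>N\<close>, which is
    nonnegative by \<open>psd\<close>.\<close>
  have "s * (mat 1 \<bullet> N) \<le> diag \<sigma> \<bullet> N"
  proof -
    have "0 \<le> N $ i $ i" for i
      using psd [of "axis i 1"] by (simp add: inner_axis' matrix_vector_mult_basis column_def)
    then show ?thesis
      unfolding mat_1_eq_diag diag_inner sum_distrib_left
      by (intro sum_mono) (simp add: mult_right_mono s(2))
  qed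
  moreover have "mat 1 \<bullet> N = real CARD('r) * s - (\<Sum>j\<in>J. m j)"
    by (simp add: N_def inner_diff_right inner_mat_1(2) mE)
  moreover have "(\<Sum>j\<in>J. outer (\<alpha> j) (\<beta> j)) \<bullet> N \<le> (\<Sum>j\<in>J. s * \<kappa> j - m j * \<kappa> j)"
    unfolding inner_sum_left
  proof (rule sum_mono)
    fix j assume j: "j \<in> J"
    \<comment> \<open>Since \<open>N\<close> is symmetric, pairing it with
      \<open>outer (B j + d) (B j - d)\<close> gives its quadratic form at \<open>B j\<close> minus
      that at \<open>d\<close>; an imbalance \<open>d\<close> between the two sides only
      helps.\<close>
    define d where "d = (\<alpha> j - \<beta> j) /\<^sub>R 2"
    have ab: "\<alpha> j = B j + d" "\<beta> j = B j - d"
      by (simp_all add: B d_def scaleR_add_right [symmetric] scaleR_diff_right [symmetric] vec_eq_iff)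
    have "d \<bullet> (N *v B j) = B j \<bullet> (N *v d)"
      by (metis inner_commute inner_transpose_vec sym)
    then have "outer (\<alpha> j) (\<beta> j) \<bullet> N = B j \<bullet> (N *v B j) - d \<bullet> (N *v d)"
      by (simp add: inner_commute [of "outer _ _" N] inner_outer ab matrix_vector_mult_diff_distrib
          inner_diff inner_add)
    then show "outer (\<alpha> j) (\<beta> j) \<bullet> N \<le> s * \<kappa> j - m j * \<kappa> j"
      using psd [of d] BN [OF j] by linarith
  qed
  ultimately have CN: "s * (real CARD('r) * s - (\<Sum>j\<in>J. m j)) - (\<Sum>j\<in>J. s * \<kappa> j - m j * \<kappa> j) \<le> - (C \<bullet> N)"
    by (simp add: C_def inner_diff_left)
  have "real CARD('r) * s\<^sup>2 - (\<Sum>j\<in>J. s\<^sup>2 - (max 0 (s - \<kappa> j))\<^sup>2) =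
      real CARD('r) * s\<^sup>2 - (\<Sum>j\<in>J. 2 * (s * \<kappa> j - m j * \<kappa> j) + (m j)\<^sup>2)"
    by (intro arg_cong2 [of _ _ _ _ "(-)"] refl sum.cong)
      (auto simp: m max_def min_def power2_eq_square algebra_simps)
  also have "\<dots> = 2 * (s * (real CARD('r) * s - (\<Sum>j\<in>J. m j)) - (\<Sum>j\<in>J. s * \<kappa> j - m j * \<kappa> j)) - N \<bullet> N"
  proof -
    have "(\<Sum>j\<in>J. 2 * (s * \<kappa> j - m j * \<kappa> j) + (m j)\<^sup>2) =
        2 * (\<Sum>j\<in>J. s * \<kappa> j - m j * \<kappa> j) + (\<Sum>j\<in>J. (m j)\<^sup>2)"
      by (simp only: sum.distrib sum_distrib_left)
    then show ?thesis
      by (simp add: NN power2_eq_square algebra_simps)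
  qed
  also have "\<dots> \<le> 2 * - (C \<bullet> N) - N \<bullet> N"
    by (intro diff_right_mono mult_left_mono CN) simp
  also have "\<dots> \<le> C \<bullet> C"
    using inner_ge_zero [of "C + N"] by (simp add: inner_add inner_commute)
  finally show ?thesis
    by (simp add: C_def \<kappa>_def power2_norm_eq_inner)
qed

text \<open>The contribution of one index to the geometric inequality: \<open>\<kappa>\<close> is
  the squared norm of the averaged inside part, \<open>g\<close> the mean squared norm of the two
  outside parts. With \<open>G = c * g\<close>, the quadratic
  \<open>(s - \<kappa>)\<^sup>2 + 2 * \<kappa> * G\<close> in \<open>\<kappa>\<close> has its
  minimum at \<open>s - G\<close>, which dictates the cases and the squares.\<close>

lemma scalar_bound:
  fixes s t c \<kappa> g :: real
  assumes "0 < s" "1 \<le> t" "0 < c" "c \<le> 1" "0 \<le> \<kappa>" "0 \<le> g"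
  shows "s\<^sup>2 * (1 - t\<^sup>2) \<le> (max 0 (s - \<kappa>))\<^sup>2 + 2 * \<kappa> * g + c\<^sup>2 * g\<^sup>2 - 2 * c * t * s * g"
proof -
  define G where "G = c * g"
  have "c * g \<le> g"
    using assms by (intro mult_left_le_one_le) auto
  then have G: "0 \<le> G" "\<kappa> * G \<le> \<kappa> * g"
    using assms by (auto simp: G_def intro: mult_left_mono)
  have "s\<^sup>2 * (1 - t\<^sup>2) \<le> (max 0 (s - \<kappa>))\<^sup>2 + 2 * (\<kappa> * G) + G\<^sup>2 - 2 * t * s * G"
  proof (cases "s \<le> \<kappa>")
    case True
    have "2 * (s * G) + G\<^sup>2 - 2 * t * s * G - s\<^sup>2 * (1 - t\<^sup>2) = (G - (t - 1) * s)\<^sup>2 + 2 * (s\<^sup>2 * (t - 1))"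
      by algebra
    moreover have "0 \<le> s\<^sup>2 * (t - 1)"
      using assms by (intro mult_nonneg_nonneg) auto
    moreover have "s * G \<le> \<kappa> * G"
      using True G by (intro mult_right_mono)
    moreover have "0 \<le> (G - (t - 1) * s)\<^sup>2" "(max 0 (s - \<kappa>))\<^sup>2 = 0"
      using True by simp_all
    ultimately show ?thesis by linarith
  next
    case False
    have "0 \<le> \<kappa>\<^sup>2 - 2 * (\<kappa> * (s - G)) + (t * s - G)\<^sup>2"
    proof (cases "s \<le> G")
      case True
      then have "\<kappa> * (s - G) \<le> 0"
        using assms by (intro mult_nonneg_nonpos) auto
      moreover have "0 \<le> \<kappa>\<^sup>2" "0 \<le> (t * s - G)\<^sup>2" by simp_all
      ultimately show ?thesis by linarith
    next
      case False
      have "s \<le> t * s"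
        using assms by simp
      then have "(s - G)\<^sup>2 \<le> (t * s - G)\<^sup>2"
        using False by (intro power_mono) auto
      moreover have "\<kappa>\<^sup>2 - 2 * (\<kappa> * (s - G)) + (s - G)\<^sup>2 = (\<kappa> - (s - G))\<^sup>2"
        by algebra
      moreover have "0 \<le> (\<kappa> - (s - G))\<^sup>2" by simp
      ultimately show ?thesis by linarith
    qed
    moreover have "(s - \<kappa>)\<^sup>2 + 2 * (\<kappa> * G) + G\<^sup>2 - 2 * t * s * G - s\<^sup>2 * (1 - t\<^sup>2) =
        \<kappa>\<^sup>2 - 2 * (\<kappa> * (s - G)) + (t * s - G)\<^sup>2"
      by algebra
    ultimately show ?thesis
      using False by simp
  qed
  moreover have "c\<^sup>2 * g\<^sup>2 = G\<^sup>2" "2 * c * t * s * g = 2 * t * s * G"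
    by (simp_all add: G_def power_mult_distrib)
  ultimately show ?thesis
    using G(2) by linarith
qed

text \<open>\<open>W\<close> splits into three mutually orthogonal blocks: \<open>S1\<close> lies
  inside both spaces of \<open>M\<close>, \<open>S2\<close> and \<open>S3\<close> inside exactly
  one; \<open>F\<close> is the fourth block of the optimum. \<open>diag_block_bound\<close> treats
  \<open>S1\<close>, \<open>gram_tail_bound\<close> treats the others together with
  \<open>F\<close>, and \<open>scalar_bound\<close> combines them index by index.\<close>

lemma factored_error_bound:
  fixes X :: "real ^ 'r ^ 'm" and Y :: "real ^ 'r ^ 'n"
    and u x :: "'j \<Rightarrow> real ^ 'm" and v y :: "'j \<Rightarrow> real ^ 'n"
  assumes J: "finite J" "card J \<le> k" "1 \<le> k" "k \<le> CARD('r)"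
    and XX: "transpose X ** X = mat 1" and YY: "transpose Y ** Y = mat 1"
    and s: "0 < s" "\<And>i. s \<le> \<sigma> i" and c: "0 < c" "c \<le> 1"
    and gram: "\<And>j l. j \<in> J \<Longrightarrow> l \<in> J \<Longrightarrow> u j \<bullet> u l = v j \<bullet> v l"
    and orth: "\<And>j l. j \<in> J \<Longrightarrow> l \<in> J \<Longrightarrow> j \<noteq> l \<Longrightarrow>
      (transpose X *v u j + transpose Y *v v j) \<bullet> (transpose X *v u l + transpose Y *v v l) = 0"
    and x: "\<And>j. x j = u j - X *v (transpose X *v u j)"
    and y: "\<And>j. y j = v j - Y *v (transpose Y *v v j)"
    and F: "F = (\<Sum>j\<in>J. outer (x j) (y j))"
    and W: "W = (\<Sum>j\<in>J. outer (u j) (v j)) - X ** diag \<sigma> ** transpose Y - F"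
  shows "2 * c * sqrt (real CARD('r) / real k) * (s * (\<Sum>j\<in>J. (x j \<bullet> x j + y j \<bullet> y j) / 2)) \<le>
      c\<^sup>2 * (norm F)\<^sup>2 + (norm W)\<^sup>2"
proof -
  define \<alpha> where "\<alpha> j = transpose X *v u j" for j
  define \<beta> where "\<beta> j = transpose Y *v v j" for j
  define B where "B j = (\<alpha> j + \<beta> j) /\<^sub>R 2" for j
  define g where "g j = (x j \<bullet> x j + y j \<bullet> y j) / 2" for j
  define t where "t = sqrt (real CARD('r) / real k)"
  have XXv: "transpose X *v (X *v z) = z" and YYv: "transpose Y *v (Y *v z) = z" for z
    using XX YY by (simp_all add: matrix_vector_mul_assoc)
  have Xx: "transpose X *v x j = 0" and Yy: "transpose Y *v y j = 0" for j
    by (simp_all add: x y matrix_vector_mult_diff_distrib XXv YYv)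
  have u: "u j = X *v \<alpha> j + x j" and v: "v j = Y *v \<beta> j + y j" for j
    by (simp_all add: x y \<alpha>_def \<beta>_def)
  have XxI: "(X *v z) \<bullet> x j = 0" "x j \<bullet> (X *v z) = 0" and
    YyI: "(Y *v z) \<bullet> y j = 0" "y j \<bullet> (Y *v z) = 0" for z j
    using inner_transpose_vec [of "x j" X z] inner_transpose_vec [of "y j" Y z]
    by (simp_all add: Xx Yy inner_commute)
  have XXI: "(X *v a) \<bullet> (X *v b) = a \<bullet> b" and YYI: "(Y *v a) \<bullet> (Y *v b) = a \<bullet> b" for a b
    by (simp_all add: inner_transpose_vec XXv YYv)
  have YI: "(Y *v b) \<bullet> z = b \<bullet> (transpose Y *v z)" for b z
    by (metis inner_transpose_vec inner_commute)
  define C where "C = (\<Sum>j\<in>J. outer (\<alpha> j) (\<beta> j)) - diag \<sigma>"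
  define S1 where "S1 = X ** (C ** transpose Y)"
  define S2 where "S2 = (\<Sum>j\<in>J. outer (X *v \<alpha> j) (y j))"
  define S3 where "S3 = (\<Sum>j\<in>J. outer (x j) (Y *v \<beta> j))"
  have S1: "S1 = (\<Sum>j\<in>J. outer (X *v \<alpha> j) (Y *v \<beta> j)) - X ** diag \<sigma> ** transpose Y"
  proof -
    have "S1 *v z = ((\<Sum>j\<in>J. outer (X *v \<alpha> j) (Y *v \<beta> j)) - X ** diag \<sigma> ** transpose Y) *v z" for z
      by (simp add: S1_def C_def matrix_vector_mul_assoc [symmetric] matrix_vector_mult_diff_rdistrib
          matrix_vector_mult_diff_distrib sum_mult_vec outer_mult_vec matrix_sum_mult
          matrix_vector_mult_scaleR YI)
    then show ?thesis
      unfolding matrix_eq by blast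
  qed
  have W': "W = S1 + S2 + S3"
  proof -
    have "(\<Sum>j\<in>J. outer (u j) (v j)) =
        (\<Sum>j\<in>J. outer (X *v \<alpha> j) (Y *v \<beta> j)) + S2 + S3 + F"
      unfolding S2_def S3_def F sum.distrib [symmetric]
      by (intro sum.cong refl) (simp add: u v outer.add_left outer.add_right)
    then show ?thesis
      by (simp add: W S1)
  qed
  have S1y: "S1 *v y j = 0" and S1x: "x j \<bullet> (S1 *v z) = 0" for j z
    by (simp_all add: S1_def matrix_vector_mul_assoc [symmetric] Yy XxI)
  have "S1 \<bullet> S2 = 0" "S1 \<bullet> S3 = 0" "S1 \<bullet> F = 0"
    by (simp_all add: S2_def S3_def F inner_sum_right inner_outer S1y S1x)
  moreover have "S2 \<bullet> S3 = 0" "S2 \<bullet> F = 0" "S3 \<bullet> F = 0"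
    by (simp_all add: S2_def S3_def F sum_inner_mult_inner XxI YyI)
  ultimately have WW: "W \<bullet> W = S1 \<bullet> S1 + (S2 \<bullet> S2 + S3 \<bullet> S3)"
    by (simp add: W' inner_add inner_commute)
  have "S1 \<bullet> S1 = C \<bullet> C"
  proof -
    have "S1 \<bullet> S1 = (transpose X ** (X ** (C ** transpose Y))) \<bullet> (C ** transpose Y)"
      unfolding S1_def by (rule inner_matrix_mult_left)
    also have "\<dots> = (C ** transpose Y) \<bullet> (C ** transpose Y)"
      by (metis XX matrix_mul_assoc matrix_mul_lid)
    also have "\<dots> = (C ** transpose Y ** transpose (transpose Y)) \<bullet> C"
      by (rule inner_matrix_mult_right)
    also have "\<dots> = C \<bullet> C"
      by (metis YY matrix_mul_assoc matrix_mul_rid transpose_transpose)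
    finally show ?thesis .
  qed
  moreover have "real CARD('r) * s\<^sup>2 - (\<Sum>j\<in>J. s\<^sup>2 - (max 0 (s - B j \<bullet> B j))\<^sup>2) \<le> C \<bullet> C"
    unfolding C_def power2_norm_eq_inner [of "_ - diag \<sigma>", symmetric]
    using orth by (intro diag_block_bound J s) (auto simp: B_def \<alpha>_def \<beta>_def)
  moreover have "(\<Sum>j\<in>J. c\<^sup>2 * (g j)\<^sup>2 + 2 * (B j \<bullet> B j) * g j) \<le> c\<^sup>2 * (F \<bullet> F) + (S2 \<bullet> S2 + S3 \<bullet> S3)"
  proof -
    have "(\<Sum>j\<in>J. c\<^sup>2 * (g j)\<^sup>2 + 2 * (B j \<bullet> B j) * g j) \<le>
      (\<Sum>j\<in>J. \<Sum>l\<in>J. c\<^sup>2 * ((x j \<bullet> x l) * (y j \<bullet> y l)) +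
       ((\<alpha> j \<bullet> \<alpha> l) * (y j \<bullet> y l) + (\<beta> j \<bullet> \<beta> l) * (x j \<bullet> x l)))"
    proof (rule gram_tail_bound)
      show "\<alpha> j \<bullet> \<alpha> l + x j \<bullet> x l = \<beta> j \<bullet> \<beta> l + y j \<bullet> y l" if "j \<in> J" "l \<in> J" for j l
        using gram [OF that] unfolding u v
        by (simp add: inner_add XXI YYI XxI YyI)
      show "B j \<bullet> B l = 0" if "j \<in> J" "l \<in> J" "j \<noteq> l" for j l
        using orth [OF that] by (simp add: B_def \<alpha>_def \<beta>_def)
    qed (use J c in \<open>auto simp: B_def g_def\<close>)
    also have "\<dots> = c\<^sup>2 * (F \<bullet> F) + (S2 \<bullet> S2 + S3 \<bullet> S3)"
      by (simp add: F S2_def S3_def sum_inner_mult_inner XXI YYI sum.distrib sum_distrib_left mult.commute)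
    finally show ?thesis .
  qed
  ultimately have *: "real CARD('r) * s\<^sup>2 - (\<Sum>j\<in>J. s\<^sup>2 - (max 0 (s - B j \<bullet> B j))\<^sup>2) +
      (\<Sum>j\<in>J. c\<^sup>2 * (g j)\<^sup>2 + 2 * (B j \<bullet> B j) * g j) \<le> c\<^sup>2 * (F \<bullet> F) + W \<bullet> W"
    using WW by linarith
  have t: "t\<^sup>2 = real CARD('r) / real k" "1 \<le> t"
    using J by (simp_all add: t_def)
  have "(\<Sum>j\<in>J. s\<^sup>2 * (1 - t\<^sup>2) + 2 * c * t * s * g j) \<le>
      (\<Sum>j\<in>J. (max 0 (s - B j \<bullet> B j))\<^sup>2 + 2 * (B j \<bullet> B j) * g j + c\<^sup>2 * (g j)\<^sup>2)"
  proof (rule sum_mono)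
    fix j
    show "s\<^sup>2 * (1 - t\<^sup>2) + 2 * c * t * s * g j \<le>
        (max 0 (s - B j \<bullet> B j))\<^sup>2 + 2 * (B j \<bullet> B j) * g j + c\<^sup>2 * (g j)\<^sup>2"
      using scalar_bound [OF s(1) t(2) c, of "B j \<bullet> B j" "g j"] by (simp add: g_def)
  qed
  then have "real (card J) * (s\<^sup>2 * (1 - t\<^sup>2)) + 2 * c * t * (s * (\<Sum>j\<in>J. g j)) \<le>
      (\<Sum>j\<in>J. (max 0 (s - B j \<bullet> B j))\<^sup>2) + (\<Sum>j\<in>J. c\<^sup>2 * (g j)\<^sup>2 + 2 * (B j \<bullet> B j) * g j)"
    by (simp add: sum.distrib sum_distrib_left mult.assoc)
  with * have "real (card J) * (s\<^sup>2 * (1 - t\<^sup>2)) + real CARD('r) * s\<^sup>2 - real (card J) * s\<^sup>2 +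
      2 * c * t * (s * (\<Sum>j\<in>J. g j)) \<le> c\<^sup>2 * (F \<bullet> F) + W \<bullet> W"
    by (simp add: sum_subtractf)
  \<comment> \<open>This fixes \<open>t\<close>: the \<open>r s^2\<close> from the singular values
    of \<open>M\<close> is spread over at most \<open>k\<close> indices, and
    \<open>k t^2 = r\<close> makes the balance nonnegative.\<close>
  moreover have "real (card J) * (s\<^sup>2 * (1 - t\<^sup>2)) + real CARD('r) * s\<^sup>2 - real (card J) * s\<^sup>2 =
      s\<^sup>2 * (real CARD('r) - real (card J) * t\<^sup>2)"
    by (simp add: algebra_simps)
  moreover have "real (card J) * t\<^sup>2 \<le> real k * t\<^sup>2"
    using J(2) by (intro mult_right_mono) auto
  then have "0 \<le> real CARD('r) - real (card J) * t\<^sup>2"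
    using J(3) by (simp add: t(1))
  then have "0 \<le> s\<^sup>2 * (real CARD('r) - real (card J) * t\<^sup>2)"
    by (intro mult_nonneg_nonneg) auto
  ultimately show "2 * c * sqrt (real CARD('r) / real k) * (s * (\<Sum>j\<in>J. (x j \<bullet> x j + y j \<bullet> y j) / 2)) \<le>
      c\<^sup>2 * (norm F)\<^sup>2 + (norm W)\<^sup>2"
    unfolding t_def [symmetric] g_def [symmetric] power2_norm_eq_inner by linarith
qed

subsection \<open>The scalar argument\<close>

text \<open>Here \<open>a = |F|^2\<close>, \<open>b = |H - F|^2\<close>, \<open>w = <g, H>\<close>,
  \<open>z = <g, F>\<close>, and \<open>\<tau>\<close> already contains the factor \<open>s\<close>.
  \<open>cert\<close> is cocoercivity, available for every smoothness constant that is at least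
  \<open>L\<close> and above \<open>\<mu>\<close>.\<close>

lemma error_vanishes:
  fixes \<mu> L L2 t a b \<tau> w z :: real
  assumes t: "0 < t" and \<mu>: "0 < \<mu>" "\<mu> \<le> L" and L2: "0 \<le> L2" "L2 / (2 * t + L2 / L) < \<mu>"
    and ab: "0 \<le> a" "0 \<le> b"
    and w: "\<mu> * (a + b) \<le> w" "w \<le> z" "w \<le> L2 * \<tau>"
    and cert: "\<And>M \<rho>. L \<le> M \<Longrightarrow> \<mu> < M \<Longrightarrow> \<mu> * M * (a + b) \<le> (M + \<mu>) * w - 2 * \<rho> * z + \<rho>\<^sup>2 * a"
    and \<tau>: "\<And>c. 0 < c \<Longrightarrow> c \<le> 1 \<Longrightarrow> 2 * c * t * \<tau> \<le> c\<^sup>2 * a + b"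
  shows "a + b = 0"
proof (rule ccontr)
  assume "a + b \<noteq> 0"
  then have h: "0 < a + b" using ab by simp
  have w0: "0 < w"
    using w(1) mult_pos_pos [OF \<mu>(1) h] by linarith
  have L: "0 < L" using \<mu> by simp
  have "0 < 2 * t + L2 / L"
    using t L2(1) L by (simp add: add_pos_nonneg)
  then have "L2 < \<mu> * (2 * t + L2 / L)"
    using L2(2) by (simp add: divide_simps)
  then have "L2 * L < \<mu> * (2 * t + L2 / L) * L"
    using L by (rule mult_strict_right_mono)
  \<comment> \<open>The hypothesis on \<open>\<mu>\<close> with its denominators cleared.\<close>
  then have gap: "L2 * (L - \<mu>) < 2 * t * \<mu> * L"
    using L by (simp add: algebra_simps)
  \<comment> \<open>\<open>cert\<close> needs a constant strictly above \<open>\<mu>\<close>, but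
    \<open>L = \<mu>\<close> is possible. \<open>M\<close> exceeds \<open>L\<close> by so little
    that the strict inequality \<open>gap\<close> survives with \<open>M\<close> in place of
    \<open>L\<close>; the \<open>+ 1\<close> covers \<open>L2 = 0\<close>.\<close>
  define M where "M = L + (2 * t * \<mu> * L - L2 * (L - \<mu>)) / (L2 + 1)"
  have M: "L < M"
    using gap L2(1) by (simp add: M_def)
  have M0: "0 < M" "\<mu> < M" using M L \<mu> by auto
  have "L2 * (M - L) < 2 * t * \<mu> * L - L2 * (L - \<mu>)"
    using gap L2(1) by (simp add: M_def divide_simps)
  moreover have "0 < 2 * t * \<mu> * (M - L)"
    using t \<mu> M by simp
  ultimately have gapM: "L2 * (M - \<mu>) < 2 * t * \<mu> * M"
    by (simp add: algebra_simps)
  have contra: False if "2 * t * \<mu> * M * \<tau> \<le> (M - \<mu>) * w"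
  proof -
    have "(M - \<mu>) * w \<le> (M - \<mu>) * (L2 * \<tau>)"
      using w(3) M0 by (intro mult_left_mono) auto
    with that have "(2 * t * \<mu> * M - L2 * (M - \<mu>)) * \<tau> \<le> 0"
      by (simp add: algebra_simps)
    then have "\<tau> \<le> 0"
      using gapM by (simp add: mult_le_0_iff)
    then have "L2 * \<tau> \<le> 0"
      using L2(1) by (simp add: mult_nonneg_nonpos)
    with w0 w(3) show False by linarith
  qed
  have a: "a > 0"
  proof (rule ccontr)
    assume "\<not> a > 0"
    then have a: "a = 0" using ab by simp
    have z: "0 < z" using w0 w(2) by simp
    \<comment> \<open>For \<open>a = 0\<close> the right-hand side of \<open>cert\<close> is affine
      in \<open>\<rho>\<close> with negative slope; this is its zero.\<close>
    define \<rho> where "\<rho> = (M + \<mu>) * w / (2 * z)"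
    have "\<mu> * M * b \<le> (M + \<mu>) * w - 2 * \<rho> * z"
      using cert [of M \<rho>] M M0 a by simp
    also have "\<dots> = 0"
      using z by (simp add: \<rho>_def)
    finally have "b \<le> 0"
      using \<mu> M0 by (simp add: mult_le_0_iff)
    with h a show False by simp
  qed
  \<comment> \<open>The minimiser of \<open>- 2 * \<rho> * w + \<rho>\<^sup>2 * a\<close>.\<close>
  define \<rho> where "\<rho> = w / a"
  have \<rho>: "0 \<le> \<rho>" using w0 a by (simp add: \<rho>_def)
  have "\<mu> * M * (a + b) \<le> (M + \<mu>) * w - 2 * \<rho> * z + \<rho>\<^sup>2 * a"
    using cert [of M \<rho>] M M0 by simp
  also have "\<dots> \<le> (M + \<mu>) * w - 2 * \<rho> * w + \<rho>\<^sup>2 * a"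
    using w(2) \<rho> by (simp add: mult_left_mono)
  also have "\<dots> = (M + \<mu>) * w - \<rho> * w"
    using a by (simp add: \<rho>_def power2_eq_square)
  finally have *: "\<mu> * M * (a + b) \<le> (M + \<mu>) * w - \<rho> * w" .
  \<comment> \<open>With this \<open>\<rho>\<close>, \<open>cert\<close> factors into
    \<open>a * b \<le> X * Y\<close>, while the sum \<open>X + Y = (1 / \<mu> - 1 / M) * w\<close>
    no longer involves \<open>a\<close>.\<close>
  define X where "X = w / \<mu> - a"
  define Y where "Y = a - w / M"
  have "a * b \<le> X * Y"
  proof -
    have "\<mu> * M * (a * b) = a * (\<mu> * M * (a + b)) - \<mu> * M * a * a"
      by algebra
    also have "\<dots> \<le> a * ((M + \<mu>) * w - \<rho> * w) - \<mu> * M * a * a"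
      using * a by (intro diff_right_mono mult_left_mono) auto
    also have "\<dots> = (\<mu> * X) * (M * Y)"
      using \<mu> M0 a by (simp add: X_def Y_def \<rho>_def algebra_simps)
    finally have "\<mu> * M * (a * b) \<le> \<mu> * M * (X * Y)"
      by (simp add: mult_ac)
    then show ?thesis
      using \<mu> M0 by simp
  qed
  have X: "b \<le> X"
    using w(1) \<mu> by (simp add: X_def field_simps)
  have XY: "\<mu> * M * (X + Y) = (M - \<mu>) * w"
    using \<mu> M0 by (simp add: X_def Y_def field_simps)
  show False
  proof (cases "b = 0")
    case True
    \<comment> \<open>For \<open>b = 0\<close> the weight \<open>Y / a\<close> of the other case
      need not be positive. It is replaced by the largest value it can take, reached at
      \<open>w = \<mu> * a\<close>.\<close>
    define c where "c = (M - \<mu>) / M"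
    have c: "0 < c" "c \<le> 1" using M0 \<mu> by (simp_all add: c_def)
    have "2 * c * t * \<tau> \<le> c\<^sup>2 * a"
      using \<tau> [OF c] True by simp
    then have "c * (2 * t * \<tau>) \<le> c * (c * a)"
      by (simp add: power2_eq_square mult_ac)
    then have "2 * t * \<tau> \<le> c * a"
      using c by simp
    then have "2 * t * \<tau> * (\<mu> * M) \<le> c * a * (\<mu> * M)"
      using \<mu> M0 by (intro mult_right_mono) auto
    also have "\<dots> = (M - \<mu>) * (\<mu> * a)"
      using M0 by (simp add: c_def)
    also have "\<dots> \<le> (M - \<mu>) * w"
      using w(1) True M0 by (intro mult_left_mono) auto
    finally show False
      by (intro contra) (simp add: mult_ac)
  next
    case False
    then have b: "0 < b" using ab by simp
    with X have X0: "0 < X" by simp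
    have "0 < X * Y"
      using \<open>a * b \<le> X * Y\<close> mult_pos_pos [OF a b] by linarith
    then have Y0: "0 < Y"
      using X0 by (simp add: zero_less_mult_iff)
    \<comment> \<open>Now \<open>c\<^sup>2 * a = c * Y\<close> and \<open>b \<le> c * X\<close>, so
      the geometric inequality divided by \<open>c\<close> reads
      \<open>2 * t * \<tau> \<le> X + Y\<close>.\<close>
    define c where "c = Y / a"
    have c: "0 < c" "c \<le> 1"
      using Y0 a w0 M0 by (simp_all add: c_def Y_def)
    have "b \<le> c * X"
      using \<open>a * b \<le> X * Y\<close> a by (simp add: c_def field_simps)
    moreover have "c\<^sup>2 * a = c * Y"
      using a by (simp add: c_def power2_eq_square)
    ultimately have "c * (2 * t * \<tau>) \<le> c * (X + Y)"
      using \<tau> [OF c] by (simp add: algebra_simps)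
    then have "2 * t * \<tau> \<le> X + Y"
      using c by simp
    then have "\<mu> * M * (2 * t * \<tau>) \<le> \<mu> * M * (X + Y)"
      using \<mu> M0 by (intro mult_left_mono) auto
    then have "\<mu> * M * (2 * t * \<tau>) \<le> (M - \<mu>) * w"
      unfolding XY .
    then show False
      by (intro contra) (simp add: mult_ac)
  qed
qed

section \<open>Derivatives relative to a convex set, and cocoercivity of the gradient\<close>

text \<open>
  At a boundary point of the positive semidefinite cone a relative derivative is determined only along
  the recession directions \<open>K\<close>, and hence on \<open>T\<close>, which they span.
\<close>

locale recession_domain =
  fixes S T K :: "'a::euclidean_space set"
  assumes T: "subspace T" and convex_S: "convex S"
    and diff_in: "x \<in> S \<Longrightarrow> y \<in> S \<Longrightarrow> y - x \<in> T"
    and K: "K \<subseteq> T" "T \<subseteq> span K"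
    and ray: "x \<in> S \<Longrightarrow> A \<in> K \<Longrightarrow> 0 \<le> t \<Longrightarrow> x + t *\<^sub>R A \<in> S"
begin

text \<open>Along a ray with direction in \<open>K\<close> this is a one-sided derivative in one
  real variable, which is unique; linearity extends the agreement to the span of
  \<open>K\<close>.\<close>

lemma has_derivative_within_unique_on:
  fixes f :: "'a \<Rightarrow> 'b::real_normed_vector"
  assumes "x \<in> S" "(f has_derivative D) (at x within S)" "(f has_derivative D') (at x within S)"
    "A \<in> T"
  shows "D A = D' A"
proof -
  have ray_deriv: "((\<lambda>t. f (x + t *\<^sub>R A)) has_vector_derivative D A) (at 0 within {0..1})"
    if "(f has_derivative D) (at x within S)" "A \<in> K" for D A
  proof -
    have "((\<lambda>t. x + t *\<^sub>R A) has_derivative (\<lambda>t. t *\<^sub>R A)) (at 0 within {0..1})"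
      by (auto intro!: derivative_eq_intros)
    moreover have "(f has_derivative D) (at (x + 0 *\<^sub>R A) within ((\<lambda>t. x + t *\<^sub>R A) ` {0..1}))"
      using ray [OF assms(1) that(2)] by (auto intro!: has_derivative_subset [OF that(1)])
    ultimately have "((\<lambda>t. f (x + t *\<^sub>R A)) has_derivative (\<lambda>t. D (t *\<^sub>R A))) (at 0 within {0..1})"
      by (rule has_derivative_in_compose)
    then show ?thesis
      using linear_cmul [OF has_derivative_linear [OF that(1)]]
      by (simp add: has_vector_derivative_def)
  qed
  have "D B = D' B" if "B \<in> K" for B
    using ray_deriv [OF assms(2) that] ray_deriv [OF assms(3) that]
      vector_derivative_unique_within_closed_interval [of 0 1 "0 :: real"]
    by (fastforce simp: cbox_interval)
  then show ?thesis
    using linear_eq_on_span [OF has_derivative_linear [OF assms(2)] has_derivative_linear [OF assms(3)]]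
      assms(4) K(2) by blast
qed

lemma gradient_eqI:
  assumes "x \<in> S" "g \<in> T" "(f has_derivative (\<lambda>h. g \<bullet> h)) (at x within S)"
  shows "gradient S T f x = g"
  unfolding gradient_def
proof (rule the_equality)
  fix g' assume g': "g' \<in> T \<and> (f has_derivative (\<lambda>h. g' \<bullet> h)) (at x within S)"
  then have "g' - g \<in> T"
    using T assms(2) by (simp add: subspace_diff)
  with g' have "g' \<bullet> (g' - g) = g \<bullet> (g' - g)"
    using has_derivative_within_unique_on [OF assms(1) _ assms(3)] by blast
  then have "(g' - g) \<bullet> (g' - g) = 0"
    by (simp add: inner_diff_left)
  then show "g' = g" by simp
qed (use assms in auto)

text \<open>The vector representing any derivative may be projected orthogonally onto
  \<open>T\<close>: increments within \<open>S\<close> lie in \<open>T\<close>, so the discarded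
  component never acts.\<close>

lemma gradient_works:
  assumes x: "x \<in> S" and f: "f differentiable (at x within S)"
  shows "gradient S T f x \<in> T" "(f has_derivative (\<lambda>h. gradient S T f x \<bullet> h)) (at x within S)"
proof -
  obtain D where D: "(f has_derivative D) (at x within S)"
    using f unfolding differentiable_def by blast
  define g0 where "g0 = (\<Sum>b\<in>Basis. D b *\<^sub>R b)"
  have lin: "linear D" using D by (rule has_derivative_linear)
  have Dg0: "D h = g0 \<bullet> h" for h
  proof -
    have "D h = D (\<Sum>b\<in>Basis. (h \<bullet> b) *\<^sub>R b)"
      by (simp add: euclidean_representation)
    also have "\<dots> = (\<Sum>b\<in>Basis. (h \<bullet> b) * D b)"
      by (simp add: linear_sum [OF lin] linear_cmul [OF lin])
    also have "\<dots> = g0 \<bullet> h"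
      unfolding g0_def inner_sum_left inner_scaleR_left
      by (intro sum.cong refl) (simp add: inner_commute mult.commute)
    finally show ?thesis .
  qed
  obtain g z where g: "g \<in> span T" "\<And>y. y \<in> span T \<Longrightarrow> orthogonal z y" "g0 = g + z"
    using orthogonal_subspace_decomp_exists [of T g0] by metis
  have "(f has_derivative (\<lambda>h. g \<bullet> h)) (at x within S)"
    unfolding has_derivative_within_alt
  proof (intro conjI allI impI)
    show "bounded_linear (\<lambda>h. g \<bullet> h)" by (rule bounded_linear_inner_right)
    fix e :: real assume "0 < e"
    then obtain d where d: "d > 0"
      "\<And>y. y \<in> S \<Longrightarrow> norm (y - x) < d \<Longrightarrow> norm (f y - f x - D (y - x)) \<le> e * norm (y - x)"
      using D unfolding has_derivative_within_alt by blast
    have "D (y - x) = g \<bullet> (y - x)" if "y \<in> S" for y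
    proof -
      have "y - x \<in> span T"
        using diff_in [OF x that] by (rule span_base)
      then show ?thesis
        using g(2) by (simp add: Dg0 g(3) inner_add_left orthogonal_def)
    qed
    then show "\<exists>d>0. \<forall>y\<in>S. norm (y - x) < d \<longrightarrow> norm (f y - f x - g \<bullet> (y - x)) \<le> e * norm (y - x)"
      using d by (metis (no_types, lifting))
  qed
  moreover have "g \<in> T" using g(1) T by (metis span_eq_iff)
  moreover note gradient_eqI [OF x this \<open>(f has_derivative (\<lambda>h. g \<bullet> h)) (at x within S)\<close>]
  ultimately show "gradient S T f x \<in> T" "(f has_derivative (\<lambda>h. gradient S T f x \<bullet> h)) (at x within S)"
    by simp_all
qed

text \<open>Young's argument, with the gradient differentiable at the single point \<open>x\<close>.
  Only nonnegative multiples of directions in \<open>K\<close> occur, since \<open>x\<close> may be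
  a boundary point. The mean value theorem in direction \<open>B\<close> turns the mixed second
  difference into a difference of two values of \<open>G\<close>, each expanded at
  \<open>x\<close>.\<close>

lemma second_difference:
  assumes x: "x \<in> S" and f: "\<And>y. y \<in> S \<Longrightarrow> (f has_derivative (\<lambda>h. G y \<bullet> h)) (at y within S)"
    and D: "(G has_derivative D) (at x within S)" and AB: "A \<in> K" "B \<in> K" and e: "0 < e"
  shows "\<exists>d>0. \<forall>s. 0 < s \<and> s < d \<longrightarrow>
    \<bar>f (x + s *\<^sub>R A + s *\<^sub>R B) - f (x + s *\<^sub>R A) - f (x + s *\<^sub>R B) + f x - s\<^sup>2 * (D A \<bullet> B)\<bar> \<le> e * s\<^sup>2"
proof -
  define c where "c = norm A + norm B + 1"
  have c: "c > 0" "norm A \<le> c" "norm B \<le> c" "norm A + norm B \<le> c"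
    by (auto simp: c_def add_nonneg_pos)
  have lin: "linear D" using D by (rule has_derivative_linear)
  \<comment> \<open>Two remainders of size at most \<open>e' * (s * c)\<close> are paired with
    \<open>B\<close>, of norm at most \<open>c\<close>, and multiplied by \<open>s\<close>; together
    they give \<open>e * s\<^sup>2\<close>.\<close>
  define e' where "e' = e / (2 * c * c)"
  have e': "0 < e'" using e c by (simp add: e'_def)
  then obtain d where d: "d > 0"
    "\<And>y. y \<in> S \<Longrightarrow> norm (y - x) < d \<Longrightarrow> norm (G y - G x - D (y - x)) \<le> e' * norm (y - x)"
    using D unfolding has_derivative_within_alt by blast
  show ?thesis
  proof (intro exI conjI allI impI; (elim conjE)?)
    show "0 < d / c" using d c by simp
    fix s assume s: "0 < s" "s < d / c"
    have in_S: "x + p *\<^sub>R A + q *\<^sub>R B \<in> S" if "0 \<le> p" "0 \<le> q" for p q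
      using ray [OF ray [OF x AB(1) that(1)] AB(2) that(2)] .
    define h where "h q = f (x + s *\<^sub>R A + q *\<^sub>R B) - f (x + 0 *\<^sub>R A + q *\<^sub>R B)" for q
    have deriv: "((\<lambda>q. f (x + p *\<^sub>R A + q *\<^sub>R B)) has_derivative
        (\<lambda>r. r * (G (x + p *\<^sub>R A + q *\<^sub>R B) \<bullet> B))) (at q within {0..s})"
      if "0 \<le> p" "0 \<le> q" for p q
    proof -
      have "((\<lambda>q. x + p *\<^sub>R A + q *\<^sub>R B) has_derivative (\<lambda>r. r *\<^sub>R B)) (at q within {0..s})"
        by (auto intro!: derivative_eq_intros)
      moreover have "(f has_derivative (\<lambda>h. G (x + p *\<^sub>R A + q *\<^sub>R B) \<bullet> h))
          (at (x + p *\<^sub>R A + q *\<^sub>R B) within ((\<lambda>q. x + p *\<^sub>R A + q *\<^sub>R B) ` {0..s}))"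
        using that in_S by (auto intro!: has_derivative_subset [OF f])
      ultimately have "((\<lambda>q. f (x + p *\<^sub>R A + q *\<^sub>R B)) has_derivative
          (\<lambda>r. G (x + p *\<^sub>R A + q *\<^sub>R B) \<bullet> (r *\<^sub>R B))) (at q within {0..s})"
        by (rule has_derivative_in_compose)
      then show ?thesis by simp
    qed
    have "(h has_derivative (\<lambda>r. r * (G (x + s *\<^sub>R A + q *\<^sub>R B) \<bullet> B) - r * (G (x + 0 *\<^sub>R A + q *\<^sub>R B) \<bullet> B)))
        (at q within {0..s})" if "0 \<le> q" "q \<le> s" for q
      unfolding h_def using s that by (intro has_derivative_diff deriv) auto
    from mvt_simple [OF s(1) this] obtain q where q: "0 < q" "q < s"
      "h s - h 0 = s * (G (x + s *\<^sub>R A + q *\<^sub>R B) \<bullet> B) - s * (G (x + 0 *\<^sub>R A + q *\<^sub>R B) \<bullet> B)"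
      by auto
    have bound: "norm (G (x + p *\<^sub>R A + q *\<^sub>R B) - G x - D (p *\<^sub>R A + q *\<^sub>R B)) \<le> e' * (s * c)"
      if p: "0 \<le> p" "p \<le> s" for p
    proof -
      have "norm (p *\<^sub>R A + q *\<^sub>R B) \<le> p * norm A + q * norm B"
        using p q by (intro norm_triangle_le) simp
      also have "\<dots> \<le> s * norm A + s * norm B"
        using p q by (intro add_mono mult_right_mono) auto
      also have "\<dots> \<le> s * c"
        using s c by (simp add: distrib_left [symmetric])
      finally have n: "norm (p *\<^sub>R A + q *\<^sub>R B) \<le> s * c" .
      also have "s * c < d" using s c by (simp add: field_simps)
      finally have "norm (G (x + p *\<^sub>R A + q *\<^sub>R B) - G x - D (p *\<^sub>R A + q *\<^sub>R B)) \<le> e' * norm (p *\<^sub>R A + q *\<^sub>R B)"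
        using d(2) [OF in_S [of p q]] p q by (simp add: add.assoc)
      also have "\<dots> \<le> e' * (s * c)"
        using n e' by (intro mult_left_mono) auto
      finally show ?thesis .
    qed
    define r1 where "r1 = G (x + s *\<^sub>R A + q *\<^sub>R B) - G x - D (s *\<^sub>R A + q *\<^sub>R B)"
    define r2 where "r2 = G (x + 0 *\<^sub>R A + q *\<^sub>R B) - G x - D (0 *\<^sub>R A + q *\<^sub>R B)"
    have "G (x + s *\<^sub>R A + q *\<^sub>R B) - G (x + 0 *\<^sub>R A + q *\<^sub>R B) = s *\<^sub>R D A + (r1 - r2)"
      by (simp add: r1_def r2_def linear_add [OF lin] linear_cmul [OF lin])
    then have "h s - h 0 = s * ((s *\<^sub>R D A + (r1 - r2)) \<bullet> B)"
      unfolding q(3) right_diff_distrib [symmetric] inner_diff_left [symmetric] by (rule arg_cong)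
    then have "h s - h 0 = s\<^sup>2 * (D A \<bullet> B) + s * ((r1 - r2) \<bullet> B)"
      by (simp add: inner_add_left power2_eq_square algebra_simps)
    then have "\<bar>h s - h 0 - s\<^sup>2 * (D A \<bullet> B)\<bar> = s * \<bar>(r1 - r2) \<bullet> B\<bar>"
      using s by (simp add: abs_mult)
    also have "\<dots> \<le> s * (norm (r1 - r2) * norm B)"
      using s by (intro mult_left_mono Cauchy_Schwarz_ineq2) auto
    also have "\<dots> \<le> s * ((e' * (s * c) + e' * (s * c)) * c)"
      using s c e' bound [of s] bound [of 0]
      by (intro mult_left_mono mult_mono order_trans [OF norm_triangle_ineq4] add_mono)
        (auto simp: r1_def r2_def)
    also have "\<dots> = e * s\<^sup>2"
      using c by (simp add: e'_def power2_eq_square field_simps)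
    finally show "\<bar>f (x + s *\<^sub>R A + s *\<^sub>R B) - f (x + s *\<^sub>R A) - f (x + s *\<^sub>R B) + f x - s\<^sup>2 * (D A \<bullet> B)\<bar> \<le> e * s\<^sup>2"
      by (simp add: h_def algebra_simps)
  qed
qed

text \<open>The mixed second difference is invariant under exchanging \<open>A\<close> and
  \<open>B\<close>, so both orders have the same limit for directions in \<open>K\<close>;
  bilinearity carries this over to \<open>T\<close>.\<close>

lemma second_derivative_symmetric:
  assumes x: "x \<in> S" and f: "\<And>y. y \<in> S \<Longrightarrow> (f has_derivative (\<lambda>h. G y \<bullet> h)) (at y within S)"
    and D: "(G has_derivative D) (at x within S)" and AB: "A \<in> T" "B \<in> T"
  shows "D A \<bullet> B = D B \<bullet> A"
proof -
  have lin: "linear D" using D by (rule has_derivative_linear)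
  have cone: "D A \<bullet> B = D B \<bullet> A" if AB: "A \<in> K" "B \<in> K" for A B
  proof (rule ccontr)
    assume "D A \<bullet> B \<noteq> D B \<bullet> A"
    define e where "e = \<bar>D A \<bullet> B - D B \<bullet> A\<bar> / 3"
    have e: "0 < e" using \<open>_ \<noteq> _\<close> by (simp add: e_def)
    let ?\<Delta> = "\<lambda>s. f (x + s *\<^sub>R A + s *\<^sub>R B) - f (x + s *\<^sub>R A) - f (x + s *\<^sub>R B) + f x"
    obtain d1 where d1: "d1 > 0" "\<And>s. 0 < s \<Longrightarrow> s < d1 \<Longrightarrow> \<bar>?\<Delta> s - s\<^sup>2 * (D A \<bullet> B)\<bar> \<le> e * s\<^sup>2"
      using second_difference [OF x f D AB e] by blast
    obtain d2 where d2: "d2 > 0" "\<And>s. 0 < s \<Longrightarrow> s < d2 \<Longrightarrow>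
        \<bar>f (x + s *\<^sub>R B + s *\<^sub>R A) - f (x + s *\<^sub>R B) - f (x + s *\<^sub>R A) + f x - s\<^sup>2 * (D B \<bullet> A)\<bar> \<le> e * s\<^sup>2"
      using second_difference [OF x f D AB(2,1) e] by blast
    define s where "s = min d1 d2 / 2"
    have s: "0 < s" "s < d1" "s < d2" using d1(1) d2(1) by (auto simp: s_def)
    have swap: "x + s *\<^sub>R B + s *\<^sub>R A = x + s *\<^sub>R A + s *\<^sub>R B" by simp
    have "\<bar>s\<^sup>2 * (D A \<bullet> B) - s\<^sup>2 * (D B \<bullet> A)\<bar> \<le> 2 * (e * s\<^sup>2)"
      using d1(2) [OF s(1,2)] d2(2) [OF s(1,3)] unfolding swap by linarith
    moreover have "\<bar>s\<^sup>2 * (D A \<bullet> B) - s\<^sup>2 * (D B \<bullet> A)\<bar> = s\<^sup>2 * \<bar>D A \<bullet> B - D B \<bullet> A\<bar>"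
      by (simp add: right_diff_distrib [symmetric] abs_mult)
    ultimately have "s\<^sup>2 * \<bar>D A \<bullet> B - D B \<bullet> A\<bar> \<le> s\<^sup>2 * (2 * e)"
      by (simp add: mult_ac)
    then have "\<bar>D A \<bullet> B - D B \<bullet> A\<bar> \<le> 2 * e"
      using s by simp
    then show False using e by (simp add: e_def)
  qed
  have "D A \<bullet> B = D B \<bullet> A" if "A \<in> K" "B \<in> span K" for A B
  proof (rule linear_eq_on_span [of "\<lambda>B. D A \<bullet> B" "\<lambda>B. D B \<bullet> A" K])
    show "linear (\<lambda>B. D A \<bullet> B)"
      by (intro linearI) (auto simp: inner_add_right)
    show "linear (\<lambda>B. D B \<bullet> A)"
      by (intro linearI) (auto simp: inner_add_left linear_add [OF lin] linear_cmul [OF lin])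
  qed (use cone that in auto)
  then have "D A \<bullet> B = D B \<bullet> A" if "A \<in> span K" "B \<in> span K" for A B
  proof (rule_tac linear_eq_on_span [of "\<lambda>A. D A \<bullet> B" "\<lambda>A. D B \<bullet> A" K])
    show "linear (\<lambda>A. D B \<bullet> A)"
      by (intro linearI) (auto simp: inner_add_right)
    show "linear (\<lambda>A. D A \<bullet> B)"
      by (intro linearI) (auto simp: inner_add_left linear_add [OF lin] linear_cmul [OF lin])
  qed (use that in auto)
  then show ?thesis
    using AB K(2) by blast
qed

text \<open>The mean value theorem for the scalar function
  \<open>G (M + t (N - M)) \<bullet> Z\<close> of \<open>t\<close> replaces the integral of the
  Hessian, which would require its integrability.\<close>

lemma gradient_increment_ge:
  assumes "\<And>y. y \<in> S \<Longrightarrow> (G has_derivative D y) (at y within S)" and M: "M \<in> S" "N \<in> S"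
    and C: "\<And>t. 0 \<le> t \<Longrightarrow> t \<le> 1 \<Longrightarrow> C \<le> D (M + t *\<^sub>R (N - M)) (N - M) \<bullet> Z"
  shows "C \<le> (G N - G M) \<bullet> (Z :: 'a)"
proof -
  define p where "p t = M + t *\<^sub>R (N - M)" for t
  have p: "p t \<in> S" if "0 \<le> t" "t \<le> 1" for t
  proof -
    have "p t = (1 - t) *\<^sub>R M + t *\<^sub>R N" by (simp add: p_def algebra_simps)
    then show ?thesis using convexD_alt [OF convex_S M that] by simp
  qed
  have "((\<lambda>t. G (p t) \<bullet> Z) has_derivative (\<lambda>r. r * (D (p t) (N - M) \<bullet> Z))) (at t within {0..1})"
    if t: "0 \<le> t" "t \<le> 1" for t
  proof -
    have "(p has_derivative (\<lambda>r. r *\<^sub>R (N - M))) (at t within {0..1})"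
      unfolding p_def by (auto intro!: derivative_eq_intros)
    moreover have "(G has_derivative D (p t)) (at (p t) within (p ` {0..1}))"
      using p t by (intro has_derivative_subset [OF assms(1)]) auto
    ultimately have "((\<lambda>t. G (p t)) has_derivative (\<lambda>r. D (p t) (r *\<^sub>R (N - M)))) (at t within {0..1})"
      by (rule has_derivative_in_compose)
    then have "((\<lambda>t. G (p t) \<bullet> Z) has_derivative (\<lambda>r. D (p t) (r *\<^sub>R (N - M)) \<bullet> Z)) (at t within {0..1})"
      by (rule has_derivative_inner_left)
    moreover have "linear (D (p t))"
      using assms(1) [OF p [OF t]] by (rule has_derivative_linear)
    ultimately show ?thesis
      by (simp add: linear_cmul)
  qed
  from mvt_simple [OF zero_less_one this] obtain t where
    "0 < t" "t < 1" "G (p 1) \<bullet> Z - G (p 0) \<bullet> Z = D (p t) (N - M) \<bullet> Z"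
    by auto
  then show ?thesis
    using C [of t] by (simp add: p_def inner_diff_left)
qed

text \<open>
  The second inequality is cocoercivity of the gradient tested in the direction \<open>F\<close>. At every point
  of the segment it is the sum of \<open>\<mu> |E|\<^sup>2 \<le> \<nabla>\<^sup>2 f[E, E]\<close> for \<open>E = L H - \<rho> F\<close> and of
  \<open>\<nabla>\<^sup>2 f[E, E] \<le> L |E|\<^sup>2\<close> for \<open>E = \<rho> F - \<mu> H\<close>, in which \<open>\<nabla>\<^sup>2 f[F, F]\<close> cancels.
\<close>

lemma restricted_cocoercive:
  assumes f: "twice_differentiable_on S T f" and M: "M \<in> S" "N \<in> S" and F: "F \<in> T"
    and H: "H = N - M" and g: "g = gradient S T f N - gradient S T f M"
    and lower: "\<And>t a b. 0 \<le> t \<Longrightarrow> t \<le> 1 \<Longrightarrow> \<mu> * (norm (a *\<^sub>R H + b *\<^sub>R F))\<^sup>2 \<le>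
      hessian S T f (M + t *\<^sub>R H) (a *\<^sub>R H + b *\<^sub>R F) (a *\<^sub>R H + b *\<^sub>R F)"
    and upper: "\<And>t a b. 0 \<le> t \<Longrightarrow> t \<le> 1 \<Longrightarrow>
      hessian S T f (M + t *\<^sub>R H) (a *\<^sub>R H + b *\<^sub>R F) (a *\<^sub>R H + b *\<^sub>R F) \<le>
      L * (norm (a *\<^sub>R H + b *\<^sub>R F))\<^sup>2"
  shows "\<mu> * (norm H)\<^sup>2 \<le> g \<bullet> H"
    and "\<mu> < L \<Longrightarrow> \<mu> * L * (norm H)\<^sup>2 \<le> (L + \<mu>) * (g \<bullet> H) - 2 * \<rho> * (g \<bullet> F) + \<rho>\<^sup>2 * (norm F)\<^sup>2"
proof -
  define D where "D y = frechet_derivative (gradient S T f) (at y within S)" for y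
  have grad: "(f has_derivative (\<lambda>h. gradient S T f y \<bullet> h)) (at y within S)" if "y \<in> S" for y
    using f that by (intro gradient_works) (auto simp: twice_differentiable_on_def differentiable_on_def)
  have D: "(gradient S T f has_derivative D y) (at y within S)" if "y \<in> S" for y
    using f that unfolding D_def frechet_derivative_works [symmetric]
    by (auto simp: twice_differentiable_on_def differentiable_on_def)
  have hess: "hessian S T f y A B = D y A \<bullet> B" for y A B
    by (simp add: hessian_def D_def)
  have lower': "\<mu> * (norm (a *\<^sub>R H + b *\<^sub>R F))\<^sup>2 \<le> D (M + t *\<^sub>R H) (a *\<^sub>R H + b *\<^sub>R F) \<bullet> (a *\<^sub>R H + b *\<^sub>R F)"
    and upper': "D (M + t *\<^sub>R H) (a *\<^sub>R H + b *\<^sub>R F) \<bullet> (a *\<^sub>R H + b *\<^sub>R F) \<le> L * (norm (a *\<^sub>R H + b *\<^sub>R F))\<^sup>2"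
    if "0 \<le> t" "t \<le> 1" for a b t
    using lower [OF that, of a b] upper [OF that, of a b] unfolding hess by blast+
  show "\<mu> * (norm H)\<^sup>2 \<le> g \<bullet> H"
    unfolding g
    using lower' [of _ 1 0] by (intro gradient_increment_ge [OF D M]) (auto simp: H)
  assume "\<mu> < L"
  \<comment> \<open>Adding the two quadratic inequalities leaves exactly the Hessian in the
    directions \<open>H\<close> and \<open>Z\<close>. Every term then carries the factor
    \<open>L - \<mu>\<close>, which is cancelled at the end.\<close>
  define Z where "Z = (L\<^sup>2 - \<mu>\<^sup>2) *\<^sub>R H - (2 * (L - \<mu>) * \<rho>) *\<^sub>R F"
  have "(L - \<mu>) * (\<mu> * L * (H \<bullet> H) - \<rho>\<^sup>2 * (F \<bullet> F)) \<le> g \<bullet> Z"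
    unfolding g
  proof (rule gradient_increment_ge [OF D M])
    fix t :: real assume t: "0 \<le> t" "t \<le> 1"
    let ?y = "M + t *\<^sub>R H"
    have "?y = (1 - t) *\<^sub>R M + t *\<^sub>R N" by (simp add: H algebra_simps)
    then have y: "?y \<in> S" using convexD_alt [OF convex_S M t] by simp
    have "H \<in> T" unfolding H using diff_in M by blast
    then have sym: "D ?y F \<bullet> H = D ?y H \<bullet> F"
      by (intro second_derivative_symmetric [OF y grad D] y F)
    have lin: "linear (D ?y)" using D [OF y] by (rule has_derivative_linear)
    have expand: "D ?y (a *\<^sub>R H + b *\<^sub>R F) \<bullet> (a *\<^sub>R H + b *\<^sub>R F) =
        a * a * (D ?y H \<bullet> H) + 2 * a * b * (D ?y H \<bullet> F) + b * b * (D ?y F \<bullet> F)" for a b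
      by (simp add: linear_add [OF lin] linear_cmul [OF lin] inner_add sym algebra_simps)
    have norm: "(norm (a *\<^sub>R H + b *\<^sub>R F))\<^sup>2 = a * a * (H \<bullet> H) + 2 * a * b * (H \<bullet> F) + b * b * (F \<bullet> F)" for a b
      by (simp add: power2_norm_eq_inner inner_add inner_commute [of F H] algebra_simps)
    have "D ?y H \<bullet> Z - (L - \<mu>) * (\<mu> * L * (H \<bullet> H) - \<rho>\<^sup>2 * (F \<bullet> F)) =
      (D ?y (L *\<^sub>R H + (- \<rho>) *\<^sub>R F) \<bullet> (L *\<^sub>R H + (- \<rho>) *\<^sub>R F) - \<mu> * (norm (L *\<^sub>R H + (- \<rho>) *\<^sub>R F))\<^sup>2) +
      (L * (norm ((- \<mu>) *\<^sub>R H + \<rho> *\<^sub>R F))\<^sup>2 - D ?y ((- \<mu>) *\<^sub>R H + \<rho> *\<^sub>R F) \<bullet> ((- \<mu>) *\<^sub>R H + \<rho> *\<^sub>R F))"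
      unfolding expand norm Z_def
      by (simp add: inner_diff_right power2_eq_square algebra_simps)
    then show "(L - \<mu>) * (\<mu> * L * (H \<bullet> H) - \<rho>\<^sup>2 * (F \<bullet> F)) \<le> D (M + t *\<^sub>R (N - M)) (N - M) \<bullet> Z"
      using lower' [OF t, of L "- \<rho>"] upper' [OF t, of "- \<mu>" \<rho>] unfolding H [symmetric] by linarith
  qed
  also have "g \<bullet> Z = (L - \<mu>) * ((L + \<mu>) * (g \<bullet> H) - 2 * \<rho> * (g \<bullet> F))"
    by (simp add: Z_def inner_diff_right power2_eq_square algebra_simps)
  finally have "\<mu> * L * (H \<bullet> H) - \<rho>\<^sup>2 * (F \<bullet> F) \<le> (L + \<mu>) * (g \<bullet> H) - 2 * \<rho> * (g \<bullet> F)"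
    using \<open>\<mu> < L\<close> by simp
  then show "\<mu> * L * (norm H)\<^sup>2 \<le> (L + \<mu>) * (g \<bullet> H) - 2 * \<rho> * (g \<bullet> F) + \<rho>\<^sup>2 * (norm F)\<^sup>2"
    by (simp add: power2_norm_eq_inner)
qed

end

section \<open>The optimal restricted constants, and the two domains\<close>

lemma hessian_zero: "hessian S T f x A 0 = 0"
  by (simp add: hessian_def)

text \<open>For nonzero \<open>E\<close>, the quotient
  \<open>hessian S T f M E E / (norm E)\<^sup>2\<close> separates all lower constants from all upper
  ones, so the bounds pass to the supremum and the infimum. The witness \<open>M0\<close>,
  \<open>E0\<close> keeps the set of lower constants bounded, so that \<open>Sup\<close> is
  meaningful.\<close>

lemma restricted_consts:
  fixes S T :: "(real ^ 'n ^ 'm) set"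
  assumes ex: "\<exists>a b. restricted_sc_smooth S T k l a b f"
    and wit: "M0 \<in> S" "rank M0 \<le> l" "E0 \<in> T" "rank E0 \<le> k" "E0 \<noteq> 0"
    and \<mu>: "\<mu> = rsc_const S T k l f" and L: "L = rsm_const S T k l f"
  shows "0 \<le> \<mu>" "\<mu> \<le> L"
    and "\<And>M E. M \<in> S \<Longrightarrow> E \<in> T \<Longrightarrow> rank M \<le> l \<Longrightarrow> rank E \<le> k \<Longrightarrow> \<mu> * (norm E)\<^sup>2 \<le> hessian S T f M E E"
    and "\<And>M E. M \<in> S \<Longrightarrow> E \<in> T \<Longrightarrow> rank M \<le> l \<Longrightarrow> rank E \<le> k \<Longrightarrow> hessian S T f M E E \<le> L * (norm E)\<^sup>2"
proof -
  let ?A = "{\<mu>. \<exists>L. restricted_sc_smooth S T k l \<mu> L f}"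
  let ?B = "{L. \<exists>\<mu>. restricted_sc_smooth S T k l \<mu> L f}"
  obtain a b where ab: "restricted_sc_smooth S T k l a b f" using ex by blast
  have bounds: "c * (norm E)\<^sup>2 \<le> hessian S T f M E E" "hessian S T f M E E \<le> d * (norm E)\<^sup>2" "0 \<le> c" "c \<le> d"
    if "restricted_sc_smooth S T k l c d f" "M \<in> S" "E \<in> T" "rank M \<le> l" "rank E \<le> k" for c d M E
    using that by (auto simp: restricted_sc_smooth_def)
  have quot: "c \<le> hessian S T f M E E / (norm E)\<^sup>2" "hessian S T f M E E / (norm E)\<^sup>2 \<le> d"
    if "restricted_sc_smooth S T k l c d f" "M \<in> S" "E \<in> T" "rank M \<le> l" "rank E \<le> k" "E \<noteq> 0" for c d M E
    using bounds(1,2) [OF that(1-5)] that(6) by (simp_all add: field_simps)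
  have "bdd_above ?A"
    using quot(1) [OF _ wit(1,3,2,4,5)] by (intro bdd_aboveI) blast
  moreover have "a \<in> ?A" using ab by blast
  ultimately have "a \<le> \<mu>"
    unfolding \<mu> rsc_const_def by (intro cSup_upper)
  with bounds(3) [OF ab wit(1,3,2,4)] show "0 \<le> \<mu>" by simp
  show lower: "\<mu> * (norm E)\<^sup>2 \<le> hessian S T f M E E"
    if "M \<in> S" "E \<in> T" "rank M \<le> l" "rank E \<le> k" for M E
  proof (cases "E = 0")
    case False
    have "\<mu> \<le> hessian S T f M E E / (norm E)\<^sup>2"
      unfolding \<mu> rsc_const_def using \<open>a \<in> ?A\<close> quot(1) [OF _ that False]
      by (intro cSup_least) blast+
    then show ?thesis using False by (simp add: field_simps)
  qed (simp add: hessian_zero)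
  show upper: "hessian S T f M E E \<le> L * (norm E)\<^sup>2"
    if "M \<in> S" "E \<in> T" "rank M \<le> l" "rank E \<le> k" for M E
  proof (cases "E = 0")
    case False
    have "hessian S T f M E E / (norm E)\<^sup>2 \<le> L"
      unfolding L rsm_const_def using ab quot(2) [OF _ that False]
      by (intro cInf_greatest) blast+
    then show ?thesis using False by (simp add: field_simps)
  qed (simp add: hessian_zero)
  have "\<mu> * (norm E0)\<^sup>2 \<le> L * (norm E0)\<^sup>2"
    using lower upper wit by (meson order_trans)
  then show "\<mu> \<le> L" using wit(5) by simp
qed

lemma restricted_sc_smooth_mono:
  "restricted_sc_smooth S T k l a b f \<Longrightarrow> 1 \<le> k' \<Longrightarrow> k' \<le> k \<Longrightarrow> restricted_sc_smooth S T k' l a b f"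
  by (auto simp: restricted_sc_smooth_def)

lemma rank_outer_le: "rank (outer x y) \<le> 1"
  by (rule order_trans [OF range_subset_imp_rank_le [of "{x}"]])
    (auto simp: outer_mult_vec intro: span_scale span_base)

interpretation UNIV_domain: recession_domain UNIV UNIV UNIV
  by unfold_locales auto

lemma subspace_symmetric_mats: "subspace symmetric_mats"
  by (auto simp: subspace_def symmetric_mats_def transpose_add transpose_scalar)
    (simp add: transpose_def vec_eq_iff)

lemma psd_mats_add: "A \<in> psd_mats \<Longrightarrow> B \<in> psd_mats \<Longrightarrow> A + B \<in> psd_mats"
  using subspace_add [OF subspace_symmetric_mats]
  by (auto simp: psd_mats_def matrix_vector_mult_add_rdistrib inner_add_right)

lemma psd_mats_scale: "A \<in> psd_mats \<Longrightarrow> 0 \<le> t \<Longrightarrow> t *\<^sub>R A \<in> psd_mats"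
  using subspace_scale [OF subspace_symmetric_mats]
  by (auto simp: psd_mats_def scaleR_matrix_vector_assoc [symmetric])

text \<open>\<open>A = (A + |A| I) - |A| I\<close>, and the Frobenius norm dominates the quadratic
  form of \<open>A\<close>.\<close>

lemma symmetric_mats_subset_span_psd: "symmetric_mats \<subseteq> span (psd_mats :: (real ^ 'd ^ 'd) set)"
proof
  fix A :: "real ^ 'd ^ 'd"
  assume A: "A \<in> symmetric_mats"
  let ?I = "norm A *\<^sub>R (mat 1 :: real ^ 'd ^ 'd)"
  have I: "?I \<in> psd_mats"
    by (simp add: psd_mats_def symmetric_mats_def transpose_scalar scaleR_matrix_vector_assoc [symmetric])
  have "0 \<le> x \<bullet> ((A + ?I) *v x)" for x
  proof -
    have "\<bar>A \<bullet> outer x x\<bar> \<le> norm A * norm (outer x x)"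
      by (rule Cauchy_Schwarz_ineq2)
    then have "- (norm A * (norm x * norm x)) \<le> x \<bullet> (A *v x)"
      unfolding inner_outer norm_outer by linarith
    then show ?thesis
      by (simp add: matrix_vector_mult_add_rdistrib scaleR_matrix_vector_assoc [symmetric]
          inner_add_right dot_square_norm power2_eq_square)
  qed
  moreover have "A + ?I \<in> symmetric_mats"
    using A I by (intro subspace_add [OF subspace_symmetric_mats]) (simp_all add: psd_mats_def)
  ultimately have "A + ?I \<in> psd_mats"
    by (simp add: psd_mats_def)
  then have "(A + ?I) - ?I \<in> span psd_mats"
    using I by (intro span_diff span_base)
  then show "A \<in> span psd_mats" by simp
qed

text \<open>A convex cone is closed under addition of its own elements, so it serves as its own set
  of recession directions.\<close>

interpretation psd_domain: recession_domain psd_mats symmetric_mats psd_mats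
proof
  show "convex psd_mats"
    unfolding convex_def by (blast intro: psd_mats_add psd_mats_scale)
  show "y - x \<in> symmetric_mats" if "x \<in> psd_mats" "y \<in> psd_mats" for x y :: "real ^ 'd ^ 'd"
    using that by (auto simp: psd_mats_def intro: subspace_diff [OF subspace_symmetric_mats])
  show "x + t *\<^sub>R A \<in> psd_mats" if "x \<in> psd_mats" "A \<in> psd_mats" "0 \<le> t" for x A :: "real ^ 'd ^ 'd" and t
    using that by (intro psd_mats_add psd_mats_scale)
  show "psd_mats \<subseteq> symmetric_mats"
    unfolding psd_mats_def by blast
qed (rule subspace_symmetric_mats, rule symmetric_mats_subset_span_psd)

section \<open>Orthogonal frames and balanced factors\<close>

lemma outer_mult_sum: "(\<Sum>i\<in>I. outer (p i) (q i)) *v z = (\<Sum>i\<in>I. (q i \<bullet> z) *\<^sub>R p i)"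
  by (simp add: sum_mult_vec outer_mult_vec)

lemma inner_sum_orthogonal:
  fixes p :: "'i \<Rightarrow> 'a::real_inner"
  assumes "finite I" "\<And>i j. i \<in> I \<Longrightarrow> j \<in> I \<Longrightarrow> i \<noteq> j \<Longrightarrow> p i \<bullet> p j = 0"
  shows "(\<Sum>i\<in>I. a i *\<^sub>R p i) \<bullet> (\<Sum>i\<in>I. b i *\<^sub>R p i) = (\<Sum>i\<in>I. a i * b i * (p i \<bullet> p i))"
proof -
  have "(a i *\<^sub>R p i) \<bullet> (b k *\<^sub>R p k) = (if k = i then a i * b i * (p i \<bullet> p i) else 0)"
    if "i \<in> I" "k \<in> I" for i k
    using assms(2) [OF that] by (cases "i = k") simp_all
  then have "(\<Sum>i\<in>I. \<Sum>k\<in>I. (a i *\<^sub>R p i) \<bullet> (b k *\<^sub>R p k)) =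
      (\<Sum>i\<in>I. \<Sum>k\<in>I. if k = i then a i * b i * (p i \<bullet> p i) else 0)"
    by (intro sum.cong refl)
  also have "\<dots> = (\<Sum>i\<in>I. a i * b i * (p i \<bullet> p i))"
    using assms(1) by (intro sum.cong refl) (simp only: sum.delta if_True)
  finally show ?thesis
    unfolding inner_sum_left by (simp only: inner_sum_right)
qed

text \<open>
  Right multiplication of both factors by the same orthogonal matrix preserves the product and
  the Gram matrices. It can be chosen to diagonalise the Gram matrix of the vectors \<open>g u\<^sub>j + h v\<^sub>j\<close>.
\<close>

lemma rotate_factors:
  fixes p :: "'i \<Rightarrow> real ^ 'm" and q :: "'i \<Rightarrow> real ^ 'n" and g :: "real ^ 'm \<Rightarrow> 'c::real_inner"
  assumes I: "finite I"
    and orth_p: "\<And>i j. i \<in> I \<Longrightarrow> j \<in> I \<Longrightarrow> i \<noteq> j \<Longrightarrow> p i \<bullet> p j = 0"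
    and orth_q: "\<And>i j. i \<in> I \<Longrightarrow> j \<in> I \<Longrightarrow> i \<noteq> j \<Longrightarrow> q i \<bullet> q j = 0"
    and norm: "\<And>i. i \<in> I \<Longrightarrow> norm (p i) = norm (q i)" and nz: "\<And>i. i \<in> I \<Longrightarrow> p i \<noteq> 0"
    and lin: "linear g" "linear h"
  obtains J :: "(real ^ 'n) set" and c u v where "finite J" "card J \<le> card I"
    "(\<Sum>j\<in>J. outer (u j) (v j)) = (\<Sum>i\<in>I. outer (p i) (q i))"
    "\<And>j l. u j \<bullet> u l = v j \<bullet> v l"
    "(\<Sum>j\<in>J. u j \<bullet> u j) = (\<Sum>i\<in>I. p i \<bullet> p i)"
    "\<And>j l. j \<in> J \<Longrightarrow> l \<in> J \<Longrightarrow> j \<noteq> l \<Longrightarrow> (g (u j) + h (v j)) \<bullet> (g (u l) + h (v l)) = 0"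
    "\<And>j. u j = (\<Sum>i\<in>I. c j i *\<^sub>R p i)" "\<And>j. v j = (\<Sum>i\<in>I. c j i *\<^sub>R q i)"
proof -
  \<comment> \<open>The orthogonal matrix is encoded by an orthonormal basis \<open>J\<close> of the
    span of the normalised \<open>q i\<close>: its entries are \<open>z \<bullet> e i\<close>, and
    \<open>u z\<close>, \<open>v z\<close> are the rotated vectors.\<close>
  define e where "e i = q i /\<^sub>R norm (q i)" for i
  have q0: "q i \<noteq> 0" if "i \<in> I" for i
    using norm [OF that] nz [OF that] by auto
  have ee: "e i \<bullet> e j = (if i = j then 1 else 0)" if "i \<in> I" "j \<in> I" for i j
    using orth_q [OF that] q0 [OF that(1)]
    by (auto simp: e_def dot_square_norm power2_eq_square divide_simps)
  define u where "u z = (\<Sum>i\<in>I. (z \<bullet> e i) *\<^sub>R p i)" for z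
  define v where "v z = (\<Sum>i\<in>I. (z \<bullet> e i) *\<^sub>R q i)" for z
  have lin_u: "linear u" and lin_v: "linear v"
    unfolding u_def v_def
    by (intro linear_compose_sum ballI linearI; simp add: inner_add_left scaleR_add_left)+
  define R where "R z = g (u z) + h (v z)" for z
  have "linear R"
    unfolding R_def using linear_compose [OF lin_u lin(1)] linear_compose [OF lin_v lin(2)]
    by (intro linear_compose_add) (simp_all add: o_def)
  from orthogonal_image_basis_exists [OF subspace_span [of "e ` I"] this] obtain J where
    J: "finite J" "card J = dim (span (e ` I))" "span J = span (e ` I)" "\<forall>e\<in>J. norm e = 1"
    "pairwise orthogonal J" "\<forall>a\<in>J. \<forall>b\<in>J. a \<noteq> b \<longrightarrow> R a \<bullet> R b = 0"
    by blast
  have "card J \<le> card (e ` I)"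
    using I J(2) dim_le_card [of "span (e ` I)" "e ` I"] by simp
  also have "\<dots> \<le> card I"
    by (rule card_image_le [OF I])
  finally have card: "card J \<le> card I" .
  \<comment> \<open>Parseval in the basis \<open>J\<close>, which is orthogonality of the matrix in
    its other index; it preserves the product and the sum of squares.\<close>
  have sumJ: "(\<Sum>z\<in>J. (z \<bullet> e i) * (z \<bullet> e k)) = (if i = k then 1 else 0)" if "i \<in> I" "k \<in> I" for i k
  proof -
    have "e k \<in> span J" using that J(3) by (simp add: span_base)
    have "(\<Sum>z\<in>J. (z \<bullet> e i) * (z \<bullet> e k)) = e i \<bullet> (\<Sum>z\<in>J. (e k \<bullet> z) *\<^sub>R z)"
      by (simp add: inner_sum_right inner_commute mult.commute)
    also have "\<dots> = e i \<bullet> e k"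
      using orthonormal_expand [OF J(1,5,4) \<open>e k \<in> span J\<close>] by simp
    finally show ?thesis using ee [OF that] by simp
  qed
  have "(\<Sum>z\<in>J. outer (u z) (v z)) = (\<Sum>z\<in>J. \<Sum>i\<in>I. \<Sum>k\<in>I. ((z \<bullet> e i) * (z \<bullet> e k)) *\<^sub>R outer (p i) (q k))"
    unfolding u_def v_def
    by (intro sum.cong refl, subst outer.sum_left, intro sum.cong refl, subst outer.sum_right)
      (simp add: outer.scaleR_left outer.scaleR_right mult.commute)
  also have "\<dots> = (\<Sum>i\<in>I. \<Sum>k\<in>I. \<Sum>z\<in>J. ((z \<bullet> e i) * (z \<bullet> e k)) *\<^sub>R outer (p i) (q k))"
    by (simp only: sum.swap [of _ I J])
  also have "\<dots> = (\<Sum>i\<in>I. \<Sum>k\<in>I. if k = i then outer (p i) (q k) else 0)"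
    unfolding scaleR_sum_left [symmetric] by (intro sum.cong refl) (auto simp: sumJ)
  also have "\<dots> = (\<Sum>i\<in>I. outer (p i) (q i))"
    using I by simp
  finally have prod: "(\<Sum>z\<in>J. outer (u z) (v z)) = (\<Sum>i\<in>I. outer (p i) (q i))" .
  have uu: "u y \<bullet> u z = (\<Sum>i\<in>I. (y \<bullet> e i) * (z \<bullet> e i) * (p i \<bullet> p i))" for y z
    unfolding u_def by (rule inner_sum_orthogonal [OF I orth_p])
  have vv: "v y \<bullet> v z = (\<Sum>i\<in>I. (y \<bullet> e i) * (z \<bullet> e i) * (q i \<bullet> q i))" for y z
    unfolding v_def by (rule inner_sum_orthogonal [OF I orth_q])
  have gram: "u y \<bullet> u z = v y \<bullet> v z" for y z
    unfolding uu vv by (intro sum.cong refl) (simp add: norm dot_square_norm)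
  have "(\<Sum>z\<in>J. u z \<bullet> u z) = (\<Sum>i\<in>I. (\<Sum>z\<in>J. (z \<bullet> e i) * (z \<bullet> e i)) * (p i \<bullet> p i))"
    unfolding uu by (subst sum.swap) (simp add: sum_distrib_right)
  also have "\<dots> = (\<Sum>i\<in>I. p i \<bullet> p i)"
    by (intro sum.cong refl) (simp add: sumJ)
  finally have sum_u: "(\<Sum>z\<in>J. u z \<bullet> u z) = (\<Sum>i\<in>I. p i \<bullet> p i)" .
  show ?thesis
  proof (rule that [OF J(1) card prod gram sum_u])
    show "(g (u j) + h (v j)) \<bullet> (g (u l) + h (v l)) = 0" if "j \<in> J" "l \<in> J" "j \<noteq> l" for j l
      using J(6) that by (simp add: R_def)
  qed (simp_all add: u_def v_def)
qed

text \<open>\<open>A\<close> maps \<open>q k\<close> to a multiple of \<open>p k\<close> and, being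
  symmetric, \<open>p k\<close> to the same multiple of \<open>q k\<close>. So \<open>A\<close>
  multiplies \<open>p k - q k\<close> by a negative number, which semidefiniteness allows only for
  zero. The singular value decomposition is thus a spectral one.\<close>

lemma psd_factors_eq:
  assumes "(\<Sum>i\<in>I. outer (p i) (q i)) \<in> psd_mats" "finite I" "k \<in> I"
    and orth_p: "\<And>i. i \<in> I \<Longrightarrow> i \<noteq> k \<Longrightarrow> p i \<bullet> p k = 0"
    and orth_q: "\<And>i. i \<in> I \<Longrightarrow> i \<noteq> k \<Longrightarrow> q i \<bullet> q k = 0"
    and norm: "norm (p k) = norm (q k)" and nz: "p k \<noteq> 0"
  shows "p k = q k"
proof -
  define A where "A = (\<Sum>i\<in>I. outer (p i) (q i))"
  have psd: "0 \<le> x \<bullet> (A *v x)" and sym: "transpose A = A" for x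
    using assms(1) by (auto simp: A_def psd_mats_def symmetric_mats_def)
  have sum_eq: "(\<Sum>i\<in>I. c i *\<^sub>R y i) = c k *\<^sub>R y k" if "\<And>i. i \<in> I \<Longrightarrow> i \<noteq> k \<Longrightarrow> c i = 0"
    for c and y :: "_ \<Rightarrow> real ^ 'a"
  proof -
    have "(\<Sum>i\<in>I. c i *\<^sub>R y i) = (\<Sum>i\<in>I. if i = k then c k *\<^sub>R y k else 0)"
      using that by (intro sum.cong) auto
    then show ?thesis using assms(2,3) by simp
  qed
  have "A *v q k = (q k \<bullet> q k) *\<^sub>R p k"
    unfolding A_def outer_mult_sum by (rule sum_eq) (rule orth_q)
  moreover have "transpose A *v p k = (p k \<bullet> p k) *\<^sub>R q k"
    unfolding A_def transpose_sum transpose_outer outer_mult_sum by (rule sum_eq) (rule orth_p)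
  moreover have pq: "p k \<bullet> p k = q k \<bullet> q k"
    using norm by (simp add: dot_square_norm)
  ultimately have "A *v (p k - q k) = (- (q k \<bullet> q k)) *\<^sub>R (p k - q k)"
    by (simp add: sym matrix_vector_mult_diff_distrib algebra_simps)
  then have "0 \<le> - (q k \<bullet> q k) * ((p k - q k) \<bullet> (p k - q k))"
    using psd [of "p k - q k"] by simp
  moreover have "0 < q k \<bullet> q k"
    using nz pq by (metis inner_gt_zero_iff)
  ultimately have "(p k - q k) \<bullet> (p k - q k) \<le> 0"
    by (simp add: mult_le_0_iff)
  then show ?thesis
    by (metis eq_iff_diff_eq_0 inner_eq_zero_iff inner_ge_zero antisym)
qed

definition colmat :: "('r \<Rightarrow> real ^ 'm) \<Rightarrow> real ^ 'r ^ 'm" where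
  "colmat w = (\<chi> a i. w i $ a)"

lemma colmat_mult_vec: "colmat w *v z = (\<Sum>i\<in>UNIV. z $ i *\<^sub>R w i)"
  by (simp add: colmat_def matrix_vector_mult_def vec_eq_iff mult.commute)

lemma transpose_colmat_mult_vec: "transpose (colmat w) *v x = (\<chi> i. w i \<bullet> x)"
  by (simp add: colmat_def transpose_def matrix_vector_mult_def inner_vec_def)

lemma diag_mult_vec: "diag \<sigma> *v z = (\<chi> i. \<sigma> i * z $ i)"
proof -
  have "(\<Sum>j\<in>UNIV. (if i = j then \<sigma> i else 0) * z $ j) = \<sigma> i * z $ i" for i
    by (subst sum.mono_neutral_right [of UNIV "{i}"]) auto
  then show ?thesis
    by (simp add: diag_def matrix_vector_mult_def)
qed

lemma transpose_colmat_mult_colmat: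
  assumes "\<And>i j. w i \<bullet> w j = (if i = j then 1 else 0)"
  shows "transpose (colmat w) ** colmat w = mat 1"
proof -
  have "(\<Sum>a\<in>UNIV. w i $ a * w j $ a) = (if i = j then 1 else 0)" for i j
    using assms [of i j] by (simp add: inner_vec_def)
  then show ?thesis
    by (simp add: colmat_def transpose_def matrix_matrix_mult_def mat_def)
qed

lemma colmat_diag_colmat:
  "colmat w ** diag \<sigma> ** transpose (colmat w') = (\<Sum>i\<in>UNIV. \<sigma> i *\<^sub>R outer (w i) (w' i))"
proof -
  have "(colmat w ** diag \<sigma> ** transpose (colmat w')) *v z =
      (\<Sum>i\<in>UNIV. \<sigma> i *\<^sub>R outer (w i) (w' i)) *v z" for z
    by (simp add: matrix_vector_mul_assoc [symmetric] transpose_colmat_mult_vec diag_mult_vec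
        colmat_mult_vec sum_mult_vec scaleR_matrix_vector_assoc [symmetric] outer_mult_vec)
  then show ?thesis
    unfolding matrix_eq by blast
qed

text \<open>For pairwise orthogonal \<open>p i\<close> this is the orthogonal projection onto their
  span.\<close>

definition frame_proj :: "'i set \<Rightarrow> ('i \<Rightarrow> 'a::real_inner) \<Rightarrow> 'a \<Rightarrow> 'a" where
  "frame_proj I p x = (\<Sum>i\<in>I. (x \<bullet> p i / (p i \<bullet> p i)) *\<^sub>R p i)"

lemma frame_proj_in_span: "frame_proj I p x \<in> span (p ` I)"
  unfolding frame_proj_def by (intro span_sum span_scale span_base) auto

lemma inner_frame_residual:
  assumes "finite I" "\<And>i j. i \<in> I \<Longrightarrow> j \<in> I \<Longrightarrow> i \<noteq> j \<Longrightarrow> p i \<bullet> p j = 0" "k \<in> I"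
  shows "(x - frame_proj I p x) \<bullet> p k = 0"
proof -
  have "frame_proj I p x \<bullet> p k = (\<Sum>i\<in>I. if i = k then x \<bullet> p k else 0)"
    unfolding frame_proj_def inner_sum_left
    using assms by (intro sum.cong) auto
  then show ?thesis
    using assms by (simp add: inner_diff_left)
qed

lemma inner_residual_span:
  assumes "\<And>i. i \<in> I \<Longrightarrow> x \<bullet> p i = 0" "y \<in> span (p ` I)"
  shows "x \<bullet> y = 0"
  using orthogonal_to_span [OF assms(2), of x] assms(1) by (auto simp: orthogonal_def)

text \<open>Carries \<open>factored_error_bound\<close> over to singular value decompositions;
  unprimed vectors belong to \<open>M\<close>, primed ones to the optimum. The matrices
  \<open>X\<close> and \<open>Y\<close> with columns indexed by \<open>'r\<close> can be formed from
  the frames only if \<open>M\<close> has rank \<open>r\<close>, hence the case split on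
  \<open>card I\<close>. The rotation is done here because it depends on the spaces of
  \<open>M\<close>.\<close>

lemma frame_error_bound:
  fixes p p' :: "_ \<Rightarrow> real ^ 'm" and q q' :: "_ \<Rightarrow> real ^ 'n"
  assumes I: "finite I" "card I \<le> CARD('r::finite)"
    and p: "\<And>i j. i \<in> I \<Longrightarrow> j \<in> I \<Longrightarrow> i \<noteq> j \<Longrightarrow> p i \<bullet> p j = 0"
    and q: "\<And>i j. i \<in> I \<Longrightarrow> j \<in> I \<Longrightarrow> i \<noteq> j \<Longrightarrow> q i \<bullet> q j = 0"
    and pq: "\<And>i. i \<in> I \<Longrightarrow> norm (p i) = norm (q i)" and nz: "\<And>i. i \<in> I \<Longrightarrow> p i \<noteq> 0"
    and I': "finite I'" "card I' \<le> k" and k: "1 \<le> k" "k \<le> CARD('r)"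
    and p': "\<And>i j. i \<in> I' \<Longrightarrow> j \<in> I' \<Longrightarrow> i \<noteq> j \<Longrightarrow> p' i \<bullet> p' j = 0"
    and q': "\<And>i j. i \<in> I' \<Longrightarrow> j \<in> I' \<Longrightarrow> i \<noteq> j \<Longrightarrow> q' i \<bullet> q' j = 0"
    and pq': "\<And>i. i \<in> I' \<Longrightarrow> norm (p' i) = norm (q' i)" and nz': "\<And>i. i \<in> I' \<Longrightarrow> p' i \<noteq> 0"
  obtains J :: "(real ^ 'n) set" and c u v x y s where "finite J" "card J \<le> k"
    "(\<Sum>j\<in>J. outer (u j) (v j)) = (\<Sum>i\<in>I'. outer (p' i) (q' i))"
    "\<And>j l. u j \<bullet> u l = v j \<bullet> v l" "(\<Sum>j\<in>J. u j \<bullet> u j) = (\<Sum>i\<in>I'. p' i \<bullet> p' i)"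
    "\<And>j. u j = (\<Sum>i\<in>I'. c j i *\<^sub>R p' i)" "\<And>j. v j = (\<Sum>i\<in>I'. c j i *\<^sub>R q' i)"
    "0 \<le> s" "card I \<noteq> CARD('r) \<Longrightarrow> s = 0" "card I = CARD('r) \<Longrightarrow> \<exists>i\<in>I. s = p i \<bullet> p i"
    "\<And>j. x j = u j - frame_proj I p (u j)" "\<And>j. y j = v j - frame_proj I q (v j)"
    "\<And>b. 0 < b \<Longrightarrow> b \<le> 1 \<Longrightarrow>
      2 * b * sqrt (real CARD('r) / real k) * (s * (\<Sum>j\<in>J. (x j \<bullet> x j + y j \<bullet> y j) / 2)) \<le>
        b\<^sup>2 * (norm (\<Sum>j\<in>J. outer (x j) (y j)))\<^sup>2 + (norm ((\<Sum>j\<in>J. outer (u j) (v j)) -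
          (\<Sum>i\<in>I. outer (p i) (q i)) - (\<Sum>j\<in>J. outer (x j) (y j))))\<^sup>2"
proof (cases "card I = CARD('r)")
  case False
  \<comment> \<open>With \<open>s = 0\<close> the bound is trivial and any rotation will do; zero
    maps produce one.\<close>
  have "linear (\<lambda>_ :: real ^ 'm. 0 :: real)" "linear (\<lambda>_ :: real ^ 'n. 0 :: real)"
    by (auto intro: linearI)
  note rotate = rotate_factors [of I' p' q', OF I'(1) p' q' pq' nz' this]
  obtain J :: "(real ^ 'n) set" and c u v where
    *: "finite J" "card J \<le> card I'"
    "(\<Sum>j\<in>J. outer (u j) (v j)) = (\<Sum>i\<in>I'. outer (p' i) (q' i))"
    "\<And>j l. u j \<bullet> u l = v j \<bullet> v l" "(\<Sum>j\<in>J. u j \<bullet> u j) = (\<Sum>i\<in>I'. p' i \<bullet> p' i)"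
    and "\<And>j l. j \<in> J \<Longrightarrow> l \<in> J \<Longrightarrow> j \<noteq> l \<Longrightarrow> (0 + 0) \<bullet> (0 + 0 :: real) = 0"
    and **: "\<And>j. u j = (\<Sum>i\<in>I'. c j i *\<^sub>R p' i)" "\<And>j. v j = (\<Sum>i\<in>I'. c j i *\<^sub>R q' i)"
    by (rule rotate) (assumption+, rule that)
  have "card J \<le> k" using *(2) I'(2) by simp
  show ?thesis
    by (rule that [OF *(1) \<open>card J \<le> k\<close> *(3-5) ** order_refl _ _ refl refl]) (use False in auto)
next
  case True
  obtain f where f: "bij_betw f (UNIV :: 'r set) I"
    using finite_same_card_bij [of "UNIV :: 'r set" I] I(1) True by auto
  have fI: "f i \<in> I" for i using f by (auto simp: bij_betw_def)
  have f_inj: "f i = f j \<longleftrightarrow> i = j" for i j using f by (auto simp: bij_betw_def inj_eq)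
  define w where "w i = p (f i) /\<^sub>R norm (p (f i))" for i
  define w' where "w' i = q (f i) /\<^sub>R norm (q (f i))" for i
  define \<sigma> where "\<sigma> i = p (f i) \<bullet> p (f i)" for i
  have nzq: "q (f i) \<noteq> 0" and nzp: "p (f i) \<noteq> 0" for i
    using pq [OF fI] nz [OF fI] by (metis norm_eq_zero)+
  have ww: "w i \<bullet> w j = (if i = j then 1 else 0)" for i j
    using p [OF fI fI, of i j] nzp [of i]
    by (auto simp: w_def f_inj dot_square_norm power2_eq_square divide_simps)
  have ww': "w' i \<bullet> w' j = (if i = j then 1 else 0)" for i j
    using q [OF fI fI, of i j] nzq [of i]
    by (auto simp: w'_def f_inj dot_square_norm power2_eq_square divide_simps)
  define X where "X = colmat w"
  define Y where "Y = colmat w'"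
  have XX: "transpose X ** X = mat 1" and YY: "transpose Y ** Y = mat 1"
    unfolding X_def Y_def by (rule transpose_colmat_mult_colmat, rule ww, rule transpose_colmat_mult_colmat, rule ww')
  have M: "X ** diag \<sigma> ** transpose Y = (\<Sum>i\<in>I. outer (p i) (q i))"
  proof -
    have "X ** diag \<sigma> ** transpose Y = (\<Sum>i\<in>UNIV. outer (p (f i)) (q (f i)))"
      unfolding X_def Y_def colmat_diag_colmat
    proof (intro sum.cong refl)
      fix i
      have "norm (q (f i)) * norm (q (f i)) * (inverse (norm (q (f i))) * inverse (norm (q (f i)))) = 1"
        using nzq [of i] by (simp add: field_simps)
      then show "\<sigma> i *\<^sub>R outer (w i) (w' i) = outer (p (f i)) (q (f i))"
        using pq [OF fI, of i]
        by (simp add: w_def w'_def \<sigma>_def outer.scaleR_left outer.scaleR_right dot_square_norm power2_eq_square)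
    qed
    then show ?thesis
      using sum.reindex_bij_betw [OF f, of "\<lambda>i. outer (p i) (q i)"] by simp
  qed
  have Xproj: "X *v (transpose X *v x) = frame_proj I p x" for x
  proof -
    have "X *v (transpose X *v x) = (\<Sum>i\<in>UNIV. (x \<bullet> p (f i) / (p (f i) \<bullet> p (f i))) *\<^sub>R p (f i))"
      unfolding X_def colmat_mult_vec transpose_colmat_mult_vec
      by (intro sum.cong refl)
        (simp add: w_def dot_square_norm power2_eq_square inner_commute [of _ x] divide_inverse mult_ac)
    then show ?thesis
      using sum.reindex_bij_betw [OF f, of "\<lambda>i. (x \<bullet> p i / (p i \<bullet> p i)) *\<^sub>R p i"]
      by (simp add: frame_proj_def)
  qed
  have Yproj: "Y *v (transpose Y *v x) = frame_proj I q x" for x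
  proof -
    have "Y *v (transpose Y *v x) = (\<Sum>i\<in>UNIV. (x \<bullet> q (f i) / (q (f i) \<bullet> q (f i))) *\<^sub>R q (f i))"
      unfolding Y_def colmat_mult_vec transpose_colmat_mult_vec
      by (intro sum.cong refl)
        (simp add: w'_def dot_square_norm power2_eq_square inner_commute [of _ x] divide_inverse mult_ac)
    then show ?thesis
      using sum.reindex_bij_betw [OF f, of "\<lambda>i. (x \<bullet> q i / (q i \<bullet> q i)) *\<^sub>R q i"]
      by (simp add: frame_proj_def)
  qed
  have "linear ((*v) (transpose X))" "linear ((*v) (transpose Y))" by simp_all
  note rotate = rotate_factors [of I' p' q', OF I'(1) p' q' pq' nz' this]
  obtain J :: "(real ^ 'n) set" and c u v where
    *: "finite J" "card J \<le> card I'"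
    "(\<Sum>j\<in>J. outer (u j) (v j)) = (\<Sum>i\<in>I'. outer (p' i) (q' i))"
    "\<And>j l. u j \<bullet> u l = v j \<bullet> v l" "(\<Sum>j\<in>J. u j \<bullet> u j) = (\<Sum>i\<in>I'. p' i \<bullet> p' i)"
    and orth: "\<And>j l. j \<in> J \<Longrightarrow> l \<in> J \<Longrightarrow> j \<noteq> l \<Longrightarrow>
      (transpose X *v u j + transpose Y *v v j) \<bullet> (transpose X *v u l + transpose Y *v v l) = 0"
    and **: "\<And>j. u j = (\<Sum>i\<in>I'. c j i *\<^sub>R p' i)" "\<And>j. v j = (\<Sum>i\<in>I'. c j i *\<^sub>R q' i)"
    by (rule rotate) (assumption+, rule that)
  have J: "card J \<le> k" using *(2) I'(2) by simp
  define s where "s = Min (range \<sigma>)"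
  have s: "s \<le> \<sigma> i" for i by (simp add: s_def)
  have "s \<in> range \<sigma>" unfolding s_def by (intro Min_in) auto
  then obtain i0 where i0: "s = \<sigma> i0" by blast
  then have s0: "0 < s" using nzp [of i0] by (simp add: \<sigma>_def)
  have "\<exists>i\<in>I. s = p i \<bullet> p i" using fI i0 by (auto simp: \<sigma>_def)
  then have s': "0 \<le> s" "card I \<noteq> CARD('r) \<Longrightarrow> s = 0" "card I = CARD('r) \<Longrightarrow> \<exists>i\<in>I. s = p i \<bullet> p i"
    using s0 True by auto
  define x where "x j = u j - frame_proj I p (u j)" for j
  define y where "y j = v j - frame_proj I q (v j)" for j
  have bound: "2 * b * sqrt (real CARD('r) / real k) * (s * (\<Sum>j\<in>J. (x j \<bullet> x j + y j \<bullet> y j) / 2)) \<le>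
        b\<^sup>2 * (norm (\<Sum>j\<in>J. outer (x j) (y j)))\<^sup>2 + (norm ((\<Sum>j\<in>J. outer (u j) (v j)) -
          (\<Sum>i\<in>I. outer (p i) (q i)) - (\<Sum>j\<in>J. outer (x j) (y j))))\<^sup>2"
    if "0 < b" "b \<le> 1" for b :: real
    unfolding M [symmetric]
    by (rule factored_error_bound [OF *(1) J k XX YY s0 s that *(4) orth _ _ refl refl])
      (simp_all add: x_def y_def Xproj Yproj)
  show ?thesis
    by (rule that [OF *(1) J *(3-5) ** s' x_def y_def bound])
qed

text \<open>The common end of both cases. The columns of \<open>M\<close>, \<open>N\<close> and
  \<open>F\<close> lie in \<open>span B\<close>, which keeps the whole segment and all test
  directions within rank \<open>k\<close>. By \<open>FW\<close> and Pythagoras, \<open>|H|^2\<close>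
  is the sum \<open>a + b\<close> of \<open>error_vanishes\<close>. \<open>\<tau>\<close> includes
  the factor \<open>s\<close>.\<close>

lemma optimum_unique:
  fixes S T K :: "(real ^ 'n ^ 'm) set"
  assumes dom: "recession_domain S T K" and f: "twice_differentiable_on S T f"
    and M: "M \<in> S" "N \<in> S" and F: "F \<in> T"
    and B: "finite B" "card B \<le> k" "\<And>z. M *v z \<in> span B" "\<And>z. N *v z \<in> span B" "\<And>z. F *v z \<in> span B"
    and lower: "\<And>P E. P \<in> S \<Longrightarrow> E \<in> T \<Longrightarrow> rank P \<le> k \<Longrightarrow> rank E \<le> k \<Longrightarrow> \<mu> * (norm E)\<^sup>2 \<le> hessian S T f P E E"
    and upper: "\<And>P E. P \<in> S \<Longrightarrow> E \<in> T \<Longrightarrow> rank P \<le> k \<Longrightarrow> rank E \<le> k \<Longrightarrow> hessian S T f P E E \<le> L * (norm E)\<^sup>2"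
    and const: "0 < t" "0 \<le> \<mu>" "\<mu> \<le> L" "0 \<le> L2" "L2 / (2 * t + L2 / L) < \<mu>"
    and FW: "F \<bullet> (N - M - F) = 0"
    and g: "g = gradient S T f N - gradient S T f M"
    and g_le: "g \<bullet> (N - M) \<le> g \<bullet> F" "g \<bullet> (N - M) \<le> L2 * \<tau>"
    and \<tau>: "\<And>c. 0 < c \<Longrightarrow> c \<le> 1 \<Longrightarrow> 2 * c * t * \<tau> \<le> c\<^sup>2 * (norm F)\<^sup>2 + (norm (N - M - F))\<^sup>2"
  shows "M = N"
proof -
  interpret recession_domain S T K by (rule dom)
  define H where "H = N - M"
  \<comment> \<open>This holds also under the convention \<open>L2 / 0 = 0\<close>; so
    \<open>\<mu>\<close>, and with it \<open>L\<close>, is positive after all.\<close>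
  have "0 \<le> L2 / (2 * t + L2 / L)"
    using const by simp
  then have \<mu>: "0 < \<mu>" using const(5) by linarith
  have HT: "H \<in> T" unfolding H_def using diff_in M by blast
  have lower': "\<mu> * (norm (a *\<^sub>R H + b *\<^sub>R F))\<^sup>2 \<le>
      hessian S T f (M + t *\<^sub>R H) (a *\<^sub>R H + b *\<^sub>R F) (a *\<^sub>R H + b *\<^sub>R F)"
    and upper': "hessian S T f (M + t *\<^sub>R H) (a *\<^sub>R H + b *\<^sub>R F) (a *\<^sub>R H + b *\<^sub>R F) \<le>
      L * (norm (a *\<^sub>R H + b *\<^sub>R F))\<^sup>2"
    if t: "0 \<le> t" "t \<le> 1" for t a b
  proof -
    have "M + t *\<^sub>R H = (1 - t) *\<^sub>R M + t *\<^sub>R N" by (simp add: H_def algebra_simps)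
    then have S: "M + t *\<^sub>R H \<in> S" using convexD_alt [OF convex_S M t] by simp
    have T: "a *\<^sub>R H + b *\<^sub>R F \<in> T"
      using T HT F by (intro subspace_add subspace_scale)
    have H: "H *v z \<in> span B" for z
      unfolding H_def matrix_vector_mult_diff_rdistrib by (intro span_diff B)
    have "rank (M + t *\<^sub>R H) \<le> card B"
      by (rule range_subset_imp_rank_le [OF B(1)])
        (simp add: matrix_vector_mult_add_rdistrib scaleR_matrix_vector_assoc [symmetric] span_add span_scale B H)
    moreover have "rank (a *\<^sub>R H + b *\<^sub>R F) \<le> card B"
      by (rule range_subset_imp_rank_le [OF B(1)])
        (simp add: matrix_vector_mult_add_rdistrib scaleR_matrix_vector_assoc [symmetric] span_add span_scale B H)
    ultimately have "rank (M + t *\<^sub>R H) \<le> k" "rank (a *\<^sub>R H + b *\<^sub>R F) \<le> k"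
      using B(2) by simp_all
    then show "\<mu> * (norm (a *\<^sub>R H + b *\<^sub>R F))\<^sup>2 \<le>
        hessian S T f (M + t *\<^sub>R H) (a *\<^sub>R H + b *\<^sub>R F) (a *\<^sub>R H + b *\<^sub>R F)"
      "hessian S T f (M + t *\<^sub>R H) (a *\<^sub>R H + b *\<^sub>R F) (a *\<^sub>R H + b *\<^sub>R F) \<le>
        L * (norm (a *\<^sub>R H + b *\<^sub>R F))\<^sup>2"
      using lower [OF S T] upper [OF S T] by blast+
  qed
  have HH: "(norm F)\<^sup>2 + (norm (H - F))\<^sup>2 = (norm H)\<^sup>2"
  proof -
    have "F \<bullet> (H - F) = 0" using FW by (simp add: H_def)
    then show ?thesis
      by (simp add: power2_norm_eq_inner inner_diff inner_commute)
  qed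
  note coc = restricted_cocoercive [OF f M F H_def g]
  have "(norm F)\<^sup>2 + (norm (N - M - F))\<^sup>2 = 0"
  proof (rule error_vanishes [OF const(1) \<mu> const(3-5)])
    show "\<mu> * ((norm F)\<^sup>2 + (norm (N - M - F))\<^sup>2) \<le> g \<bullet> (N - M)"
      unfolding H_def [symmetric] HH by (rule coc(1) [OF lower' upper'])
    show "\<mu> * P * ((norm F)\<^sup>2 + (norm (N - M - F))\<^sup>2) \<le>
        (P + \<mu>) * (g \<bullet> (N - M)) - 2 * \<rho> * (g \<bullet> F) + \<rho>\<^sup>2 * (norm F)\<^sup>2" if P: "L \<le> P" "\<mu> < P" for P \<rho>
      unfolding H_def [symmetric] HH
    proof (rule coc(2) [OF lower' _ P(2)])
      fix t a b :: real assume t: "0 \<le> t" "t \<le> 1"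
      have "L * (norm (a *\<^sub>R H + b *\<^sub>R F))\<^sup>2 \<le> P * (norm (a *\<^sub>R H + b *\<^sub>R F))\<^sup>2"
        using P(1) by (intro mult_right_mono) auto
      with upper' [OF t, of a b] show "hessian S T f (M + t *\<^sub>R H) (a *\<^sub>R H + b *\<^sub>R F) (a *\<^sub>R H + b *\<^sub>R F) \<le>
          P * (norm (a *\<^sub>R H + b *\<^sub>R F))\<^sup>2"
        by linarith
    qed
  qed (use g_le \<tau> in auto)
  then have "H = 0" unfolding H_def [symmetric] HH by simp
  then show ?thesis by (simp add: H_def)
qed

subsection \<open>Critical points of the factored objective\<close>

lemma bounded_bilinear_matrix_mult:
  "bounded_bilinear ((**) :: real ^ 'k ^ 'm \<Rightarrow> real ^ 'n ^ 'k \<Rightarrow> real ^ 'n ^ 'm)"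
proof (intro bilinear_conv_bounded_bilinear [THEN iffD1])
  show "bilinear ((**) :: real ^ 'k ^ 'm \<Rightarrow> real ^ 'n ^ 'k \<Rightarrow> real ^ 'n ^ 'm)"
    unfolding bilinear_def
    by (intro conjI allI linearI)
      (simp_all add: matrix_matrix_mult_def vec_eq_iff sum.distrib sum_distrib_left algebra_simps)
qed

interpretation matrix_mult: bounded_bilinear "(**) :: real ^ 'k ^ 'm \<Rightarrow> real ^ 'n ^ 'k \<Rightarrow> real ^ 'n ^ 'm"
  by (rule bounded_bilinear_matrix_mult)

lemma has_derivative_transpose:
  "(f has_derivative f') F \<Longrightarrow> ((\<lambda>x. transpose (f x :: real ^ 'n ^ 'm)) has_derivative (\<lambda>h. transpose (f' h))) F"
  by (rule bounded_linear.has_derivative) (rule linear_conv_bounded_linear [THEN iffD1, OF linear_transpose])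

lemma gradient_UNIV_eqI:
  "(f has_derivative (\<lambda>h. g \<bullet> h)) (at x) \<Longrightarrow> gradient UNIV UNIV f x = g"
  by (rule UNIV_domain.gradient_eqI) auto

lemma hessian_UNIV_eqI:
  assumes "\<And>y. (f has_derivative (\<lambda>h. g y \<bullet> h)) (at y)" "(g has_derivative D) (at x)"
  shows "hessian UNIV UNIV f x A B = D A \<bullet> B"
proof -
  have "gradient UNIV UNIV f = g"
    by (intro ext gradient_UNIV_eqI assms)
  then show ?thesis
    unfolding hessian_def using frechet_derivative_at [OF assms(2)] by simp
qed

lemma product_transpose_psd: "X ** transpose X \<in> psd_mats"
proof -
  have "0 \<le> x \<bullet> ((X ** transpose X) *v x)" for x
  proof -
    have "x \<bullet> ((X ** transpose X) *v x) = (transpose X *v x) \<bullet> (transpose X *v x)"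
      by (metis inner_transpose_vec matrix_vector_mul_assoc)
    then show ?thesis by simp
  qed
  then show ?thesis
    by (simp add: psd_mats_def symmetric_mats_def matrix_transpose_mul)
qed

lemma twice_differentiable_onD:
  assumes "twice_differentiable_on S T f" "x \<in> S"
  shows "f differentiable (at x within S)"
    "(gradient S T f has_derivative frechet_derivative (gradient S T f) (at x within S)) (at x within S)"
  using assms unfolding frechet_derivative_works [symmetric]
  by (auto simp: twice_differentiable_on_def differentiable_on_def)

text \<open>\<open>\<phi>\<close> is differentiable only relative to the cone, but
  \<open>X ** transpose X\<close> never leaves it, so the chain rule within its range yields
  ordinary derivatives of the factored objective. The penalty is absorbed into \<open>G\<close> as a
  multiple of the identity.\<close>

lemma symmetric_critical:
  fixes \<phi> :: "real ^ 'd ^ 'd \<Rightarrow> real" and U :: "real ^ 'r ^ 'd"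
  assumes \<phi>: "twice_differentiable_on psd_mats symmetric_mats \<phi>"
    and crit: "second_order_critical (\<lambda>X. \<phi> (X ** transpose X) + lam * (norm X)\<^sup>2) U"
    and G: "G = gradient psd_mats symmetric_mats \<phi> (U ** transpose U) + lam *\<^sub>R mat 1"
  shows "G ** U = 0"
    and "\<And>E. 0 \<le> hessian psd_mats symmetric_mats \<phi> (U ** transpose U)
        (E ** transpose U + U ** transpose E) (E ** transpose U + U ** transpose E) + 2 * ((G ** E) \<bullet> E)"
proof -
  let ?grad = "gradient psd_mats symmetric_mats \<phi>"
  define f where "f X = \<phi> (X ** transpose X) + lam * (norm X)\<^sup>2" for X :: "real ^ 'r ^ 'd"
  define g where "g X = ?grad (X ** transpose X) ** X + transpose (?grad (X ** transpose X)) ** X + (2 * lam) *\<^sub>R X"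
    for X :: "real ^ 'r ^ 'd"
  define D where "D = frechet_derivative ?grad (at (U ** transpose U) within psd_mats)"
  have sq: "((\<lambda>X. X ** transpose X) has_derivative (\<lambda>E. X ** transpose E + E ** transpose X)) (at X)"
    for X :: "real ^ 'r ^ 'd"
    by (intro matrix_mult.FDERIV has_derivative_ident has_derivative_transpose)
  have range: "range (\<lambda>X :: real ^ 'r ^ 'd. X ** transpose X) \<subseteq> psd_mats"
    using product_transpose_psd by blast
  have "(f has_derivative (\<lambda>E. g X \<bullet> E)) (at X)" for X
  proof -
    have "(\<phi> has_derivative (\<lambda>h. ?grad (X ** transpose X) \<bullet> h))
        (at (X ** transpose X) within range (\<lambda>X :: real ^ 'r ^ 'd. X ** transpose X))"
      by (intro has_derivative_subset [OF psd_domain.gradient_works(2) range] product_transpose_psd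
          twice_differentiable_onD(1) [OF \<phi>])
    from has_derivative_in_compose [OF sq this]
    have "((\<lambda>X. \<phi> (X ** transpose X)) has_derivative
        (\<lambda>E. ?grad (X ** transpose X) \<bullet> (X ** transpose E + E ** transpose X))) (at X)" .
    moreover have "((\<lambda>X. lam * (norm X)\<^sup>2) has_derivative (\<lambda>E. (2 * lam) *\<^sub>R X \<bullet> E)) (at X)"
      unfolding power2_norm_eq_inner
      by (auto intro!: derivative_eq_intros simp: inner_commute algebra_simps)
    ultimately have "(f has_derivative (\<lambda>E. ?grad (X ** transpose X) \<bullet> (X ** transpose E + E ** transpose X) +
        (2 * lam) *\<^sub>R X \<bullet> E)) (at X)"
      unfolding f_def by (rule has_derivative_add)
    moreover have "A \<bullet> (X ** transpose E + E ** transpose X) = (A ** X + transpose A ** X) \<bullet> E"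
      for A :: "real ^ 'd ^ 'd" and E
    proof -
      have "A \<bullet> (X ** transpose E) = transpose A \<bullet> (E ** transpose X)"
        by (metis inner_transpose matrix_transpose_mul transpose_transpose)
      then show ?thesis
        by (simp add: inner_add inner_matrix_mult_right)
    qed
    ultimately show ?thesis
      by (simp add: g_def inner_add_left)
  qed
  note f = this
  have "((\<lambda>X. ?grad (X ** transpose X)) has_derivative (\<lambda>E. D (U ** transpose E + E ** transpose U))) (at U)"
    unfolding D_def
    by (intro has_derivative_in_compose [OF sq] has_derivative_subset [OF _ range]
        twice_differentiable_onD(2) [OF \<phi>] product_transpose_psd)
  note D = this
  have g: "(g has_derivative (\<lambda>E.
      ?grad (U ** transpose U) ** E + D (U ** transpose E + E ** transpose U) ** U +
      (transpose (?grad (U ** transpose U)) ** E + transpose (D (U ** transpose E + E ** transpose U)) ** U) +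
      (2 * lam) *\<^sub>R E)) (at U)"
    unfolding g_def
    by (intro has_derivative_add matrix_mult.FDERIV D has_derivative_ident has_derivative_transpose
        has_derivative_scaleR_right)
  have sym: "transpose (?grad (U ** transpose U)) = ?grad (U ** transpose U)"
    using psd_domain.gradient_works(1) [OF product_transpose_psd twice_differentiable_onD(1) [OF \<phi> product_transpose_psd]]
    by (simp add: symmetric_mats_def)
  have GE: "G ** E = ?grad (U ** transpose U) ** E + lam *\<^sub>R E" for E :: "real ^ 'k ^ 'd"
    by (simp add: G matrix_mult.add_left matrix_mult.scaleR_left)
  have "gradient UNIV UNIV f U = g U"
    by (rule gradient_UNIV_eqI [OF f])
  moreover have "gradient UNIV UNIV f U = 0"
    using crit unfolding second_order_critical_def f_def by blast
  ultimately have "2 *\<^sub>R (G ** U) = 0"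
    by (simp add: g_def sym GE scaleR_2 algebra_simps)
  then show "G ** U = 0" by simp
  fix E :: "real ^ 'r ^ 'd"
  let ?S = "E ** transpose U + U ** transpose E"
  have "0 \<le> hessian UNIV UNIV f U E E"
    using crit unfolding second_order_critical_def f_def by blast
  also have "\<dots> = (?grad (U ** transpose U) ** E + D ?S ** U +
      (?grad (U ** transpose U) ** E + transpose (D ?S) ** U) + (2 * lam) *\<^sub>R E) \<bullet> E"
    unfolding hessian_UNIV_eqI [OF f g] by (simp add: sym add.commute)
  also have "\<dots> = D ?S \<bullet> ?S + 2 * ((G ** E) \<bullet> E)"
  proof -
    have "(D ?S ** U) \<bullet> E = D ?S \<bullet> (E ** transpose U)"
      by (simp add: inner_matrix_mult_right)
    moreover have "(transpose (D ?S) ** U) \<bullet> E = transpose (D ?S) \<bullet> (E ** transpose U)"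
      by (simp add: inner_matrix_mult_right)
    then have "(transpose (D ?S) ** U) \<bullet> E = D ?S \<bullet> (U ** transpose E)"
      by (metis inner_transpose matrix_transpose_mul transpose_transpose)
    ultimately show ?thesis
      unfolding GE inner_add_left inner_add_right inner_scaleR_left by (simp add: algebra_simps)
  qed
  finally show "0 \<le> hessian psd_mats symmetric_mats \<phi> (U ** transpose U) ?S ?S + 2 * ((G ** E) \<bullet> E)"
    by (simp add: hessian_def D_def)
qed

text \<open>The penalty acts on \<open>U\<close> and \<open>V\<close> separately while
  \<open>G\<close> couples them, so here it stays outside \<open>G\<close>.\<close>

lemma asymmetric_critical:
  fixes \<phi> :: "real ^ 'n ^ 'm \<Rightarrow> real" and U :: "real ^ 'r ^ 'm" and V :: "real ^ 'r ^ 'n"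
  assumes \<phi>: "twice_differentiable_on UNIV UNIV \<phi>"
    and crit: "second_order_critical
      (\<lambda>(X, Y). \<phi> (X ** transpose Y) + lam * (((norm X)\<^sup>2 + (norm Y)\<^sup>2) / 2)) (U, V)"
    and G: "G = gradient UNIV UNIV \<phi> (U ** transpose V)"
  shows "G ** V = - lam *\<^sub>R U" and "transpose G ** U = - lam *\<^sub>R V"
    and "\<And>E E'. 0 \<le> hessian UNIV UNIV \<phi> (U ** transpose V)
        (E ** transpose V + U ** transpose E') (E ** transpose V + U ** transpose E') +
        2 * ((G ** E') \<bullet> E) + lam * ((norm E)\<^sup>2 + (norm E')\<^sup>2)"
proof -
  let ?grad = "gradient UNIV UNIV \<phi>"
  define f where "f z = \<phi> (fst z ** transpose (snd z)) + lam * (((norm (fst z))\<^sup>2 + (norm (snd z))\<^sup>2) / 2)"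
    for z :: "(real ^ 'r ^ 'm) \<times> (real ^ 'r ^ 'n)"
  define g where "g z = (?grad (fst z ** transpose (snd z)) ** snd z + lam *\<^sub>R fst z,
      transpose (?grad (fst z ** transpose (snd z))) ** fst z + lam *\<^sub>R snd z)"
    for z :: "(real ^ 'r ^ 'm) \<times> (real ^ 'r ^ 'n)"
  have f_eq: "(\<lambda>(X, Y). \<phi> (X ** transpose Y) + lam * (((norm X)\<^sup>2 + (norm Y)\<^sup>2) / 2)) = f"
    by (auto simp: f_def fun_eq_iff)
  define D where "D = frechet_derivative ?grad (at (U ** transpose V))"
  have prod: "((\<lambda>z. fst z ** transpose (snd z)) has_derivative
      (\<lambda>h. fst z ** transpose (snd h) + fst h ** transpose (snd z))) (at z)"
    for z :: "(real ^ 'r ^ 'm) \<times> (real ^ 'r ^ 'n)"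
    by (intro matrix_mult.FDERIV has_derivative_transpose has_derivative_fst has_derivative_snd has_derivative_ident)
  have f: "(f has_derivative (\<lambda>h. g z \<bullet> h)) (at z)" for z
  proof -
    have "(\<phi> has_derivative (\<lambda>h. ?grad (fst z ** transpose (snd z)) \<bullet> h)) (at (fst z ** transpose (snd z)))"
      by (intro UNIV_domain.gradient_works(2) twice_differentiable_onD(1) [OF \<phi>] UNIV_I)
    from has_derivative_compose [OF prod this]
    have "((\<lambda>z. \<phi> (fst z ** transpose (snd z))) has_derivative
        (\<lambda>h. ?grad (fst z ** transpose (snd z)) \<bullet> (fst z ** transpose (snd h) + fst h ** transpose (snd z)))) (at z)" .
    moreover have "((\<lambda>z. lam * (((norm (fst z))\<^sup>2 + (norm (snd z))\<^sup>2) / 2)) has_derivative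
        (\<lambda>h. lam *\<^sub>R fst z \<bullet> fst h + lam *\<^sub>R snd z \<bullet> snd h)) (at z)"
      unfolding power2_norm_eq_inner
      by (auto intro!: derivative_eq_intros simp: inner_commute algebra_simps)
    ultimately have "(f has_derivative (\<lambda>h. ?grad (fst z ** transpose (snd z)) \<bullet>
        (fst z ** transpose (snd h) + fst h ** transpose (snd z)) +
        (lam *\<^sub>R fst z \<bullet> fst h + lam *\<^sub>R snd z \<bullet> snd h))) (at z)"
      unfolding f_def by (rule has_derivative_add)
    moreover have "A \<bullet> (fst z ** transpose (snd h) + fst h ** transpose (snd z)) =
        (A ** snd z) \<bullet> fst h + (transpose A ** fst z) \<bullet> snd h" for A :: "real ^ 'n ^ 'm" and h
    proof -
      have "A \<bullet> (fst z ** transpose (snd h)) = transpose A \<bullet> (snd h ** transpose (fst z))"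
        by (metis inner_transpose matrix_transpose_mul transpose_transpose)
      then show ?thesis
        by (simp add: inner_add inner_matrix_mult_right)
    qed
    ultimately show ?thesis
      by (simp add: g_def inner_prod_def inner_add_left algebra_simps)
  qed
  have "((\<lambda>z. ?grad (fst z ** transpose (snd z))) has_derivative
      (\<lambda>h. D (U ** transpose (snd h) + fst h ** transpose V))) (at (U, V))"
    using has_derivative_compose [OF prod [of "(U, V)"], of ?grad D]
      twice_differentiable_onD(2) [OF \<phi>, of "U ** transpose V"] by (simp add: D_def)
  note D = this
  have g: "(g has_derivative (\<lambda>h.
      (?grad (U ** transpose V) ** snd h + D (U ** transpose (snd h) + fst h ** transpose V) ** V + lam *\<^sub>R fst h,
       transpose (?grad (U ** transpose V)) ** fst h +
         transpose (D (U ** transpose (snd h) + fst h ** transpose V)) ** U + lam *\<^sub>R snd h))) (at (U, V))"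
  proof -
    have "(g has_derivative (\<lambda>h.
      (?grad (fst (U, V) ** transpose (snd (U, V))) ** snd h + D (U ** transpose (snd h) + fst h ** transpose V) ** snd (U, V) + lam *\<^sub>R fst h,
       transpose (?grad (fst (U, V) ** transpose (snd (U, V)))) ** fst h +
         transpose (D (U ** transpose (snd h) + fst h ** transpose V)) ** fst (U, V) + lam *\<^sub>R snd h))) (at (U, V))"
      unfolding g_def
      by (intro has_derivative_Pair has_derivative_add matrix_mult.FDERIV D has_derivative_ident has_derivative_transpose
        has_derivative_scaleR_right has_derivative_fst has_derivative_snd)
    then show ?thesis by simp
  qed
  have "gradient UNIV UNIV f (U, V) = g (U, V)"
    by (rule gradient_UNIV_eqI [OF f])
  moreover have "gradient UNIV UNIV f (U, V) = 0"
    using crit unfolding second_order_critical_def f_eq by blast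
  ultimately show "G ** V = - lam *\<^sub>R U" "transpose G ** U = - lam *\<^sub>R V"
    by (simp_all add: g_def G zero_prod_def eq_neg_iff_add_eq_0)
  fix E :: "real ^ 'r ^ 'm" and E' :: "real ^ 'r ^ 'n"
  let ?S = "E ** transpose V + U ** transpose E'"
  have "0 \<le> hessian UNIV UNIV f (U, V) (E, E') (E, E')"
    using crit unfolding second_order_critical_def f_eq by blast
  also have "\<dots> = (G ** E' + D ?S ** V + lam *\<^sub>R E) \<bullet> E + (transpose G ** E + transpose (D ?S) ** U + lam *\<^sub>R E') \<bullet> E'"
    unfolding hessian_UNIV_eqI [OF f g] by (simp add: G inner_prod_def add.commute)
  also have "\<dots> = D ?S \<bullet> ?S + 2 * ((G ** E') \<bullet> E) + lam * ((norm E)\<^sup>2 + (norm E')\<^sup>2)"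
  proof -
    have "(D ?S ** V) \<bullet> E = D ?S \<bullet> (E ** transpose V)"
      by (simp add: inner_matrix_mult_right)
    moreover have "(transpose (D ?S) ** U) \<bullet> E' = transpose (D ?S) \<bullet> (E' ** transpose U)"
      by (simp add: inner_matrix_mult_right)
    then have "(transpose (D ?S) ** U) \<bullet> E' = D ?S \<bullet> (U ** transpose E')"
      by (metis inner_transpose matrix_transpose_mul transpose_transpose)
    moreover have "(transpose G ** E) \<bullet> E' = (G ** E') \<bullet> E"
      by (metis inner_commute inner_matrix_mult_left)
    ultimately show ?thesis
      by (simp add: inner_add power2_norm_eq_inner distrib_left)
  qed
  finally show "0 \<le> hessian UNIV UNIV \<phi> (U ** transpose V) ?S ?S +
      2 * ((G ** E') \<bullet> E) + lam * ((norm E)\<^sup>2 + (norm E')\<^sup>2)"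
    by (simp add: hessian_def D_def)
qed

subsection \<open>The symmetric case\<close>

lemma exists_orthogonal_vector:
  fixes w :: "'i \<Rightarrow> real ^ 'r"
  assumes "finite I" "card I < CARD('r)"
  obtains z where "z \<noteq> 0" "\<And>i. i \<in> I \<Longrightarrow> w i \<bullet> z = 0"
proof -
  have "dim (w ` I) \<le> card (w ` I)"
    using assms(1) by (intro dim_le_card) (auto simp: span_superset)
  also have "\<dots> < DIM(real ^ 'r)"
    using card_image_le [OF assms(1), of w] assms(2) by simp
  finally obtain z where "z \<noteq> 0" "\<And>y. y \<in> span (w ` I) \<Longrightarrow> orthogonal z y"
    using orthogonal_to_subspace_exists [of "w ` I"] by metis
  then have "w i \<bullet> z = 0" if "i \<in> I" for i
  proof -
    have "w i \<in> span (w ` I)" using that by (intro span_base) simp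
    then show ?thesis
      using \<open>\<And>y. y \<in> span (w ` I) \<Longrightarrow> orthogonal z y\<close> by (metis orthogonal_def inner_commute)
  qed
  with \<open>z \<noteq> 0\<close> show ?thesis by (rule that)
qed

lemma frame_mult_vec:
  assumes "finite I" "k \<in> I" "\<And>i j. i \<in> I \<Longrightarrow> j \<in> I \<Longrightarrow> i \<noteq> j \<Longrightarrow> q i \<bullet> q j = 0"
  shows "(\<Sum>i\<in>I. outer (p i) (q i)) *v q k = (q k \<bullet> q k) *\<^sub>R p k"
proof -
  have "(\<Sum>i\<in>I. outer (p i) (q i)) *v q k = (\<Sum>i\<in>I. if i = k then (q k \<bullet> q k) *\<^sub>R p k else 0)"
    unfolding outer_mult_sum using assms by (intro sum.cong refl) auto
  then show ?thesis
    using assms by simp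
qed

text \<open>At full rank there is a unit vector \<open>v\<close> with \<open>U v = p i\<close>. The
  perturbation \<open>outer x v\<close> moves \<open>M\<close> by
  \<open>outer x (p i) + outer (p i) x\<close>, of rank at most two and squared norm
  \<open>2 s |x|^2\<close>. Below full rank \<open>U\<close> has a kernel vector \<open>z\<close>;
  \<open>outer x z\<close> does not move \<open>M\<close> to first order, and the curvature of
  \<open>\<phi>\<close> drops out.\<close>

lemma symmetric_spurious_direction_bound:
  fixes U :: "real ^ 'r ^ 'd" and p :: "'i \<Rightarrow> real ^ 'd"
  assumes I: "finite I" "card I \<le> CARD('r)" and M: "U ** transpose U = (\<Sum>i\<in>I. outer (p i) (p i))"
    and p: "\<And>i j. i \<in> I \<Longrightarrow> j \<in> I \<Longrightarrow> i \<noteq> j \<Longrightarrow> p i \<bullet> p j = 0" and nz: "\<And>i. i \<in> I \<Longrightarrow> p i \<noteq> 0"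
    and s: "0 \<le> s" "card I \<noteq> CARD('r) \<Longrightarrow> s = 0" "card I = CARD('r) \<Longrightarrow> \<exists>i\<in>I. s = p i \<bullet> p i"
    and upper: "\<And>E. E \<in> symmetric_mats \<Longrightarrow> rank E \<le> 2 \<Longrightarrow> h E \<le> L2 * (norm E)\<^sup>2"
    and second_order: "\<And>E :: real ^ 'r ^ 'd. 0 \<le> h (E ** transpose U + U ** transpose E) + 2 * ((G ** E) \<bullet> E)"
    and L2: "0 \<le> L2" and x: "\<And>i. i \<in> I \<Longrightarrow> x \<bullet> p i = 0"
  shows "0 \<le> x \<bullet> (G *v x) + L2 * s * (x \<bullet> x)"
proof (cases "card I = CARD('r)")
  case True
  then obtain i where i: "i \<in> I" "s = p i \<bullet> p i" using s(3) by blast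
  have s0: "s \<noteq> 0" using nz [OF i(1)] i(2) by simp
  define v where "v = (transpose U *v p i) /\<^sub>R s"
  have Mp: "U *v (transpose U *v p i) = s *\<^sub>R p i"
    using frame_mult_vec [where p = p and q = p and k = i, OF I(1) i(1) p] by (simp add: M [symmetric] matrix_vector_mul_assoc i(2))
  have Uv: "U *v v = p i"
    using s0 by (simp add: v_def matrix_vector_mult_scaleR Mp)
  have "(transpose U *v p i) \<bullet> (transpose U *v p i) = s * s"
    unfolding inner_transpose_vec [symmetric] Mp by (simp add: i(2))
  then have vv: "v \<bullet> v = 1"
    using s0 by (simp add: v_def field_simps)
  let ?E = "outer x v"
  let ?S = "?E ** transpose U + U ** transpose ?E"
  have S: "?S = outer x (p i) + outer (p i) x"
    by (simp add: outer_matrix_mult matrix_mult_outer transpose_outer Uv)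
  have "?S \<in> symmetric_mats"
    unfolding S by (simp add: symmetric_mats_def transpose_add transpose_outer add.commute)
  moreover have "rank ?S \<le> card {x, p i}"
  proof (rule range_subset_imp_rank_le)
    show "?S *v z \<in> span {x, p i}" for z
      unfolding S matrix_vector_mult_add_rdistrib outer_mult_vec
      by (intro span_add span_scale span_base) auto
  qed simp
  then have "rank ?S \<le> 2"
    by (rule order_trans) (simp add: card_insert_if)
  ultimately have "h ?S \<le> L2 * (norm ?S)\<^sup>2"
    by (rule upper)
  also have "(norm ?S)\<^sup>2 = 2 * (s * (x \<bullet> x))"
    using x [OF i(1)]
    by (simp add: S power2_norm_eq_inner inner_add inner_outer_outer inner_commute [of "p i" x] i(2))
  finally have "0 \<le> L2 * (2 * (s * (x \<bullet> x))) + 2 * ((G ** ?E) \<bullet> ?E)"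
    using second_order [of ?E] by linarith
  then show ?thesis
    by (simp add: matrix_mult_outer inner_outer_outer vv inner_commute)
next
  case False
  then have "card I < CARD('r)" using I(2) by simp
  \<comment> \<open>Orthogonality to all \<open>transpose U *v p i\<close> gives
    \<open>M (U z) = 0\<close>, and \<open>M = U U^T\<close> then forces
    \<open>U z = 0\<close>.\<close>
  then obtain z where z: "z \<noteq> 0" "\<And>i. i \<in> I \<Longrightarrow> (transpose U *v p i) \<bullet> z = 0"
    using exists_orthogonal_vector [OF I(1), of "\<lambda>i. transpose U *v p i"] by blast
  have "U *v (transpose U *v (U *v z)) = (\<Sum>i\<in>I. (p i \<bullet> (U *v z)) *\<^sub>R p i)"
    using outer_mult_sum [of p p I "U *v z"] by (metis M matrix_vector_mul_assoc)
  also have "\<dots> = 0"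
    using z(2) by (simp add: inner_transpose_vec)
  finally have "(transpose U *v (U *v z)) \<bullet> (transpose U *v (U *v z)) = 0"
    by (metis inner_transpose_vec inner_zero_right)
  then have "(U *v z) \<bullet> (U *v z) = 0"
    by (metis inner_eq_zero_iff inner_transpose_vec inner_zero_left)
  then have Uz: "U *v z = 0" by simp
  let ?E = "outer x z"
  have "?E ** transpose U + U ** transpose ?E = 0"
    by (simp add: outer_matrix_mult matrix_mult_outer transpose_outer Uz outer.zero_left outer.zero_right)
  moreover have "h 0 \<le> 0"
    using upper [of 0] by (simp add: symmetric_mats_def transpose_def vec_eq_iff)
  ultimately have "0 \<le> (G ** ?E) \<bullet> ?E"
    using second_order [of ?E] by simp
  then have "0 \<le> (z \<bullet> z) * (x \<bullet> (G *v x))"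
    by (simp add: matrix_mult_outer inner_outer_outer inner_commute mult.commute)
  moreover have "0 < z \<bullet> z" using z(1) by simp
  ultimately have "0 \<le> x \<bullet> (G *v x)"
    by (simp add: zero_le_mult_iff)
  then show ?thesis
    using False s(2) by simp
qed

text \<open>Projecting onto the frame does not leave the span of the \<open>p i\<close> and
  \<open>u j\<close>, so one set of at most \<open>r + rs\<close> vectors carries the columns of
  \<open>M\<close>, of the optimum and of \<open>F\<close>. This is where the rank in the constants
  comes from.\<close>

lemma frame_span_bound:
  fixes p u :: "_ \<Rightarrow> real ^ 'm" and q v :: "_ \<Rightarrow> real ^ 'n"
  assumes I: "finite I" and J: "finite J"
    and x: "\<And>j. x j = u j - frame_proj I p (u j)"
  defines "B \<equiv> p ` I \<union> u ` J"
  shows "finite B" "card B \<le> card I + card J"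
    "(\<Sum>i\<in>I. outer (p i) (q i)) *v z \<in> span B" "(\<Sum>j\<in>J. outer (u j) (v j)) *v z \<in> span B"
    "(\<Sum>j\<in>J. outer (x j) (v' j)) *v z \<in> span B"
proof -
  show "finite B" using I J by (simp add: B_def)
  show "card B \<le> card I + card J"
    unfolding B_def
    using card_Un_le [of "p ` I" "u ` J"] card_image_le [OF I, of p] card_image_le [OF J, of u] by linarith
  have pB: "p i \<in> span B" if "i \<in> I" for i
    using that by (intro span_base) (simp add: B_def)
  have uB: "u j \<in> span B" if "j \<in> J" for j
    using that by (intro span_base) (simp add: B_def)
  have "span (p ` I) \<subseteq> span B"
    unfolding B_def by (intro span_mono) blast
  then have xB: "x j \<in> span B" if "j \<in> J" for j
    unfolding x using frame_proj_in_span uB [OF that] by (intro span_diff) blast+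
  show "(\<Sum>i\<in>I. outer (p i) (q i)) *v z \<in> span B" "(\<Sum>j\<in>J. outer (u j) (v j)) *v z \<in> span B"
    "(\<Sum>j\<in>J. outer (x j) (v' j)) *v z \<in> span B"
    unfolding outer_mult_sum by (intro span_sum span_scale pB uB xB; assumption)+
qed

text \<open>The outside parts are orthogonal to the frames. Hence \<open>F\<close> paired with the
  optimum sees only \<open>F\<close> itself, and paired with \<open>M\<close> it gives zero.\<close>

lemma frame_residual_orthogonal:
  fixes p u :: "_ \<Rightarrow> real ^ 'm" and q v :: "_ \<Rightarrow> real ^ 'n"
  assumes I: "finite I"
    and p: "\<And>i j. i \<in> I \<Longrightarrow> j \<in> I \<Longrightarrow> i \<noteq> j \<Longrightarrow> p i \<bullet> p j = 0"
    and q: "\<And>i j. i \<in> I \<Longrightarrow> j \<in> I \<Longrightarrow> i \<noteq> j \<Longrightarrow> q i \<bullet> q j = 0"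
    and x: "\<And>j. x j = u j - frame_proj I p (u j)" and y: "\<And>j. y j = v j - frame_proj I q (v j)"
    and F: "F = (\<Sum>j\<in>J. outer (x j) (y j))"
  shows "F \<bullet> ((\<Sum>j\<in>J. outer (u j) (v j)) - (\<Sum>i\<in>I. outer (p i) (q i)) - F) = 0"
proof -
  have xp: "x j \<bullet> p i = 0" and yq: "y j \<bullet> q i = 0" if "i \<in> I" for i j
    unfolding x y by (rule inner_frame_residual [OF I p that] inner_frame_residual [OF I q that]; assumption)+
  have xu: "x j \<bullet> u l = x j \<bullet> x l" for j l
  proof -
    have "x j \<bullet> frame_proj I p (u l) = 0"
      by (rule inner_residual_span [OF xp frame_proj_in_span])
    then show ?thesis by (simp add: x [of l] inner_diff_right)
  qed
  have yv: "y j \<bullet> v l = y j \<bullet> y l" for j l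
  proof -
    have "y j \<bullet> frame_proj I q (v l) = 0"
      by (rule inner_residual_span [OF yq frame_proj_in_span])
    then show ?thesis by (simp add: y [of l] inner_diff_right)
  qed
  have "F \<bullet> (\<Sum>i\<in>I. outer (p i) (q i)) = 0"
    unfolding F sum_inner_mult_inner by (intro sum.neutral ballI) (simp add: xp)
  moreover have "F \<bullet> (\<Sum>j\<in>J. outer (u j) (v j)) = F \<bullet> F"
    unfolding F sum_inner_mult_inner by (simp only: xu yv)
  ultimately show ?thesis
    by (simp add: inner_diff_right)
qed

text \<open>\<open>G\<close> vanishes on the columns of \<open>M\<close>, \<open>Gs\<close> is
  semidefinite and annihilates \<open>Ms\<close>; hence \<open><g, H> = - <Gs, M> - <G, F>\<close>,
  at most \<open>- <G, F>\<close>. Comparison with \<open><g, F>\<close> gives one estimate, the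
  second-order condition at every \<open>x j\<close> the other.\<close>

lemma symmetric_case:
  fixes \<phi> :: "real ^ 'd ^ 'd \<Rightarrow> real" and U :: "real ^ 'r ^ 'd"
  assumes rs: "1 \<le> rs" "rs \<le> CARD('r)"
    and \<phi>: "twice_differentiable_on psd_mats symmetric_mats \<phi>"
    and ex: "\<exists>a b. restricted_sc_smooth psd_mats symmetric_mats (CARD('r) + rs) (CARD('r) + rs) a b \<phi>"
    and \<mu>: "\<mu> = rsc_const psd_mats symmetric_mats (CARD('r) + rs) (CARD('r) + rs) \<phi>"
    and L: "L = rsm_const psd_mats symmetric_mats (CARD('r) + rs) (CARD('r) + rs) \<phi>"
    and L2: "L2 = rsm_const psd_mats symmetric_mats 2 (CARD('r) + rs) \<phi>"
    and gap: "L2 / (2 * sqrt (real CARD('r) / real rs) + L2 / L) < \<mu>"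
    and Ms: "Ms \<in> psd_mats" "rank Ms \<le> rs"
    and opt: "(gradient psd_mats symmetric_mats \<phi> Ms + lam *\<^sub>R mat 1) ** Ms = 0"
      "gradient psd_mats symmetric_mats \<phi> Ms + lam *\<^sub>R mat 1 \<in> psd_mats"
    and crit: "second_order_critical (\<lambda>X. \<phi> (X ** transpose X) + lam * (norm X)\<^sup>2) U"
  shows "U ** transpose U = Ms"
proof -
  let ?k = "CARD('r) + rs"
  define M where "M = U ** transpose U"
  define G where "G = gradient psd_mats symmetric_mats \<phi> M + lam *\<^sub>R mat 1"
  define Gs where "Gs = gradient psd_mats symmetric_mats \<phi> Ms + lam *\<^sub>R mat 1"
  have M: "M \<in> psd_mats" unfolding M_def by (rule product_transpose_psd)
  let ?e = "axis undefined 1 :: real ^ 'd"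
  have "norm (outer ?e ?e) = 1" by (simp add: norm_outer)
  then have "outer ?e ?e \<noteq> 0" by (metis norm_zero zero_neq_one)
  then have wit: "0 \<in> (psd_mats :: (real ^ 'd ^ 'd) set)" "rank (0 :: real ^ 'd ^ 'd) \<le> ?k" "outer ?e ?e \<in> symmetric_mats"
      "rank (outer ?e ?e) \<le> 2" "outer ?e ?e \<noteq> 0"
    using psd_mats_scale [OF Ms(1), of 0] rank_outer_le [of ?e ?e]
    by (simp_all add: symmetric_mats_def transpose_outer)
  \<comment> \<open>Constants admissible for perturbations of rank \<open>r + rs\<close> are thus
    admissible for rank two, so \<open>L2\<close> is finite as well.\<close>
  have k2: "2 \<le> ?k" using rs by simp
  then have wit_k: "rank (outer ?e ?e) \<le> ?k" using wit(4) by linarith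
  note bounds = restricted_consts [OF ex wit(1-3) wit_k wit(5) \<mu> L]
  have ex2: "\<exists>a b. restricted_sc_smooth psd_mats symmetric_mats 2 ?k a b \<phi>"
    using ex restricted_sc_smooth_mono [OF _ _ k2] by (metis one_le_numeral)
  note bounds2 = restricted_consts [OF ex2 wit refl L2]
  have L2_0: "0 \<le> L2" using bounds2(1,2) by linarith
  have rank_M: "rank M \<le> CARD('r)"
    unfolding M_def using rank_mul_le_left [of U "transpose U"] rank_bound [of U] by simp
  obtain I :: "(real ^ 'd) set" and p q where
    I: "finite I" "card I = rank M" "M = (\<Sum>i\<in>I. outer (p i) (q i))"
    and p: "\<And>i j. i \<in> I \<Longrightarrow> j \<in> I \<Longrightarrow> i \<noteq> j \<Longrightarrow> p i \<bullet> p j = 0"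
    and q: "\<And>i j. i \<in> I \<Longrightarrow> j \<in> I \<Longrightarrow> i \<noteq> j \<Longrightarrow> q i \<bullet> q j = 0"
    and pq: "\<And>i. i \<in> I \<Longrightarrow> norm (p i) = norm (q i)" and nz: "\<And>i. i \<in> I \<Longrightarrow> p i \<noteq> 0"
    by (rule singular_value_decomposition) (rule that)
  have p_eq: "p i = q i" if "i \<in> I" for i
    using M I(1) that unfolding I(3) by (rule psd_factors_eq) (use p q pq nz that in auto)
  have M_p: "M = (\<Sum>i\<in>I. outer (p i) (p i))"
    using I(3) p_eq by simp
  obtain I' :: "(real ^ 'd) set" and p' q' where
    I': "finite I'" "card I' = rank Ms" "Ms = (\<Sum>i\<in>I'. outer (p' i) (q' i))"
    and p': "\<And>i j. i \<in> I' \<Longrightarrow> j \<in> I' \<Longrightarrow> i \<noteq> j \<Longrightarrow> p' i \<bullet> p' j = 0"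
    and q': "\<And>i j. i \<in> I' \<Longrightarrow> j \<in> I' \<Longrightarrow> i \<noteq> j \<Longrightarrow> q' i \<bullet> q' j = 0"
    and pq': "\<And>i. i \<in> I' \<Longrightarrow> norm (p' i) = norm (q' i)" and nz': "\<And>i. i \<in> I' \<Longrightarrow> p' i \<noteq> 0"
    by (rule singular_value_decomposition) (rule that)
  have p_eq': "p' i = q' i" if "i \<in> I'" for i
    using Ms(1) I'(1) that unfolding I'(3) by (rule psd_factors_eq) (use p' q' pq' nz' that in auto)
  have cards: "card I \<le> CARD('r)" "card I' \<le> rs"
    using rank_M Ms(2) I(2) I'(2) by simp_all
  note error_bound = frame_error_bound [where 'r = 'r and I = I and p = p and q = q and I' = I' and p' = p'
      and q' = q' and k = rs, OF I(1) cards(1) p q pq nz I'(1) cards(2) rs p' q' pq' nz']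
  obtain J :: "(real ^ 'd) set" and c u v x y s where
    J: "finite J" "card J \<le> rs" "(\<Sum>j\<in>J. outer (u j) (v j)) = (\<Sum>i\<in>I'. outer (p' i) (q' i))"
    and "\<And>j l. u j \<bullet> u l = v j \<bullet> v l" "(\<Sum>j\<in>J. u j \<bullet> u j) = (\<Sum>i\<in>I'. p' i \<bullet> p' i)"
    and u: "\<And>j. u j = (\<Sum>i\<in>I'. c j i *\<^sub>R p' i)" and v: "\<And>j. v j = (\<Sum>i\<in>I'. c j i *\<^sub>R q' i)"
    and s: "0 \<le> s" "card I \<noteq> CARD('r) \<Longrightarrow> s = 0" "card I = CARD('r) \<Longrightarrow> \<exists>i\<in>I. s = p i \<bullet> p i"
    and x_def: "\<And>j. x j = u j - frame_proj I p (u j)" and y_def: "\<And>j. y j = v j - frame_proj I q (v j)"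
    and bound: "\<And>b. 0 < b \<Longrightarrow> b \<le> 1 \<Longrightarrow>
      2 * b * sqrt (real CARD('r) / real rs) * (s * (\<Sum>j\<in>J. (x j \<bullet> x j + y j \<bullet> y j) / 2)) \<le>
        b\<^sup>2 * (norm (\<Sum>j\<in>J. outer (x j) (y j)))\<^sup>2 + (norm ((\<Sum>j\<in>J. outer (u j) (v j)) -
          (\<Sum>i\<in>I. outer (p i) (q i)) - (\<Sum>j\<in>J. outer (x j) (y j))))\<^sup>2"
    by (rule error_bound) (assumption+, rule that)
  \<comment> \<open>The rotation coefficients \<open>c j i\<close> are shared by both
    factors.\<close>
  have uv: "v j = u j" for j
    unfolding u v using p_eq' by simp
  have Ms_u: "Ms = (\<Sum>j\<in>J. outer (u j) (u j))"
    using J(3) I'(3) by (simp add: uv)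
  have proj_q: "frame_proj I q z = frame_proj I p z" for z
    unfolding frame_proj_def using p_eq by (intro sum.cong) auto
  have yx: "y j = x j" for j
    by (simp add: x_def y_def proj_q uv)
  define F where "F = (\<Sum>j\<in>J. outer (x j) (x j))"
  have xp: "x j \<bullet> p i = 0" if "i \<in> I" for i j
    unfolding x_def by (rule inner_frame_residual [OF I(1) p that])
  have GU: "G ** U = 0"
    by (rule symmetric_critical(1) [OF \<phi> crit]) (simp add: G_def M_def)
  have second: "0 \<le> hessian psd_mats symmetric_mats \<phi> M (E ** transpose U + U ** transpose E)
      (E ** transpose U + U ** transpose E) + 2 * ((G ** E) \<bullet> E)" for E
    unfolding M_def by (rule symmetric_critical(2) [OF \<phi> crit]) (simp add: G_def M_def)
  have escape: "0 \<le> x j \<bullet> (G *v x j) + L2 * s * (x j \<bullet> x j)" for j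
  proof (rule symmetric_spurious_direction_bound [OF I(1) cards(1) _ p nz s _ second L2_0 xp])
    show "U ** transpose U = (\<Sum>i\<in>I. outer (p i) (p i))"
      using M_p by (simp add: M_def)
    show "hessian psd_mats symmetric_mats \<phi> M E E \<le> L2 * (norm E)\<^sup>2"
      if "E \<in> symmetric_mats" "rank E \<le> 2" for E
      using that rank_M by (intro bounds2(4) M) auto
  qed
  have grad_sym: "gradient psd_mats symmetric_mats \<phi> P \<in> symmetric_mats" if "P \<in> psd_mats" for P
    by (intro psd_domain.gradient_works(1) twice_differentiable_onD(1) [OF \<phi>] that)
  have symG: "transpose G = G"
    using grad_sym [OF M] by (simp add: G_def symmetric_mats_def transpose_add transpose_scalar)
  have Gp: "G *v z = 0" if "z \<in> span (p ` I)" for z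
  proof -
    have "G *v p i = 0" if i: "i \<in> I" for i
    proof -
      have "(p i \<bullet> p i) *\<^sub>R (G *v p i) = G *v (M *v p i)"
        using frame_mult_vec [where p = p and q = p and k = i, OF I(1) i p] by (simp add: M_p matrix_vector_mult_scaleR)
      also have "\<dots> = (G ** U) *v (transpose U *v p i)"
        by (simp add: M_def matrix_vector_mul_assoc [symmetric])
      finally show ?thesis using GU nz [OF i] by simp
    qed
    then show ?thesis
      using that linear_eq_0_on_span [of "(*v) G" "p ` I" z] by auto
  qed
  have Gu: "u j \<bullet> (G *v u j) = x j \<bullet> (G *v x j)" for j
  proof -
    define z where "z = frame_proj I p (u j)"
    have Gz: "G *v z = 0" unfolding z_def by (intro Gp frame_proj_in_span)
    then have "z \<bullet> (G *v x j) = 0"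
      by (metis inner_transpose_vec inner_zero_left symG)
    moreover have "u j = x j + z" by (simp add: x_def z_def)
    ultimately show ?thesis
      by (simp add: matrix_vector_right_distrib Gz inner_add_left)
  qed
  have Gs_psd: "0 \<le> z \<bullet> (Gs *v z)" for z
    using opt(2) by (simp add: Gs_def psd_mats_def)
  have GsMs: "Gs \<bullet> Ms = 0"
  proof -
    have "Gs \<bullet> (mat 1 ** Ms) = (Gs ** transpose Ms) \<bullet> mat 1"
      by (rule inner_matrix_mult_right)
    also have "transpose Ms = Ms" using Ms(1) by (simp add: psd_mats_def symmetric_mats_def)
    finally show ?thesis using opt(1) by (simp add: Gs_def)
  qed
  have GM: "G \<bullet> M = 0"
    unfolding M_p inner_sum_right inner_outer by (intro sum.neutral ballI) (simp add: Gp span_base)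
  have GMs: "G \<bullet> Ms = (\<Sum>j\<in>J. x j \<bullet> (G *v x j))" and GF: "G \<bullet> F = (\<Sum>j\<in>J. x j \<bullet> (G *v x j))"
    by (simp_all add: Ms_u F_def inner_sum_right inner_outer Gu)
  have GsM: "0 \<le> Gs \<bullet> M" and GsF: "0 \<le> Gs \<bullet> F"
    unfolding M_p F_def inner_sum_right inner_outer by (intro sum_nonneg Gs_psd)+
  have g: "Gs - G = gradient psd_mats symmetric_mats \<phi> Ms - gradient psd_mats symmetric_mats \<phi> M"
    by (simp add: G_def Gs_def)
  have w: "(Gs - G) \<bullet> (Ms - M) = - (Gs \<bullet> M) - (\<Sum>j\<in>J. x j \<bullet> (G *v x j))"
    by (simp add: inner_diff GsMs GM GMs)
  have "M = Ms"
  proof (rule optimum_unique [OF psd_domain.recession_domain_axioms \<phi> M Ms(1) _ _ _ _ _ _ bounds(3,4) _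
        bounds(1,2) L2_0 gap _ g])
    show "F \<in> symmetric_mats"
      by (simp add: F_def symmetric_mats_def transpose_sum transpose_outer)
    show "finite (p ` I \<union> u ` J)" by (rule frame_span_bound [OF I(1) J(1) x_def])
    have "card (p ` I \<union> u ` J) \<le> card I + card J" by (rule frame_span_bound [OF I(1) J(1) x_def])
    then show "card (p ` I \<union> u ` J) \<le> ?k" using cards(1) J(2) by linarith
    show "M *v z \<in> span (p ` I \<union> u ` J)" for z
      unfolding M_p by (rule frame_span_bound [OF I(1) J(1) x_def])
    show "Ms *v z \<in> span (p ` I \<union> u ` J)" for z
      unfolding Ms_u by (rule frame_span_bound [OF I(1) J(1) x_def])
    show "F *v z \<in> span (p ` I \<union> u ` J)" for z
      unfolding F_def by (rule frame_span_bound [OF I(1) J(1) x_def])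
    show "0 < sqrt (real CARD('r) / real rs)" using rs by simp
    show "F \<bullet> (Ms - M - F) = 0"
      unfolding Ms_u M_p by (rule frame_residual_orthogonal [OF I(1) p p x_def x_def F_def])
    show "(Gs - G) \<bullet> (Ms - M) \<le> (Gs - G) \<bullet> F"
      unfolding w using GsM GsF by (simp add: inner_diff_left GF)
    have "0 \<le> (\<Sum>j\<in>J. x j \<bullet> (G *v x j) + L2 * s * (x j \<bullet> x j))"
      by (intro sum_nonneg escape)
    then show "(Gs - G) \<bullet> (Ms - M) \<le> L2 * (s * (\<Sum>j\<in>J. (x j \<bullet> x j + x j \<bullet> x j) / 2))"
      using GsM by (simp add: w sum.distrib sum_distrib_left mult.assoc)
    show "2 * c * sqrt (real CARD('r) / real rs) * (s * (\<Sum>j\<in>J. (x j \<bullet> x j + x j \<bullet> x j) / 2)) \<le>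
        c\<^sup>2 * (norm F)\<^sup>2 + (norm (Ms - M - F))\<^sup>2" if "0 < c" "c \<le> 1" for c
      using bound [OF that] by (simp only: yx uv F_def Ms_u I(3))
  qed
  then show ?thesis by (simp add: M_def)
qed

subsection \<open>The asymmetric case\<close>

text \<open>The limit \<open>e\<close> to \<open>0\<close>. It serves the case
  \<open>lam = 0\<close>, where two test vectors can be scaled inversely.\<close>

lemma nonneg_if_scaled_nonneg:
  fixes C k :: real
  assumes "0 \<le> C" "\<And>e. 0 < e \<Longrightarrow> 0 \<le> e\<^sup>2 * C + k"
  shows "0 \<le> k"
proof (rule ccontr)
  assume "\<not> 0 \<le> k"
  define d where "d = C + 1"
  define K where "K = - k / 2"
  have d: "0 < d" and K: "0 < K"
    using assms(1) \<open>\<not> 0 \<le> k\<close> by (simp_all add: d_def K_def)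
  define e where "e = sqrt (K / d)"
  have e: "0 < e" "e\<^sup>2 = K / d" using d K by (simp_all add: e_def)
  have "e\<^sup>2 * C \<le> e\<^sup>2 * d" by (intro mult_left_mono) (auto simp: d_def)
  also have "\<dots> = K" using d by (simp add: e(2))
  finally show False using assms(2) [OF e(1)] K by (simp add: K_def)
qed

text \<open>Both first-order conditions evaluate \<open>U^T G V\<close>. At \<open>lam = 0\<close>
  both results are zero and carry no information about balance.\<close>

lemma critical_factors_balanced:
  fixes U :: "real ^ 'r ^ 'm" and V :: "real ^ 'r ^ 'n"
  assumes "G ** V = - lam *\<^sub>R U" "transpose G ** U = - lam *\<^sub>R V" "lam \<noteq> 0"
  shows "transpose U ** U = transpose V ** V"
proof -
  have "transpose (transpose G ** U) ** V = transpose U ** (G ** V)"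
    by (simp add: matrix_transpose_mul matrix_mul_assoc)
  then have "lam *\<^sub>R (transpose V ** V) = lam *\<^sub>R (transpose U ** U)"
    by (simp add: assms(1,2) transpose_scalar matrix_mult.scaleR_left matrix_mult.scaleR_right
        matrix_mult.minus_left matrix_mult.minus_right flip: scaleR_minus_left)
  then show ?thesis using assms(3) by simp
qed

text \<open>For \<open>lam \<noteq> 0\<close>, the common Gram matrix
  \<open>W = U^T U = V^T V\<close> satisfies \<open>W b = s a\<close> and \<open>W a = s b\<close>;
  so \<open>W (a - b) = - s (a - b)\<close>, and semidefiniteness gives \<open>a = b\<close>.
  Without balance \<open>a \<bullet> b = 1\<close> remains, which is all that the term with
  \<open>G\<close> sees.\<close>

lemma factor_preimages:
  fixes U :: "real ^ 'r ^ 'm" and V :: "real ^ 'r ^ 'n"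
  assumes I: "finite I" "i \<in> I" and M: "U ** transpose V = (\<Sum>i\<in>I. outer (p i) (q i))"
    and p: "\<And>i j. i \<in> I \<Longrightarrow> j \<in> I \<Longrightarrow> i \<noteq> j \<Longrightarrow> p i \<bullet> p j = 0"
    and q: "\<And>i j. i \<in> I \<Longrightarrow> j \<in> I \<Longrightarrow> i \<noteq> j \<Longrightarrow> q i \<bullet> q j = 0"
    and pq: "norm (p i) = norm (q i)" and nz: "p i \<noteq> 0"
    and G: "G ** V = - lam *\<^sub>R U" "transpose G ** U = - lam *\<^sub>R V"
  obtains a b where "V *v a = q i" "U *v b = p i" "a \<bullet> b = 1" "lam \<noteq> 0 \<Longrightarrow> a = b"
proof -
  define s where "s = p i \<bullet> p i"
  have s: "0 < s" "q i \<bullet> q i = s"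
    using nz by (simp add: s_def) (use pq in \<open>simp add: s_def dot_square_norm\<close>)
  define a where "a = (transpose U *v p i) /\<^sub>R s"
  define b where "b = (transpose V *v q i) /\<^sub>R s"
  have Mq: "U *v (transpose V *v q i) = s *\<^sub>R p i"
    using frame_mult_vec [where p = p and q = q and k = i, OF I q] s(2)
    by (simp add: matrix_vector_mul_assoc M)
  have M': "V ** transpose U = (\<Sum>i\<in>I. outer (q i) (p i))"
    using arg_cong [OF M, of transpose] by (simp add: matrix_transpose_mul transpose_sum transpose_outer)
  have Mp: "V *v (transpose U *v p i) = s *\<^sub>R q i"
    using frame_mult_vec [where p = q and q = p and k = i, OF I p]
    by (simp add: matrix_vector_mul_assoc M' s_def)
  have Va: "V *v a = q i" and Ub: "U *v b = p i"
    using s(1) by (simp_all add: a_def b_def matrix_vector_mult_scaleR Mq Mp)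
  have "(transpose U *v p i) \<bullet> (transpose V *v q i) = s * s"
    unfolding inner_transpose_vec [symmetric] Mq by (simp add: s_def)
  then have ab: "a \<bullet> b = 1"
    using s(1) by (simp add: a_def b_def field_simps)
  have "a = b" if "lam \<noteq> 0"
  proof -
    have bal: "transpose U ** U = transpose V ** V"
      by (rule critical_factors_balanced [OF G that])
    have "(transpose U ** U) *v b = s *\<^sub>R a"
      using s(1) by (simp add: matrix_vector_mul_assoc [symmetric] Ub a_def)
    moreover have "(transpose U ** U) *v a = s *\<^sub>R b"
      using s(1) by (simp add: bal) (simp add: matrix_vector_mul_assoc [symmetric] Va b_def)
    ultimately have "(transpose U ** U) *v (a - b) = (- s) *\<^sub>R (a - b)"
      by (simp add: matrix_vector_mult_diff_distrib algebra_simps)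
    then have "transpose U *v (U *v (a - b)) = (- s) *\<^sub>R (a - b)"
      by (simp only: matrix_vector_mul_assoc)
    then have "(U *v (a - b)) \<bullet> (U *v (a - b)) = - s * ((a - b) \<bullet> (a - b))"
      unfolding inner_transpose_vec by simp
    then have "s * ((a - b) \<bullet> (a - b)) \<le> 0"
      by (metis inner_ge_zero minus_mult_left neg_0_le_iff_le)
    then have "(a - b) \<bullet> (a - b) \<le> 0"
      using s(1) by (simp add: mult_le_0_iff)
    then have "(a - b) \<bullet> (a - b) = 0"
      using inner_ge_zero [of "a - b"] by linarith
    then show ?thesis by simp
  qed
  with Va Ub ab show ?thesis by (rule that)
qed

text \<open>Perturbing the factors by \<open>outer x a\<close> and \<open>outer y b\<close> moves
  \<open>M\<close> by \<open>outer x (q i) + outer (p i) y\<close>, of squared norm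
  \<open>s (|x|^2 + |y|^2)\<close>. The penalty comes out right because either
  \<open>lam = 0\<close> or \<open>a = b\<close> is a unit vector.\<close>

lemma asymmetric_spurious_direction_bound:
  fixes U :: "real ^ 'r ^ 'm" and V :: "real ^ 'r ^ 'n" and p :: "'i \<Rightarrow> real ^ 'm" and q :: "'i \<Rightarrow> real ^ 'n"
  assumes I: "finite I" "card I \<le> CARD('r)" and M: "U ** transpose V = (\<Sum>i\<in>I. outer (p i) (q i))"
    and p: "\<And>i j. i \<in> I \<Longrightarrow> j \<in> I \<Longrightarrow> i \<noteq> j \<Longrightarrow> p i \<bullet> p j = 0"
    and q: "\<And>i j. i \<in> I \<Longrightarrow> j \<in> I \<Longrightarrow> i \<noteq> j \<Longrightarrow> q i \<bullet> q j = 0"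
    and pq: "\<And>i. i \<in> I \<Longrightarrow> norm (p i) = norm (q i)" and nz: "\<And>i. i \<in> I \<Longrightarrow> p i \<noteq> 0"
    and s: "0 \<le> s" "card I \<noteq> CARD('r) \<Longrightarrow> s = 0" "card I = CARD('r) \<Longrightarrow> \<exists>i\<in>I. s = p i \<bullet> p i"
    and upper: "\<And>E. rank E \<le> 2 \<Longrightarrow> h E \<le> L2 * (norm E)\<^sup>2"
    and second_order: "\<And>(E :: real ^ 'r ^ 'm) E'. 0 \<le> h (E ** transpose V + U ** transpose E') +
      2 * ((G ** E') \<bullet> E) + lam * ((norm E)\<^sup>2 + (norm E')\<^sup>2)"
    and G: "G ** V = - lam *\<^sub>R U" "transpose G ** U = - lam *\<^sub>R V"
    and L2: "0 \<le> L2"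
    and x: "\<And>i. i \<in> I \<Longrightarrow> x \<bullet> p i = 0" and y: "\<And>i. i \<in> I \<Longrightarrow> y \<bullet> q i = 0"
  shows "0 \<le> 2 * (x \<bullet> (G *v y)) + lam * (x \<bullet> x + y \<bullet> y) + L2 * s * (x \<bullet> x + y \<bullet> y)"
proof (cases "card I = CARD('r)")
  case True
  then obtain i where i: "i \<in> I" "s = p i \<bullet> p i" using s(3) by blast
  have qs: "q i \<bullet> q i = s" using pq [OF i(1)] i(2) by (simp add: dot_square_norm)
  obtain a b where ab: "V *v a = q i" "U *v b = p i" "a \<bullet> b = 1" "lam \<noteq> 0 \<Longrightarrow> a = b"
    by (rule factor_preimages [where i = i and p = p and q = q, OF I(1) i(1) M p q pq nz G])
      (use i(1) that in auto)
  let ?E = "outer x a"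
  let ?E' = "outer y b"
  let ?S = "?E ** transpose V + U ** transpose ?E'"
  have S: "?S = outer x (q i) + outer (p i) y"
    by (simp add: outer_matrix_mult matrix_mult_outer transpose_outer ab)
  have "rank ?S \<le> card {x, p i}"
  proof (rule range_subset_imp_rank_le)
    show "?S *v z \<in> span {x, p i}" for z
      unfolding S matrix_vector_mult_add_rdistrib outer_mult_vec
      by (intro span_add span_scale span_base) auto
  qed simp
  then have "rank ?S \<le> 2"
    by (rule order_trans) (simp add: card_insert_if)
  then have "h ?S \<le> L2 * (norm ?S)\<^sup>2"
    by (rule upper)
  also have "(norm ?S)\<^sup>2 = s * (x \<bullet> x + y \<bullet> y)"
    using x [OF i(1)] y [OF i(1)]
    unfolding S by (simp add: power2_norm_eq_inner inner_add inner_outer_outer inner_commute [of "p i" x]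
        i(2) [symmetric] qs algebra_simps)
  finally have "0 \<le> L2 * (s * (x \<bullet> x + y \<bullet> y)) + 2 * ((G ** ?E') \<bullet> ?E) + lam * ((norm ?E)\<^sup>2 + (norm ?E')\<^sup>2)"
    using second_order [of ?E ?E'] by linarith
  moreover have "lam * ((norm ?E)\<^sup>2 + (norm ?E')\<^sup>2) = lam * (x \<bullet> x + y \<bullet> y)"
    using ab(3,4) by (cases "lam = 0") (simp_all add: power2_norm_eq_inner inner_outer_outer)
  moreover have "(G ** ?E') \<bullet> ?E = x \<bullet> (G *v y)"
    using ab(3) by (simp add: matrix_mult_outer inner_outer_outer inner_commute)
  ultimately show ?thesis
    by (simp add: algebra_simps)
next
  case False
  then have "card I < CARD('r)" using I(2) by simp
  then obtain z where z: "z \<noteq> 0" "\<And>i. i \<in> I \<Longrightarrow> (transpose U *v p i) \<bullet> z = 0"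
    using exists_orthogonal_vector [OF I(1), of "\<lambda>i. transpose U *v p i"] by blast
  have M': "V ** transpose U = (\<Sum>i\<in>I. outer (q i) (p i))"
    using arg_cong [OF M, of transpose] by (simp add: matrix_transpose_mul transpose_sum transpose_outer)
  have "V *v (transpose U *v (U *v z)) = (\<Sum>i\<in>I. (p i \<bullet> (U *v z)) *\<^sub>R q i)"
    using outer_mult_sum [of q p I "U *v z"] by (metis M' matrix_vector_mul_assoc)
  also have "\<dots> = 0"
    using z(2) by (simp add: inner_transpose_vec)
  finally have V0: "V *v (transpose U *v (U *v z)) = 0" .
  \<comment> \<open>Either \<open>U z = 0\<close>, or \<open>U^T U z\<close> is a nonzero vector in
    the kernel of \<open>V\<close>.\<close>
  have "\<exists>z. z \<noteq> 0 \<and> (U *v z = 0 \<or> V *v z = 0)"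
  proof (cases "transpose U *v (U *v z) = 0")
    case True
    then have "(U *v z) \<bullet> (U *v z) = 0"
      by (simp add: inner_transpose_vec)
    then show ?thesis using z(1) by auto
  qed (use V0 in blast)
  then obtain z where z: "z \<noteq> 0" "U *v z = 0 \<or> V *v z = 0" by blast
  have zz: "0 < z \<bullet> z" using z(1) by simp
  have test: "0 \<le> L2 * (norm (outer x (V *v z) + outer (U *v z) y))\<^sup>2 +
      (z \<bullet> z) * (2 * (x \<bullet> (G *v y)) + lam * (x \<bullet> x + y \<bullet> y))" for x y
  proof -
    let ?S = "outer x (V *v z) + outer (U *v z) y"
    have "rank ?S \<le> card {x, U *v z}"
    proof (rule range_subset_imp_rank_le)
      show "?S *v w \<in> span {x, U *v z}" for w
        unfolding matrix_vector_mult_add_rdistrib outer_mult_vec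
        by (intro span_add span_scale span_base) auto
    qed simp
    then have "rank ?S \<le> 2"
      by (rule order_trans) (simp add: card_insert_if)
    then have "h ?S \<le> L2 * (norm ?S)\<^sup>2"
      by (rule upper)
    moreover have "0 \<le> h ?S + 2 * ((G ** outer y z) \<bullet> outer x z) + lam * ((norm (outer x z))\<^sup>2 + (norm (outer y z))\<^sup>2)"
      using second_order [of "outer x z" "outer y z"]
      by (simp add: outer_matrix_mult matrix_mult_outer transpose_outer)
    moreover have "2 * ((G ** outer y z) \<bullet> outer x z) + lam * ((norm (outer x z))\<^sup>2 + (norm (outer y z))\<^sup>2) =
        (z \<bullet> z) * (2 * (x \<bullet> (G *v y)) + lam * (x \<bullet> x + y \<bullet> y))"
      by (simp add: matrix_mult_outer power2_norm_eq_inner inner_outer_outer inner_commute [of "G *v y" x] algebra_simps)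
    ultimately show ?thesis by linarith
  qed
  have "0 \<le> (z \<bullet> z) * (2 * (x \<bullet> (G *v y)) + lam * (x \<bullet> x + y \<bullet> y))"
  proof (cases "lam = 0")
    case False
    have bal: "transpose U ** U = transpose V ** V"
      by (rule critical_factors_balanced [OF G False])
    have "(U *v z) \<bullet> (U *v z) = (V *v z) \<bullet> (V *v z)"
      unfolding inner_transpose_vec matrix_vector_mul_assoc bal ..
    then have "U *v z = 0" "V *v z = 0" using z(2) by auto
    then show ?thesis
      using test [of x y] by (simp add: outer.zero_left outer.zero_right)
  next
    \<comment> \<open>Only one of \<open>U z\<close>, \<open>V z\<close> is known to vanish. Scaling
      \<open>x\<close> and \<open>y\<close> inversely preserves \<open>x \<bullet> (G *v y)\<close>
      and shrinks the surviving part of the perturbation by \<open>e\<close>.\<close>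
    case True
    define C where "C = L2 * (norm (outer x (V *v z) + outer (U *v z) y))\<^sup>2"
    have C: "0 \<le> C" using L2 by (simp add: C_def)
    show ?thesis
    proof (rule nonneg_if_scaled_nonneg [OF C])
      fix e :: real assume e: "0 < e"
      consider "U *v z = 0" | "V *v z = 0" using z(2) by blast
      then show "0 \<le> e\<^sup>2 * C + (z \<bullet> z) * (2 * (x \<bullet> (G *v y)) + lam * (x \<bullet> x + y \<bullet> y))"
      proof cases
        case 1
        then show ?thesis
          using test [of "e *\<^sub>R x" "(1 / e) *\<^sub>R y"] e True
          by (simp add: C_def outer.scaleR_left outer.zero_left matrix_vector_mult_scaleR power_mult_distrib mult_ac)
      next
        case 2
        then show ?thesis
          using test [of "(1 / e) *\<^sub>R x" "e *\<^sub>R y"] e True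
          by (simp add: C_def outer.scaleR_right outer.zero_right matrix_vector_mult_scaleR power_mult_distrib mult_ac)
      qed
    qed
  qed
  then have "0 \<le> 2 * (x \<bullet> (G *v y)) + lam * (x \<bullet> x + y \<bullet> y)"
    using zz by (simp add: zero_le_mult_iff)
  then show ?thesis
    using False s(2) by simp
qed

text \<open>\<open>Q\<close> and \<open>A\<close> play the role of the nuclear norms of
  \<open>M\<close> and \<open>Ms\<close>. The four pairings of \<open>G\<close> and
  \<open>Gs\<close> with \<open>M\<close> and \<open>Ms\<close> are estimated so that all terms with
  \<open>lam * Q\<close> and \<open>lam * A\<close> cancel and
  \<open><g, H> \<le> - <G, F> - lam * \<tau>\<close> remains. The operator norm bound on the
  subgradient compares this with \<open><g, F>\<close>, the second-order condition with
  \<open>L2 * (s * \<tau>)\<close>.\<close>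

lemma asymmetric_case:
  fixes \<phi> :: "real ^ 'n ^ 'm \<Rightarrow> real" and U :: "real ^ 'r ^ 'm" and V :: "real ^ 'r ^ 'n"
  assumes rs: "1 \<le> rs" "rs \<le> CARD('r)" and lam: "0 \<le> lam"
    and \<phi>: "twice_differentiable_on UNIV UNIV \<phi>"
    and ex: "\<exists>a b. restricted_sc_smooth UNIV UNIV (CARD('r) + rs) (CARD('r) + rs) a b \<phi>"
    and \<mu>: "\<mu> = rsc_const UNIV UNIV (CARD('r) + rs) (CARD('r) + rs) \<phi>"
    and L: "L = rsm_const UNIV UNIV (CARD('r) + rs) (CARD('r) + rs) \<phi>"
    and L2: "L2 = rsm_const UNIV UNIV 2 (CARD('r) + rs) \<phi>"
    and gap: "L2 / (2 * sqrt (real CARD('r) / real rs) + L2 / L) < \<mu>"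
    and Ms: "rank Ms \<le> rs"
    and opt: "gradient UNIV UNIV \<phi> Ms \<in> (\<lambda>G. - lam *\<^sub>R G) ` subdifferential nuclear_norm Ms"
    and crit: "second_order_critical
      (\<lambda>(X, Y). \<phi> (X ** transpose Y) + lam * (((norm X)\<^sup>2 + (norm Y)\<^sup>2) / 2)) (U, V)"
  shows "U ** transpose V = Ms"
proof -
  let ?k = "CARD('r) + rs"
  define M where "M = U ** transpose V"
  define G where "G = gradient UNIV UNIV \<phi> M"
  define Gs where "Gs = gradient UNIV UNIV \<phi> Ms"
  obtain D where D: "D \<in> subdifferential nuclear_norm Ms" "Gs = - lam *\<^sub>R D"
    using opt unfolding Gs_def by blast
  let ?E = "outer (axis undefined 1) (axis undefined 1) :: real ^ 'n ^ 'm"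
  have "norm ?E = 1" by (simp add: norm_outer)
  then have "?E \<noteq> 0" by (metis norm_zero zero_neq_one)
  then have wit: "(0 :: real ^ 'n ^ 'm) \<in> UNIV" "rank (0 :: real ^ 'n ^ 'm) \<le> ?k" "?E \<in> UNIV" "rank ?E \<le> 2" "?E \<noteq> 0"
    using order_trans [OF rank_outer_le one_le_numeral] by simp_all
  have k2: "2 \<le> ?k" using rs by simp
  then have wit_k: "rank ?E \<le> ?k" using wit(4) by linarith
  note bounds = restricted_consts [OF ex wit(1-3) wit_k wit(5) \<mu> L]
  have ex2: "\<exists>a b. restricted_sc_smooth UNIV UNIV 2 ?k a b \<phi>"
    using ex restricted_sc_smooth_mono [OF _ _ k2] by (metis one_le_numeral)
  note bounds2 = restricted_consts [OF ex2 wit refl L2]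
  have L2_0: "0 \<le> L2" using bounds2(1,2) by linarith
  have rank_M: "rank M \<le> CARD('r)"
    unfolding M_def using rank_mul_le_left [of U "transpose V"] rank_bound [of U] by simp
  obtain I :: "(real ^ 'n) set" and p q where
    I: "finite I" "card I = rank M" "M = (\<Sum>i\<in>I. outer (p i) (q i))"
    and p: "\<And>i j. i \<in> I \<Longrightarrow> j \<in> I \<Longrightarrow> i \<noteq> j \<Longrightarrow> p i \<bullet> p j = 0"
    and q: "\<And>i j. i \<in> I \<Longrightarrow> j \<in> I \<Longrightarrow> i \<noteq> j \<Longrightarrow> q i \<bullet> q j = 0"
    and pq: "\<And>i. i \<in> I \<Longrightarrow> norm (p i) = norm (q i)" and nz: "\<And>i. i \<in> I \<Longrightarrow> p i \<noteq> 0"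
    by (rule singular_value_decomposition) (rule that)
  obtain I' :: "(real ^ 'n) set" and p' q' where
    I': "finite I'" "card I' = rank Ms" "Ms = (\<Sum>i\<in>I'. outer (p' i) (q' i))"
    and p': "\<And>i j. i \<in> I' \<Longrightarrow> j \<in> I' \<Longrightarrow> i \<noteq> j \<Longrightarrow> p' i \<bullet> p' j = 0"
    and q': "\<And>i j. i \<in> I' \<Longrightarrow> j \<in> I' \<Longrightarrow> i \<noteq> j \<Longrightarrow> q' i \<bullet> q' j = 0"
    and pq': "\<And>i. i \<in> I' \<Longrightarrow> norm (p' i) = norm (q' i)" and nz': "\<And>i. i \<in> I' \<Longrightarrow> p' i \<noteq> 0"
    and nuc: "(\<Sum>i\<in>I'. (norm (p' i))\<^sup>2) \<le> nuclear_norm Ms"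
    by (rule singular_value_decomposition) (rule that)
  have cards: "card I \<le> CARD('r)" "card I' \<le> rs"
    using rank_M Ms I(2) I'(2) by simp_all
  note error_bound = frame_error_bound [where 'r = 'r and I = I and p = p and q = q and I' = I' and p' = p'
      and q' = q' and k = rs, OF I(1) cards(1) p q pq nz I'(1) cards(2) rs p' q' pq' nz']
  obtain J :: "(real ^ 'n) set" and c u v x y s where
    J: "finite J" "card J \<le> rs" "(\<Sum>j\<in>J. outer (u j) (v j)) = (\<Sum>i\<in>I'. outer (p' i) (q' i))"
    and gram: "\<And>j l. u j \<bullet> u l = v j \<bullet> v l" and sum_u: "(\<Sum>j\<in>J. u j \<bullet> u j) = (\<Sum>i\<in>I'. p' i \<bullet> p' i)"
    and "\<And>j. u j = (\<Sum>i\<in>I'. c j i *\<^sub>R p' i)" "\<And>j. v j = (\<Sum>i\<in>I'. c j i *\<^sub>R q' i)"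
    and s: "0 \<le> s" "card I \<noteq> CARD('r) \<Longrightarrow> s = 0" "card I = CARD('r) \<Longrightarrow> \<exists>i\<in>I. s = p i \<bullet> p i"
    and x_def: "\<And>j. x j = u j - frame_proj I p (u j)" and y_def: "\<And>j. y j = v j - frame_proj I q (v j)"
    and bound: "\<And>b. 0 < b \<Longrightarrow> b \<le> 1 \<Longrightarrow>
      2 * b * sqrt (real CARD('r) / real rs) * (s * (\<Sum>j\<in>J. (x j \<bullet> x j + y j \<bullet> y j) / 2)) \<le>
        b\<^sup>2 * (norm (\<Sum>j\<in>J. outer (x j) (y j)))\<^sup>2 + (norm ((\<Sum>j\<in>J. outer (u j) (v j)) -
          (\<Sum>i\<in>I. outer (p i) (q i)) - (\<Sum>j\<in>J. outer (x j) (y j))))\<^sup>2"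
    by (rule error_bound) (assumption+, rule that)
  have Ms_u: "Ms = (\<Sum>j\<in>J. outer (u j) (v j))"
    using J(3) I'(3) by simp
  define F where "F = (\<Sum>j\<in>J. outer (x j) (y j))"
  define \<tau> where "\<tau> = (\<Sum>j\<in>J. (x j \<bullet> x j + y j \<bullet> y j) / 2)"
  have xp: "x j \<bullet> p i = 0" if "i \<in> I" for i j
    unfolding x_def by (rule inner_frame_residual [OF I(1) p that])
  have yq: "y j \<bullet> q i = 0" if "i \<in> I" for i j
    unfolding y_def by (rule inner_frame_residual [OF I(1) q that])
  have GVU: "G ** V = - lam *\<^sub>R U" "transpose G ** U = - lam *\<^sub>R V"
    by (rule asymmetric_critical [OF \<phi> crit]; simp add: G_def M_def)+
  have second: "0 \<le> hessian UNIV UNIV \<phi> M (E ** transpose V + U ** transpose E') (E ** transpose V + U ** transpose E') +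
      2 * ((G ** E') \<bullet> E) + lam * ((norm E)\<^sup>2 + (norm E')\<^sup>2)" for E E'
    unfolding M_def by (rule asymmetric_critical(3) [OF \<phi> crit]) (simp add: G_def M_def)
  have M_pq: "U ** transpose V = (\<Sum>i\<in>I. outer (p i) (q i))"
    using I(3) by (simp add: M_def)
  have upper2: "hessian UNIV UNIV \<phi> M E E \<le> L2 * (norm E)\<^sup>2" if "rank E \<le> 2" for E
    using that rank_M by (intro bounds2(4)) auto
  have escape: "0 \<le> 2 * (x j \<bullet> (G *v y j)) + lam * (x j \<bullet> x j + y j \<bullet> y j) + L2 * s * (x j \<bullet> x j + y j \<bullet> y j)" for j
    by (rule asymmetric_spurious_direction_bound [OF I(1) cards(1) M_pq p q pq nz s upper2 second GVU L2_0 xp yq])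
  \<comment> \<open>\<open>G\<close> and its transpose exchange the row and column frames of
    \<open>M\<close> up to the factor \<open>- lam\<close>; this removes the cross terms between
    inside and outside parts below.\<close>
  have Gq: "G *v q i = - lam *\<^sub>R p i" and Gp: "transpose G *v p i = - lam *\<^sub>R q i" if i: "i \<in> I" for i
  proof -
    obtain a b where ab: "V *v a = q i" "U *v b = p i" "a \<bullet> b = 1" "lam \<noteq> 0 \<Longrightarrow> a = b"
      by (rule factor_preimages [where i = i and p = p and q = q, OF I(1) i M_pq p q pq [OF i] nz [OF i] GVU])
        (use that in auto)
    have "G *v q i = (G ** V) *v a" "transpose G *v p i = (transpose G ** U) *v b"
      by (simp_all add: ab(1,2) matrix_vector_mul_assoc [symmetric])
    then have "G *v q i = - lam *\<^sub>R (U *v a)" "transpose G *v p i = - lam *\<^sub>R (V *v b)"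
      unfolding GVU by (simp_all only: scaleR_matrix_vector_assoc)
    then show "G *v q i = - lam *\<^sub>R p i" "transpose G *v p i = - lam *\<^sub>R q i"
      using ab by (cases "lam = 0"; simp)+
  qed
  have Gspan: "G *v z \<in> span (p ` I)" if "z \<in> span (q ` I)" for z
    using that
  proof (induction rule: span_induct_alt)
    case (step c z w)
    then obtain i where "i \<in> I" "z = q i" by blast
    then show ?case
      using step by (simp add: matrix_vector_right_distrib matrix_vector_mult_scaleR Gq
          span_add span_diff span_neg span_scale span_base)
  qed (simp add: span_zero)
  have Gspan': "transpose G *v z \<in> span (q ` I)" if "z \<in> span (p ` I)" for z
    using that
  proof (induction rule: span_induct_alt)
    case (step c z w)
    then obtain i where "i \<in> I" "z = p i" by blast
    then show ?case
      using step by (simp add: matrix_vector_right_distrib matrix_vector_mult_scaleR Gp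
          span_add span_diff span_neg span_scale span_base)
  qed (simp add: span_zero)
  have uv_ge: "x j \<bullet> (G *v y j) - lam * (u j \<bullet> u j - (x j \<bullet> x j + y j \<bullet> y j) / 2) \<le> u j \<bullet> (G *v v j)" for j
  proof -
    define a where "a = frame_proj I p (u j)"
    define b where "b = frame_proj I q (v j)"
    \<comment> \<open>\<open>R\<close> transfers the coefficients of \<open>b\<close> from the row
      frame to the column frame; it has the length of \<open>b\<close>, and \<open>G *v b\<close> is
      \<open>- lam *\<^sub>R R\<close>. The mean of \<open>|a|^2\<close> and \<open>|b|^2\<close>
      bounds \<open>a \<bullet> R\<close>, and \<open>|u j| = |v j|\<close> expresses that mean
      through the outside parts.\<close>
    define R where "R = (\<Sum>i\<in>I. (v j \<bullet> q i / (q i \<bullet> q i)) *\<^sub>R p i)"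
    have ua: "u j = x j + a" and vb: "v j = y j + b"
      by (simp_all add: x_def y_def a_def b_def)
    have a: "a \<in> span (p ` I)" and b: "b \<in> span (q ` I)"
      unfolding a_def b_def by (rule frame_proj_in_span)+
    have xa: "x j \<bullet> a = 0" by (rule inner_residual_span [OF xp a])
    have yb: "y j \<bullet> b = 0" by (rule inner_residual_span [OF yq b])
    have "y j \<bullet> (transpose G *v a) = 0"
      by (rule inner_residual_span [OF yq Gspan' [OF a]])
    then have aGy: "a \<bullet> (G *v y j) = 0"
      by (metis inner_transpose_vec inner_commute)
    have xGb: "x j \<bullet> (G *v b) = 0"
      by (rule inner_residual_span [OF xp Gspan [OF b]])
    have "G *v b = - lam *\<^sub>R R"
    proof -
      have "G *v b = (\<Sum>i\<in>I. (v j \<bullet> q i / (q i \<bullet> q i)) *\<^sub>R (G *v q i))"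
        by (simp add: b_def frame_proj_def matrix_sum_mult matrix_vector_mult_scaleR)
      also have "\<dots> = (\<Sum>i\<in>I. - lam *\<^sub>R ((v j \<bullet> q i / (q i \<bullet> q i)) *\<^sub>R p i))"
        by (intro sum.cong refl) (simp add: Gq)
      finally show ?thesis unfolding R_def scaleR_sum_right .
    qed
    then have aGb: "a \<bullet> (G *v b) = - (lam * (a \<bullet> R))" by simp
    have "R \<bullet> R = b \<bullet> b"
    proof -
      have "R \<bullet> R = (\<Sum>i\<in>I. (v j \<bullet> q i / (q i \<bullet> q i)) * (v j \<bullet> q i / (q i \<bullet> q i)) * (p i \<bullet> p i))"
        unfolding R_def by (rule inner_sum_orthogonal [OF I(1) p])
      also have "\<dots> = (\<Sum>i\<in>I. (v j \<bullet> q i / (q i \<bullet> q i)) * (v j \<bullet> q i / (q i \<bullet> q i)) * (q i \<bullet> q i))"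
        by (intro sum.cong refl) (simp add: dot_square_norm pq)
      also have "\<dots> = b \<bullet> b"
        unfolding b_def frame_proj_def by (rule inner_sum_orthogonal [OF I(1) q, symmetric])
      finally show ?thesis .
    qed
    moreover have "0 \<le> (a - R) \<bullet> (a - R)" by simp
    ultimately have aR: "a \<bullet> R \<le> (a \<bullet> a + b \<bullet> b) / 2"
      by (simp add: inner_diff inner_commute)
    have uu: "u j \<bullet> u j = x j \<bullet> x j + a \<bullet> a" and vv: "v j \<bullet> v j = y j \<bullet> y j + b \<bullet> b"
      using xa yb by (simp_all add: ua vb inner_add inner_commute [of a "x j"] inner_commute [of b "y j"])
    have half_sum: "(a' + b') / 2 = u' - (x' + y') / 2"
      if "u' = x' + a'" "v' = y' + b'" "u' = v'" for a' b' u' v' x' y' :: real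
      using that by (simp add: field_simps)
    have "(a \<bullet> a + b \<bullet> b) / 2 = u j \<bullet> u j - (x j \<bullet> x j + y j \<bullet> y j) / 2"
      by (rule half_sum [OF uu vv gram])
    with aR have "lam * (a \<bullet> R) \<le> lam * (u j \<bullet> u j - (x j \<bullet> x j + y j \<bullet> y j) / 2)"
      using lam by (intro mult_left_mono) auto
    moreover have "u j \<bullet> (G *v v j) = x j \<bullet> (G *v y j) - lam * (a \<bullet> R)"
      by (simp add: ua vb matrix_vector_right_distrib inner_add_left inner_add_right aGy xGb aGb)
    ultimately show ?thesis by linarith
  qed
  define A where "A = (\<Sum>j\<in>J. u j \<bullet> u j)"
  define Q where "Q = (\<Sum>i\<in>I. p i \<bullet> p i)"
  have GMs: "G \<bullet> F - lam * (A - \<tau>) \<le> G \<bullet> Ms"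
  proof -
    have "G \<bullet> F - lam * (A - \<tau>) =
        (\<Sum>j\<in>J. x j \<bullet> (G *v y j) - lam * (u j \<bullet> u j - (x j \<bullet> x j + y j \<bullet> y j) / 2))"
      by (simp only: F_def A_def \<tau>_def inner_sum_right inner_outer sum_subtractf sum_distrib_left [symmetric])
    also have "\<dots> \<le> (\<Sum>j\<in>J. u j \<bullet> (G *v v j))"
      by (intro sum_mono uv_ge)
    finally show ?thesis by (simp add: Ms_u inner_sum_right inner_outer)
  qed
  have GM: "G \<bullet> M = - (lam * Q)"
    by (simp add: I(3) inner_sum_right inner_outer Gq Q_def sum_distrib_left sum_negf)
  have Dxy: "a \<bullet> (D *v b) \<le> (a \<bullet> a + b \<bullet> b) / 2" for a b
  proof -
    have "a \<bullet> (D *v b) \<le> norm a * norm b" by (rule nuclear_norm_subgradient(2) [OF D(1)])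
    also have "\<dots> \<le> (a \<bullet> a + b \<bullet> b) / 2"
      using sum_squares_bound [of "norm a" "norm b"] by (simp add: dot_square_norm)
    finally show ?thesis .
  qed
  have "D \<bullet> M \<le> (\<Sum>i\<in>I. (p i \<bullet> p i + q i \<bullet> q i) / 2)"
    unfolding I(3) inner_sum_right inner_outer by (intro sum_mono Dxy)
  also have "\<dots> = Q"
    unfolding Q_def by (intro sum.cong refl) (simp add: dot_square_norm pq)
  finally have GsM: "- (lam * Q) \<le> Gs \<bullet> M"
    using lam by (simp add: D(2) mult_left_mono)
  have "D \<bullet> F \<le> \<tau>"
    unfolding F_def \<tau>_def inner_sum_right inner_outer by (intro sum_mono Dxy)
  then have GsF: "- (lam * \<tau>) \<le> Gs \<bullet> F"
    using lam by (simp add: D(2) mult_left_mono)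
  \<comment> \<open>The rotation preserves the sum of squares, which for the singular value
    decomposition is at most the nuclear norm.\<close>
  have "A \<le> D \<bullet> Ms"
    using nuc nuclear_norm_subgradient(1) [OF D(1)] sum_u by (simp add: A_def dot_square_norm)
  then have GsMs: "Gs \<bullet> Ms \<le> - (lam * A)"
    using lam by (simp add: D(2) mult_left_mono)
  have g: "Gs - G = gradient UNIV UNIV \<phi> Ms - gradient UNIV UNIV \<phi> M"
    by (simp add: G_def Gs_def)
  have w: "(Gs - G) \<bullet> (Ms - M) = Gs \<bullet> Ms - Gs \<bullet> M - (G \<bullet> Ms - G \<bullet> M)"
    by (simp add: inner_diff)
  have GMs': "G \<bullet> F - lam * A + lam * \<tau> \<le> G \<bullet> Ms"
    using GMs by (simp add: right_diff_distrib)
  have "M = Ms"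
  proof (rule optimum_unique [OF UNIV_domain.recession_domain_axioms \<phi> UNIV_I UNIV_I UNIV_I _ _ _ _ _ bounds(3,4) _
        bounds(1,2) L2_0 gap _ g])
    show "finite (p ` I \<union> u ` J)" by (rule frame_span_bound [OF I(1) J(1) x_def])
    have "card (p ` I \<union> u ` J) \<le> card I + card J" by (rule frame_span_bound [OF I(1) J(1) x_def])
    then show "card (p ` I \<union> u ` J) \<le> ?k" using cards(1) J(2) by linarith
    show "M *v z \<in> span (p ` I \<union> u ` J)" for z
      unfolding I(3) by (rule frame_span_bound [OF I(1) J(1) x_def])
    show "Ms *v z \<in> span (p ` I \<union> u ` J)" for z
      unfolding Ms_u by (rule frame_span_bound [OF I(1) J(1) x_def])
    show "F *v z \<in> span (p ` I \<union> u ` J)" for z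
      unfolding F_def by (rule frame_span_bound [OF I(1) J(1) x_def])
    show "0 < sqrt (real CARD('r) / real rs)" using rs by simp
    show "F \<bullet> (Ms - M - F) = 0"
      unfolding Ms_u I(3) by (rule frame_residual_orthogonal [OF I(1) p q x_def y_def F_def])
    show "(Gs - G) \<bullet> (Ms - M) \<le> (Gs - G) \<bullet> F"
      using GsF GsMs GsM GM GMs' unfolding w inner_diff_left [of Gs G F] by linarith
    have "0 \<le> (\<Sum>j\<in>J. 2 * (x j \<bullet> (G *v y j)) + lam * (x j \<bullet> x j + y j \<bullet> y j) + L2 * s * (x j \<bullet> x j + y j \<bullet> y j))"
      by (intro sum_nonneg escape)
    also have "\<dots> = 2 * (G \<bullet> F) + 2 * (lam * \<tau>) + 2 * (L2 * (s * \<tau>))"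
      by (simp add: F_def \<tau>_def inner_sum_right inner_outer sum.distrib sum_distrib_left mult.assoc)
    finally show "(Gs - G) \<bullet> (Ms - M) \<le> L2 * (s * \<tau>)"
      using GsMs GsM GM GMs' unfolding w by linarith
    show "2 * b * sqrt (real CARD('r) / real rs) * (s * \<tau>) \<le> b\<^sup>2 * (norm F)\<^sup>2 + (norm (Ms - M - F))\<^sup>2"
      if "0 < b" "b \<le> 1" for b
      using bound [OF that] by (simp only: \<tau>_def F_def Ms_u I(3))
  qed
  then show ?thesis by (simp add: M_def)
qed

theorem theorem4:
  fixes rs :: nat and lam :: real
  assumes "1 \<le> rs" and "rs \<le> CARD('r::finite)" and "0 \<le> lam"
  shows
    "(\<forall>(\<phi> :: real ^ 'n ^ 'm \<Rightarrow> real) Ms (U :: real ^ 'r ^ 'm) (V :: real ^ 'r ^ 'n) \<mu> L L2.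
        convex_on UNIV \<phi> \<longrightarrow>
        twice_differentiable_on UNIV UNIV \<phi> \<longrightarrow>
        (\<exists>a b. restricted_sc_smooth UNIV UNIV (CARD('r) + rs) (CARD('r) + rs) a b \<phi>) \<longrightarrow>
        \<mu> = rsc_const UNIV UNIV (CARD('r) + rs) (CARD('r) + rs) \<phi> \<longrightarrow>
        L = rsm_const UNIV UNIV (CARD('r) + rs) (CARD('r) + rs) \<phi> \<longrightarrow>
        L2 = rsm_const UNIV UNIV 2 (CARD('r) + rs) \<phi> \<longrightarrow>
        L2 / (2 * sqrt (real CARD('r) / real rs) + L2 / L) < \<mu> \<longrightarrow>
        rank Ms \<le> rs \<longrightarrow>
        gradient UNIV UNIV \<phi> Ms \<in> (\<lambda>G. - lam *\<^sub>R G) ` subdifferential nuclear_norm Ms \<longrightarrow>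
        second_order_critical
          (\<lambda>(X, Y). \<phi> (X ** transpose Y) + lam * (((norm X)\<^sup>2 + (norm Y)\<^sup>2) / 2)) (U, V) \<longrightarrow>
        U ** transpose V = Ms) \<and>
     (\<forall>(\<phi> :: real ^ 'd ^ 'd \<Rightarrow> real) Ms (U :: real ^ 'r ^ 'd) \<mu> L L2.
        convex_on psd_mats \<phi> \<longrightarrow>
        twice_differentiable_on psd_mats symmetric_mats \<phi> \<longrightarrow>
        (\<exists>a b. restricted_sc_smooth psd_mats symmetric_mats
                 (CARD('r) + rs) (CARD('r) + rs) a b \<phi>) \<longrightarrow>
        \<mu> = rsc_const psd_mats symmetric_mats (CARD('r) + rs) (CARD('r) + rs) \<phi> \<longrightarrow>
        L = rsm_const psd_mats symmetric_mats (CARD('r) + rs) (CARD('r) + rs) \<phi> \<longrightarrow>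
        L2 = rsm_const psd_mats symmetric_mats 2 (CARD('r) + rs) \<phi> \<longrightarrow>
        L2 / (2 * sqrt (real CARD('r) / real rs) + L2 / L) < \<mu> \<longrightarrow>
        Ms \<in> psd_mats \<longrightarrow>
        rank Ms \<le> rs \<longrightarrow>
        (gradient psd_mats symmetric_mats \<phi> Ms + lam *\<^sub>R mat 1) ** Ms = 0 \<longrightarrow>
        gradient psd_mats symmetric_mats \<phi> Ms + lam *\<^sub>R mat 1 \<in> psd_mats \<longrightarrow>
        second_order_critical
          (\<lambda>X. \<phi> (X ** transpose X) + lam * (norm X)\<^sup>2) U \<longrightarrow>
        U ** transpose U = Ms)"
proof (intro conjI allI impI, goal_cases)
  case (1 \<phi> Ms U V \<mu> L L2)
  show ?case
    using 1 by (intro asymmetric_case [OF assms])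
next
  case (2 \<phi> Ms U \<mu> L L2)
  show ?case
    using 2 by (intro symmetric_case [OF assms(1,2)])
qed

end
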